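(* Assume that $\alpha$ is an isogeny. Then the image of the Ribet section $r_f$ in the Poincaré torsor $\mathcal{P}=\Gamma_\alpha(3)\backslash(P_\alpha^u(\mathbb{Z})\backslash D_\alpha)$, a family of semi-abelian varieties over the family $B$ of the $B_\tau$ over $S=\Gamma_\alpha(3)\backslash\mathbb{H}_{d,\alpha}$, is not a torsion translate of a family of algebraic subgroups. More precisely, the union of the images of the sections $nr_f$, with $n\in\mathbb{Z}$ (multiples taken in the group $\mathcal{P}\to B$), is dense, for the Archimedean topology, in a circle bundle of real codimension $1$ in $\mathcal{P}$, whose fibres over the points of $B$ are the maximal compact subgroups of the corresponding complex analytic semi-abelian varieties.
   Context: Matrices and Siegel space. $\mathrm{M}_{m,n}(R)$ denotes $m\times n$ matrices over $R$; $d\ge1$; $\mathbb{H}_d$ is the set of symmetric $\tau\in\mathrm{M}_d(\mathbb{C})$ with $\mathrm{Im}(\tau)$ positive definite. $\mathbb{Z}(1)=2\pi i\mathbb{Z}$, of Hodge type $(-1,-1)$. $\Psi(x,y)=2\pi i\,x^t\begin{pmatrix}0&-1_d\\1_d&0\end{pmatrix}y$ on $\mathbb{Z}^{2d}$. $\mathrm{GSp}(\Psi)(R)$ is the group of pairs $(g,\mu(g))\in\mathrm{GL}_{2d}(R)\times R^\times$ with $\Psi(gx,gy)=\mu(g)\Psi(x,y)$. The set $D$. $M=\mathbb{Z}(1)\oplus\mathbb{Z}^{2d}\oplus\mathbb{Z}$ with $\mathbb{Z}$-basis $2\pi i e_0,e_1,\dots,e_{2d+1}$ and weight filtration $W_{-3}M=0$,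 $W_{-2}M=\mathbb{Z}\cdot 2\pi i e_0$, $W_{-1}M=\mathbb{Z}(1)\oplus\mathbb{Z}^{2d}$, $W_0M=M$. $D$ is the set of filtrations $F$ on $M_{\mathbb{C}}$ such that $(M,W,F)$ is a mixed $\mathbb{Z}$-Hodge structure of type $\{(-1,-1),(-1,0),(0,-1),(0,0)\}$ and $\Psi$ is a polarisation on $\mathrm{Gr}^W_{-1}M=\mathbb{Z}^{2d}$. Such $F$ is given by $F^0$, and $D$ is in bijection with $\mathbb{H}_d\times\mathrm{M}_{1,d}(\mathbb{C})\times\mathrm{M}_{d,1}(\mathbb{C})\times\mathbb{C}$ via $(\tau,u,v,w)\mapsto F^0=\begin{pmatrix}u&w\\ \tau&v\\1_d&0\\0&1\end{pmatrix}\mathbb{C}^{d+1}\subset M_{\mathbb{C}}=\bigoplus_j\mathbb{C}e_j$. Write $\tilde\tau$ for the point $(\tau,0,0,0)$. Groups. With respect to the basis $2\pi i e_0,e_1,\dots,e_{2d+1}$, $P(R)$ is the group of matrices $\begin{pmatrix}\mu(g)&x&z\\0&g&y\\0&0&1\end{pmatrix}$ with $(g,\mu(g))\in\mathrm{GSp}(\Psi)(R)$, $x\in\mathrm{M}_{1,2d}(R)$, $y\in\mathrm{M}_{2d,1}(R)$, $z\in R$; $P^u$ is the subgroup with $g=1$, $\mu(g)=1$ and $U\subset P^u$ the subgroup with moreover $x=0$, $y=0$. $P(\mathbb{R})^+U(\mathbb{C})$ acts on $D$ by acting on $F^0\subset M_{\mathbb{C}}$. Abelian varieties. $A_\tau=\mathrm{M}_{d,1}(\mathbb{C})/(1_d\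 \,-\tau)\mathrm{M}_{2d,1}(\mathbb{Z})$ and $B_\tau=\mathrm{M}_{1,d}(\mathbb{C})/\mathrm{M}_{1,2d}(\mathbb{Z}(1))\begin{pmatrix}\tau\\1_d\end{pmatrix}$. $P^u(\mathbb{Z})\backslash D$ is the universal Poincaré torsor over $\mathbb{H}_d$: its fibre at $\tau$ is the Poincaré $\mathbb{C}^\times$-torsor $\mathcal{P}_\tau$ on $A_\tau\times B_\tau$ ($v$ gives the point of $A_\tau$, $u$ the point of $B_\tau$), which identifies $B_\tau$ with $A_\tau^\vee$ and $A_\tau$ with $B_\tau^\vee$; over $B_\tau$ it is the universal extension of $A_\tau$ by $\mathbb{C}^\times$. The data $f,\alpha$. Fix $\tau_0\in\mathbb{H}_d$ and a morphism $f\colon B_{\tau_0}\to A_{\tau_0}$, with dual $f^\vee\colon B_{\tau_0}\to A_{\tau_0}$, and $\alpha=f-f^\vee$. Let $\alpha_{\mathbb{Z}}\in\mathrm{M}_{2d}(\mathbb{Z})$ be the (symmetric) matrix such that $\alpha$ on lattices is $\mathrm{M}_{1,2d}(\mathbb{Z}(1))\to\mathrm{M}_{2d,1}(\mathbb{Z})$, $2\pi i\,n\mapsto \alpha_{\mathbb{Z}}n^t$. View this map as a map $\mathrm{Gr}^W_{-1}(M)^\vee(1)\to\mathrm{Gr}^W_{-1}(M)$ ( * ). $P_\alpha$ and $G_\alpha$ are the identity components of the stabilisers of ( * ) in $P$ and in $\mathrm{GSp}(\Psi)$; $P_\alpha$ is the inverse image of $G_\alpha$ in $P$, and $P_\alpha^u=P^u$.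 Put $D_\alpha=P_\alpha(\mathbb{R})^+U(\mathbb{C})\cdot\tilde\tau_0\subset D$ and $\mathbb{H}_{d,\alpha}=G_\alpha(\mathbb{R})^+\cdot\tau_0\subset\mathbb{H}_d$. For every $\tau\in\mathbb{H}_{d,\alpha}$, $\alpha_{\mathbb{Z}}$ induces a morphism $\alpha\colon B_\tau\to A_\tau$. $P_\alpha^u(\mathbb{Z})\backslash D_\alpha$ is the universal Poincaré torsor over $\mathbb{H}_{d,\alpha}$. The Ribet section $r_f$. Over each $\tau\in\mathbb{H}_{d,\alpha}$ it is the unique section, with value $1$ at the origin, of the restriction of $\mathcal{P}_\tau$ to the graph of $\alpha\colon B_\tau\to A_\tau$; so it is a section of the universal Poincaré torsor over the family of the $B_\tau$. Level structure. $\Gamma_\alpha(3)$ is the kernel of $G_\alpha(\mathbb{Z})\to G_\alpha(\mathbb{F}_3)$; it acts freely on $\mathbb{H}_{d,\alpha}$, and on $P^u_\alpha(\mathbb{Z})\backslash D_\alpha$ via block matrices $\mathrm{diag}(\mu(g),g,1)\in P_\alpha$, compatibly with the projection to $\mathbb{H}_{d,\alpha}$, with the families of the $A_\tau$ and of the $B_\tau$ over $\mathbb{H}_{d,\alpha}$, with the morphisms $\alpha\colon B_\tau\to A_\tau$, with the structure of Poincaré torsor on $P^u_\alpha(\mathbb{Z})\backslash D_\alpha$ and with the section $r_f$; the families of $A_\tau$, of $B_\tau$, the Poincaré torsor and $r_f$ descend to the quotient by $\Gamma_\alpha(3)$. *)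

theory Defs
  imports "HOL-Analysis.Analysis" "HOL-Algebra.Group"
begin

section \<open>Conventions\<close>

text \<open>The integer \<open>d \<ge> 1\<close> is \<open>CARD('d)\<close>. The lattice \<open>\<int>\<^sup>2\<^sup>d\<close> is indexed by
  \<open>'d + 'd\<close>, and \<open>M\<close> by \<open>unit + ('d + 'd) + unit\<close>: \<open>Inl ()\<close> is the index of
  \<open>e\<^sub>0\<close>, and \<open>Inr (Inr ())\<close> is the index \<open>2d+1\<close> of the last basis vector.
  Rows and columns are both of type \<open>complex ^ _\<close>. For \<open>R\<close>-points, \<open>R\<close> is a subset of the
  complex numbers (\<open>\<int>\<close>, \<open>\<real>\<close> or \<open>UNIV\<close>).\<close>

type_synonym 'd lat = "'d + 'd"
type_synonym 'd mix = "unit + 'd lat + unit"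

text \<open>Coordinates \<open>(\<tau>, u, v, w)\<close> of points of \<open>D\<close>, and pairs \<open>(g, \<mu>)\<close>.\<close>

type_synonym 'd point =
  "((complex, 'd) vec, 'd) vec \<times> (complex, 'd) vec \<times> (complex, 'd) vec \<times> complex"
type_synonym 'd bpoint = "((complex, 'd) vec, 'd) vec \<times> (complex, 'd) vec"
type_synonym 'd gsp = "((complex, 'd lat) vec, 'd lat) vec \<times> complex"
type_synonym 'd pmatrix = "((complex, 'd mix) vec, 'd mix) vec"

definition vec_in :: "complex set \<Rightarrow> complex ^ 'n \<Rightarrow> bool" where
  "vec_in R x \<longleftrightarrow> (\<forall>i. x $ i \<in> R)"

definition mat_in :: "complex set \<Rightarrow> complex ^ 'n ^ 'm \<Rightarrow> bool" where
  "mat_in R A \<longleftrightarrow> (\<forall>i j. A $ i $ j \<in> R)"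

definition siegel :: "(complex ^ 'd ^ 'd) set" where
  "siegel = {\<tau>. transpose \<tau> = \<tau> \<and>
     (\<forall>x :: real ^ 'd. x \<noteq> 0 \<longrightarrow> 0 < x \<bullet> ((\<chi> i j. Im (\<tau> $ i $ j)) *v x))}"


section \<open>Holomorphic functions and analytic subsets\<close>

text \<open>\<open>J\<close> is multiplication by \<open>\<i>\<close> on the complex vector space underlying \<open>'a\<close>.\<close>

definition holomorphic_wrt ::
    "('a::real_normed_vector \<Rightarrow> 'a) \<Rightarrow> 'a set \<Rightarrow> ('a \<Rightarrow> complex) \<Rightarrow> bool" where
  "holomorphic_wrt J U f \<longleftrightarrow>
     (\<forall>p\<in>U. \<exists>D. (f has_derivative D) (at p) \<and> (\<forall>x. D (J x) = \<i> * D x))"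

text \<open>\<open>Z\<close> is a closed analytic subset of \<open>X\<close>; holomorphic functions on \<open>X\<close> are locally
  restrictions of holomorphic functions of the ambient space.\<close>

definition analytic_subset ::
    "('a::real_normed_vector \<Rightarrow> 'a) \<Rightarrow> 'a set \<Rightarrow> 'a set \<Rightarrow> bool" where
  "analytic_subset J X Z \<longleftrightarrow> Z \<subseteq> X \<and>
     (\<forall>p\<in>X. \<exists>U F. open U \<and> p \<in> U \<and> finite F \<and> (\<forall>f\<in>F. holomorphic_wrt J U f) \<and>
        Z \<inter> U = {q \<in> X \<inter> U. \<forall>f\<in>F. f q = 0})"

definition J_vec :: "complex ^ 'd \<Rightarrow> complex ^ 'd" where
  "J_vec u = \<i> *s u"

definition J_chart :: "(complex ^ 'd) \<times> complex \<Rightarrow> (complex ^ 'd) \<times> complex" where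
  "J_chart = (\<lambda>(v, t). (\<i> *s v, \<i> * t))"

definition J_point :: "'d::finite point \<Rightarrow> 'd point" where
  "J_point = (\<lambda>(\<tau>, u, v, w). ((\<chi> i j. \<i> * \<tau> $ i $ j), \<i> *s u, \<i> *s v, \<i> * w))"


section \<open>Identity components of complex linear algebraic groups\<close>

text \<open>Polynomial functions in a given set \<open>X\<close> of coordinate functions.\<close>

inductive_set polyfun :: "('a \<Rightarrow> complex) set \<Rightarrow> ('a \<Rightarrow> complex) set"
  for X :: "('a \<Rightarrow> complex) set" where
  const: "(\<lambda>_. c) \<in> polyfun X"
| coord: "f \<in> X \<Longrightarrow> f \<in> polyfun X"
| add: "f \<in> polyfun X \<Longrightarrow> g \<in> polyfun X \<Longrightarrow> (\<lambda>p. f p + g p) \<in> polyfun X"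
| mult: "f \<in> polyfun X \<Longrightarrow> g \<in> polyfun X \<Longrightarrow> (\<lambda>p. f p * g p) \<in> polyfun X"

definition zariski :: "('a \<Rightarrow> complex) set \<Rightarrow> 'a topology" where
  "zariski X = topology_generated_by {{p. f p \<noteq> 0} | f. f \<in> polyfun X}"

definition zariski_component :: "('a \<Rightarrow> complex) set \<Rightarrow> 'a set \<Rightarrow> 'a \<Rightarrow> 'a set" where
  "zariski_component X S e = connected_component_of_set (subtopology (zariski X) S) e"

definition mat_coords :: "(complex ^ 'n ^ 'n \<Rightarrow> complex) set" where
  "mat_coords = {\<lambda>A. A $ i $ j | i j. True}"

definition gsp_coords :: "('d::finite gsp \<Rightarrow> complex) set" where
  "gsp_coords = {\<lambda>q. fst q $ i $ j | i j. True} \<union> {snd}"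


section \<open>The groups GSp, P, P^u, U\<close>

definition Jmat :: "complex ^ 'd::finite lat ^ 'd lat" where
  "Jmat = (\<chi> i j. case i of
      Inl k \<Rightarrow> (case j of Inl l \<Rightarrow> 0 | Inr l \<Rightarrow> if k = l then -1 else 0)
    | Inr k \<Rightarrow> (case j of Inl l \<Rightarrow> if k = l then 1 else 0 | Inr l \<Rightarrow> 0))"

definition Psi :: "complex ^ 'd::finite lat \<Rightarrow> complex ^ 'd lat \<Rightarrow> complex" where
  "Psi x y = 2 * of_real pi * \<i> * (\<Sum>i\<in>UNIV. x $ i * (Jmat *v y) $ i)"

definition GSp :: "complex set \<Rightarrow> 'd::finite gsp set" where
  "GSp R = {(g, \<mu>).
     mat_in R g \<and> (\<exists>h. mat_in R h \<and> g ** h = mat 1 \<and> h ** g = mat 1) \<and>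
     \<mu> \<in> R \<and> (\<exists>\<nu>\<in>R. \<mu> * \<nu> = 1) \<and>
     (\<forall>x y. vec_in R x \<longrightarrow> vec_in R y \<longrightarrow> Psi (g *v x) (g *v y) = \<mu> * Psi x y)}"

text \<open>The block matrix with rows \<open>(\<mu>, x, z)\<close>, \<open>(0, g, y)\<close>, \<open>(0, 0, 1)\<close>.\<close>

definition pmat :: "complex \<Rightarrow> complex ^ 'd lat ^ 'd lat \<Rightarrow> complex ^ 'd lat \<Rightarrow>
    complex ^ 'd lat \<Rightarrow> complex \<Rightarrow> 'd::finite pmatrix" where
  "pmat \<mu> g x y z = (\<chi> i j. case i of
      Inl _ \<Rightarrow> (case j of Inl _ \<Rightarrow> \<mu> | Inr (Inl l) \<Rightarrow> x $ l | Inr (Inr _) \<Rightarrow> z)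
    | Inr (Inl k) \<Rightarrow> (case j of Inl _ \<Rightarrow> 0 | Inr (Inl l) \<Rightarrow> g $ k $ l | Inr (Inr _) \<Rightarrow> y $ k)
    | Inr (Inr _) \<Rightarrow> (case j of Inl _ \<Rightarrow> 0 | Inr (Inl _) \<Rightarrow> 0 | Inr (Inr _) \<Rightarrow> 1))"

definition Pgrp :: "complex set \<Rightarrow> 'd::finite pmatrix set" where
  "Pgrp R = {pmat \<mu> g x y z | \<mu> g x y z.
     (g, \<mu>) \<in> GSp R \<and> vec_in R x \<and> vec_in R y \<and> z \<in> R}"

definition Pu :: "complex set \<Rightarrow> 'd::finite pmatrix set" where
  "Pu R = {pmat 1 (mat 1) x y z | x y z. vec_in R x \<and> vec_in R y \<and> z \<in> R}"

definition Ugrp :: "complex set \<Rightarrow> 'd::finite pmatrix set" where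
  "Ugrp R = {pmat 1 (mat 1) 0 0 z | z. z \<in> R}"


section \<open>Hodge filtrations and the action of P\<close>

text \<open>From coordinates with respect to the integral basis, which starts with \<open>2\<pi>\<i> e\<^sub>0\<close>, to
  coordinates with respect to the \<open>e\<^sub>j\<close>. Subsets of \<open>M\<^sub>\<complex>\<close> are written in the
  latter, elements of \<open>P\<close> in the former.\<close>

definition to_e :: "complex ^ 'd::finite mix \<Rightarrow> complex ^ 'd mix" where
  "to_e c = (\<chi> i. if i = Inl () then 2 * of_real pi * \<i> * c $ i else c $ i)"

definition from_e :: "complex ^ 'd::finite mix \<Rightarrow> complex ^ 'd mix" where
  "from_e m = (\<chi> i. if i = Inl () then m $ i / (2 * of_real pi * \<i>) else m $ i)"

definition actM :: "'d::finite pmatrix \<Rightarrow> complex ^ 'd mix \<Rightarrow> complex ^ 'd mix" where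
  "actM p m = to_e (p *v from_e m)"

definition F0mat :: "'d::finite point \<Rightarrow> complex ^ ('d + unit) ^ 'd mix" where
  "F0mat = (\<lambda>(\<tau>, u, v, w). \<chi> i j. case i of
      Inl _ \<Rightarrow> (case j of Inl l \<Rightarrow> u $ l | Inr _ \<Rightarrow> w)
    | Inr (Inl (Inl k)) \<Rightarrow> (case j of Inl l \<Rightarrow> \<tau> $ k $ l | Inr _ \<Rightarrow> v $ k)
    | Inr (Inl (Inr k)) \<Rightarrow> (case j of Inl l \<Rightarrow> if k = l then 1 else 0 | Inr _ \<Rightarrow> 0)
    | Inr (Inr _) \<Rightarrow> (case j of Inl _ \<Rightarrow> 0 | Inr _ \<Rightarrow> 1))"

definition F0 :: "'d::finite point \<Rightarrow> (complex ^ 'd mix) set" where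
  "F0 q = range (\<lambda>c. F0mat q *v c)"

definition W_minus1 :: "(complex ^ 'd::finite mix) set" where
  "W_minus1 = {m. m $ Inr (Inr ()) = 0}"

text \<open>\<open>moves p q q'\<close>: \<open>p\<close> maps the point \<open>q\<close> of \<open>D\<close> to \<open>q'\<close>. \<open>moves_B\<close> is the
  same for \<open>F\<^sup>0 \<inter> W\<^sub>-\<^sub>1\<close>, which is spanned by the columns of \<open>u\<close>, \<open>\<tau>\<close>, \<open>1\<close> and
  so depends on \<open>(\<tau>, u)\<close> only.\<close>

definition moves :: "'d::finite pmatrix \<Rightarrow> 'd point \<Rightarrow> 'd point \<Rightarrow> bool" where
  "moves p q q' \<longleftrightarrow> actM p ` F0 q = F0 q'"

definition moves_B :: "'d::finite pmatrix \<Rightarrow> 'd bpoint \<Rightarrow> 'd bpoint \<Rightarrow> bool" where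
  "moves_B p = (\<lambda>(\<tau>, u) (\<tau>', u').
     actM p ` (F0 (\<tau>, u, 0, 0) \<inter> W_minus1) = F0 (\<tau>', u', 0, 0) \<inter> W_minus1)"


section \<open>The abelian varieties A and B, and morphisms from B to A\<close>

definition col_block :: "complex ^ 'd ^ 'd \<Rightarrow> complex ^ 'd ^ 'd lat" where
  "col_block \<tau> = (\<chi> i j. case i of Inl k \<Rightarrow> \<tau> $ k $ j | Inr k \<Rightarrow> if k = j then 1 else 0)"

definition row_block :: "complex ^ 'd ^ 'd \<Rightarrow> complex ^ 'd lat ^ 'd" where
  "row_block \<tau> = (\<chi> i j. case j of Inl l \<Rightarrow> if i = l then 1 else 0 | Inr l \<Rightarrow> - \<tau> $ i $ l)"

definition lattice_A :: "complex ^ 'd ^ 'd \<Rightarrow> (complex ^ 'd) set" where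
  "lattice_A \<tau> = {row_block \<tau> *v m | m. vec_in \<int> m}"

definition lattice_B :: "complex ^ 'd ^ 'd \<Rightarrow> (complex ^ 'd) set" where
  "lattice_B \<tau> = {(2 * of_real pi * \<i>) *s (n v* col_block \<tau>) | n. vec_in \<int> n}"

definition A_var :: "complex ^ 'd ^ 'd \<Rightarrow> (complex ^ 'd) set set" where
  "A_var \<tau> = UNIV // {(x, y). y - x \<in> lattice_A \<tau>}"

definition B_var :: "complex ^ 'd ^ 'd \<Rightarrow> (complex ^ 'd) set set" where
  "B_var \<tau> = UNIV // {(x, y). y - x \<in> lattice_B \<tau>}"

text \<open>A morphism \<open>B\<^sub>\<tau> \<rightarrow> A\<^sub>\<tau>\<close> is given by the matrix of the complex linear map that it
  induces on universal covers, \<open>u \<mapsto> L *v u\<close>.\<close>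

definition morphism_BA :: "complex ^ 'd ^ 'd \<Rightarrow> complex ^ 'd ^ 'd \<Rightarrow> bool" where
  "morphism_BA \<tau> L \<longleftrightarrow> (\<forall>l\<in>lattice_B \<tau>. L *v l \<in> lattice_A \<tau>)"

definition torus_map :: "complex ^ 'd ^ 'd \<Rightarrow> complex ^ 'd ^ 'd \<Rightarrow>
    (complex ^ 'd) set \<Rightarrow> (complex ^ 'd) set" where
  "torus_map \<tau> L b = {(x, y). y - x \<in> lattice_A \<tau>} `` ((\<lambda>u. L *v u) ` b)"

definition isogeny_BA :: "complex ^ 'd ^ 'd \<Rightarrow> complex ^ 'd ^ 'd \<Rightarrow> bool" where
  "isogeny_BA \<tau> L \<longleftrightarrow> morphism_BA \<tau> L \<and> torus_map \<tau> L ` B_var \<tau> = A_var \<tau> \<and>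
     finite {b \<in> B_var \<tau>. torus_map \<tau> L b = lattice_A \<tau>}"

text \<open>\<open>L\<close> is given on lattices by \<open>2\<pi>\<i> n \<mapsto> a n\<^sup>t\<close>.\<close>

definition on_lattices ::
    "complex ^ 'd ^ 'd \<Rightarrow> complex ^ 'd lat ^ 'd lat \<Rightarrow> complex ^ 'd ^ 'd \<Rightarrow> bool" where
  "on_lattices \<tau> a L \<longleftrightarrow> (\<forall>n. vec_in \<int> n \<longrightarrow>
     L *v ((2 * of_real pi * \<i>) *s (n v* col_block \<tau>)) = row_block \<tau> *v (a *v n))"

text \<open>The Poincare torsor \<open>\<P>\<^sub>\<tau>\<close> is the quotient of the \<open>(\<tau>, u, v, w)\<close> by \<open>P\<^sup>u(\<int>)\<close>, with
  \<open>\<complex>\<^sup>\<times>\<close> acting by translating \<open>w\<close> by logarithms.\<close>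

definition poincare_eq :: "'d::finite point \<Rightarrow> 'd point \<Rightarrow> bool" where
  "poincare_eq q q' \<longleftrightarrow> (\<exists>h\<in>Pu \<int>. moves h q q')"

text \<open>With \<open>B\<^sub>\<tau>\<close> the dual of \<open>A\<^sub>\<tau>\<close> and conversely through the Poincare torsor, \<open>L'\<close> is
  the dual of \<open>L\<close> if for every point \<open>b = [u]\<close> of \<open>B\<^sub>\<tau>\<close> the pullback along \<open>L\<close> of
  \<open>\<P>\<^sub>\<tau>|(A\<^sub>\<tau> \<times> b)\<close> is isomorphic to \<open>\<P>\<^sub>\<tau>|(L' b \<times> B\<^sub>\<tau>)\<close> as holomorphic
  \<open>\<complex>\<^sup>\<times>\<close>-torsor on \<open>B\<^sub>\<tau>\<close>. On the universal cover such an isomorphism is multiplication by a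
  nowhere zero entire function \<open>exp \<circ> \<phi>\<close>.\<close>

definition dual_morphism ::
    "complex ^ 'd ^ 'd \<Rightarrow> complex ^ 'd ^ 'd \<Rightarrow> complex ^ 'd ^ 'd \<Rightarrow> bool" where
  "dual_morphism \<tau> L L' \<longleftrightarrow> morphism_BA \<tau> L' \<and>
     (\<forall>u. \<exists>\<phi>. holomorphic_wrt J_vec UNIV \<phi> \<and>
        (\<forall>u1 u2 w1 w2. u2 - u1 \<in> lattice_B \<tau> \<longrightarrow>
           (poincare_eq (\<tau>, u, L *v u1, w1) (\<tau>, u, L *v u2, w2) \<longleftrightarrow>
            poincare_eq (\<tau>, u1, L' *v u, w1 + \<phi> u1) (\<tau>, u2, L' *v u, w2 + \<phi> u2))))"


section \<open>The groups and spaces attached to alpha\<close>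

text \<open>Throughout, \<open>a\<close> is the matrix \<open>\<alpha>\<^sub>\<int>\<close>. \<open>(g, \<mu>)\<close> acts on \<open>Gr\<close> by \<open>g\<close> and on
  \<open>Gr\<^sup>\<or>(1)\<close> by \<open>2\<pi>\<i> n \<mapsto> 2\<pi>\<i> \<mu> n g\<^sup>-\<^sup>1\<close>; the stabiliser of \<open>\<alpha>\<close> consists of those
  \<open>(g, \<mu>)\<close> for which \<open>\<alpha>\<close> is equivariant.\<close>

definition stabilises :: "complex ^ 'd lat ^ 'd lat \<Rightarrow> 'd::finite gsp \<Rightarrow> bool" where
  "stabilises a = (\<lambda>(g, \<mu>). \<forall>n. a *v (\<mu> *s (n v* matrix_inv g)) = g *v (a *v n))"

text \<open>Complex points of \<open>G\<^sub>\<alpha>\<close> and \<open>P\<^sub>\<alpha>\<close>; the points over a smaller ring are obtained by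
  intersecting with \<open>GSp R\<close> and \<open>Pgrp R\<close>.\<close>

definition G_alpha :: "complex ^ 'd lat ^ 'd lat \<Rightarrow> 'd::finite gsp set" where
  "G_alpha a = zariski_component gsp_coords {q \<in> GSp UNIV. stabilises a q} (mat 1, 1)"

definition P_alpha :: "complex ^ 'd lat ^ 'd lat \<Rightarrow> 'd::finite pmatrix set" where
  "P_alpha a = zariski_component mat_coords
     {pmat \<mu> g x y z | \<mu> g x y z. (g, \<mu>) \<in> GSp UNIV \<and> stabilises a (g, \<mu>)} (mat 1)"

definition G_alpha_real_plus :: "complex ^ 'd lat ^ 'd lat \<Rightarrow> 'd::finite gsp set" where
  "G_alpha_real_plus a = connected_component_set (G_alpha a \<inter> GSp \<real>) (mat 1, 1)"

definition P_alpha_real_plus :: "complex ^ 'd lat ^ 'd lat \<Rightarrow> 'd::finite pmatrix set" where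
  "P_alpha_real_plus a = connected_component_set (P_alpha a \<inter> Pgrp \<real>) (mat 1)"

definition H_alpha ::
    "complex ^ 'd ^ 'd \<Rightarrow> complex ^ 'd lat ^ 'd lat \<Rightarrow> (complex ^ 'd ^ 'd) set" where
  "H_alpha \<tau>0 a = {\<tau> \<in> siegel. \<exists>(g, \<mu>)\<in>G_alpha_real_plus a.
     (\<lambda>x. g *v x) ` range (\<lambda>c. col_block \<tau>0 *v c) = range (\<lambda>c. col_block \<tau> *v c)}"

definition D_alpha ::
    "complex ^ 'd ^ 'd \<Rightarrow> complex ^ 'd lat ^ 'd lat \<Rightarrow> 'd::finite point set" where
  "D_alpha \<tau>0 a = {q. fst q \<in> siegel \<and>
     (\<exists>p\<in>P_alpha_real_plus a. \<exists>h\<in>Ugrp UNIV. moves (p ** h) (\<tau>0, 0, 0, 0) q)}"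

definition Gamma_alpha3 :: "complex ^ 'd lat ^ 'd lat \<Rightarrow> 'd::finite gsp set" where
  "Gamma_alpha3 a = {(g, \<mu>) \<in> G_alpha a \<inter> GSp \<int>.
     (\<forall>i j. (g $ i $ j - mat 1 $ i $ j) / 3 \<in> \<int>) \<and> (\<mu> - 1) / 3 \<in> \<int>}"

text \<open>\<open>\<Gamma>\<^sub>\<alpha>(3)\<close>, embedded block diagonally, normalises \<open>P\<^sub>\<alpha>\<^sup>u(\<int>)\<close>. Dividing by \<open>P\<^sub>\<alpha>\<^sup>u(\<int>)\<close>
  and then by \<open>\<Gamma>\<^sub>\<alpha>(3)\<close> is dividing by the following group.\<close>

definition level_group :: "complex ^ 'd lat ^ 'd lat \<Rightarrow> 'd::finite pmatrix set" where
  "level_group a = {pmat \<mu> g 0 0 0 ** h | g \<mu> h.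
     (g, \<mu>) \<in> Gamma_alpha3 a \<and> h \<in> P_alpha a \<inter> Pu \<int>}"


section \<open>The family of semi-abelian varieties\<close>

definition P_rel ::
    "complex ^ 'd ^ 'd \<Rightarrow> complex ^ 'd lat ^ 'd lat \<Rightarrow> ('d::finite point \<times> 'd point) set" where
  "P_rel \<tau>0 a = {(q, q'). q \<in> D_alpha \<tau>0 a \<and> q' \<in> D_alpha \<tau>0 a \<and>
     (\<exists>p\<in>level_group a. moves p q q')}"

definition P_tot ::
    "complex ^ 'd ^ 'd \<Rightarrow> complex ^ 'd lat ^ 'd lat \<Rightarrow> 'd::finite point set set" where
  "P_tot \<tau>0 a = D_alpha \<tau>0 a // P_rel \<tau>0 a"

definition P_top ::
    "complex ^ 'd ^ 'd \<Rightarrow> complex ^ 'd lat ^ 'd lat \<Rightarrow> 'd::finite point set topology" where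
  "P_top \<tau>0 a = topology (\<lambda>V. V \<subseteq> P_tot \<tau>0 a \<and>
     openin (top_of_set (D_alpha \<tau>0 a)) (\<Union>V))"

text \<open>The family of the \<open>B\<^sub>\<tau>\<close> over \<open>\<Gamma>\<^sub>\<alpha>(3) \ H\<close>: the block \<open>x\<close> of an element of
  \<open>P\<^sup>u(\<int>)\<close> translates \<open>u\<close> by the element \<open>2\<pi>\<i> x (\<tau>; 1)\<close> of \<open>lattice_B \<tau>\<close>, and
  the blocks \<open>y\<close> and \<open>z\<close> do not move \<open>(\<tau>, u)\<close>.\<close>

definition B_rel ::
    "complex ^ 'd ^ 'd \<Rightarrow> complex ^ 'd lat ^ 'd lat \<Rightarrow> ('d::finite bpoint \<times> 'd bpoint) set" where
  "B_rel \<tau>0 a = {(q, q'). fst q \<in> H_alpha \<tau>0 a \<and> fst q' \<in> H_alpha \<tau>0 a \<and>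
     (\<exists>p\<in>level_group a. moves_B p q q')}"

definition B_tot ::
    "complex ^ 'd ^ 'd \<Rightarrow> complex ^ 'd lat ^ 'd lat \<Rightarrow> 'd::finite bpoint set set" where
  "B_tot \<tau>0 a = (H_alpha \<tau>0 a \<times> UNIV) // B_rel \<tau>0 a"

definition P_proj :: "complex ^ 'd ^ 'd \<Rightarrow> complex ^ 'd lat ^ 'd lat \<Rightarrow>
    'd::finite point set \<Rightarrow> 'd bpoint set" where
  "P_proj \<tau>0 a c = B_rel \<tau>0 a `` ((\<lambda>(\<tau>, u, v, w). (\<tau>, u)) ` c)"

text \<open>The group law of \<open>\<P> \<rightarrow> B\<close>, written multiplicatively: for fixed \<open>(\<tau>, u)\<close> it is induced by
  addition of \<open>(v, w)\<close>.\<close>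

definition P_fibre :: "complex ^ 'd ^ 'd \<Rightarrow> complex ^ 'd lat ^ 'd lat \<Rightarrow>
    'd::finite bpoint set \<Rightarrow> 'd point set monoid" where
  "P_fibre \<tau>0 a b =
     \<lparr>carrier = {c \<in> P_tot \<tau>0 a. P_proj \<tau>0 a c = b},
      mult = (\<lambda>c c'. P_rel \<tau>0 a `` {(\<tau>, u, v + v', w + w') | \<tau> u v w v' w'.
                (\<tau>, u, v, w) \<in> c \<and> (\<tau>, u, v', w') \<in> c'}),
      one = P_rel \<tau>0 a `` ((\<lambda>(\<tau>, u). (\<tau>, u, 0, 0)) ` b)\<rparr>"

definition Cstar_act :: "complex ^ 'd ^ 'd \<Rightarrow> complex ^ 'd lat ^ 'd lat \<Rightarrow>
    complex \<Rightarrow> 'd::finite point set \<Rightarrow> 'd point set" where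
  "Cstar_act \<tau>0 a t c =
     P_rel \<tau>0 a `` {(\<tau>, u, v, w + s) | \<tau> u v w s. (\<tau>, u, v, w) \<in> c \<and> exp s = t}"


section \<open>The Ribet section\<close>

text \<open>A holomorphic section over \<open>B\<^sub>\<tau>\<close> of the restriction of the Poincare torsor to the graph of
  \<open>\<alpha>\<close> lifts, \<open>\<complex>\<^sup>d\<close> being simply connected, to \<open>u \<mapsto> (\<tau>, u, \<alpha> u, s u)\<close> with \<open>s\<close>
  entire; its value in the fibre \<open>\<complex>\<^sup>\<times>\<close> at the origin is \<open>exp (s 0)\<close>.\<close>

definition is_ribet_section :: "complex ^ 'd ^ 'd \<Rightarrow> complex ^ 'd lat ^ 'd lat \<Rightarrow>
    ('d::finite bpoint set \<Rightarrow> 'd point set) \<Rightarrow> bool" where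
  "is_ribet_section \<tau>0 a r \<longleftrightarrow> r \<in> extensional (B_tot \<tau>0 a) \<and>
     (\<forall>\<tau>\<in>H_alpha \<tau>0 a. \<exists>L s. on_lattices \<tau> a L \<and>
        holomorphic_wrt J_vec UNIV s \<and> exp (s 0) = 1 \<and>
        (\<forall>u. r (B_rel \<tau>0 a `` {(\<tau>, u)}) = P_rel \<tau>0 a `` {(\<tau>, u, L *v u, s u)}))"

definition ribet_section :: "complex ^ 'd ^ 'd \<Rightarrow> complex ^ 'd lat ^ 'd lat \<Rightarrow>
    'd::finite bpoint set \<Rightarrow> 'd point set" where
  "ribet_section \<tau>0 a = (THE r. is_ribet_section \<tau>0 a r)"


section \<open>Torsion translates of families of algebraic subgroups\<close>

text \<open>The semi-abelian variety over \<open>b = [(\<tau>, u)]\<close> is a quotient of the space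
  \<open>\<complex>\<^sup>d \<times> \<complex>\<^sup>\<times>\<close> of pairs \<open>(v, t)\<close> with \<open>t = exp w\<close>, and its compactification, a
  projective line bundle over \<open>A\<^sub>\<tau>\<close>, is covered by the charts in \<open>(v, t)\<close> and \<open>(v, 1/t)\<close>.
  By Chow's theorem the Zariski closed subsets of the semi-abelian variety are the traces
  of the analytic subsets of this projective compactification, that is, the sets whose
  inverse image extends analytically over \<open>t = 0\<close> and over \<open>t = \<infinity>\<close>.\<close>

definition algebraic_subset :: "complex ^ 'd ^ 'd \<Rightarrow> complex ^ 'd lat ^ 'd lat \<Rightarrow>
    'd::finite bpoint set \<Rightarrow> 'd point set set \<Rightarrow> bool" where
  "algebraic_subset \<tau>0 a b K \<longleftrightarrow> K \<subseteq> carrier (P_fibre \<tau>0 a b) \<and>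
     (\<forall>(\<tau>, u)\<in>b. \<exists>Y0 Y1. analytic_subset J_chart UNIV Y0 \<and> analytic_subset J_chart UNIV Y1 \<and>
        (\<forall>v w. (P_rel \<tau>0 a `` {(\<tau>, u, v, w)} \<in> K \<longleftrightarrow> (v, exp w) \<in> Y0) \<and>
               (P_rel \<tau>0 a `` {(\<tau>, u, v, w)} \<in> K \<longleftrightarrow> (v, exp (- w)) \<in> Y1)))"

definition family_of_algebraic_subgroups ::
    "complex ^ 'd ^ 'd \<Rightarrow> complex ^ 'd lat ^ 'd lat \<Rightarrow> 'd::finite point set set \<Rightarrow> bool" where
  "family_of_algebraic_subgroups \<tau>0 a H \<longleftrightarrow> H \<subseteq> P_tot \<tau>0 a \<and>
     analytic_subset J_point (D_alpha \<tau>0 a) (\<Union>H) \<and>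
     (\<forall>b\<in>B_tot \<tau>0 a. subgroup (H \<inter> carrier (P_fibre \<tau>0 a b)) (P_fibre \<tau>0 a b) \<and>
        algebraic_subset \<tau>0 a b (H \<inter> carrier (P_fibre \<tau>0 a b)))"

text \<open>The torsion points \<open>t b\<close> have bounded order, but need not form a holomorphic section.\<close>

definition torsion_translate_of_family ::
    "complex ^ 'd ^ 'd \<Rightarrow> complex ^ 'd lat ^ 'd lat \<Rightarrow> 'd::finite point set set \<Rightarrow> bool" where
  "torsion_translate_of_family \<tau>0 a X \<longleftrightarrow>
     (\<exists>H t. \<exists>N::nat. family_of_algebraic_subgroups \<tau>0 a H \<and> N > 0 \<and>
        (\<forall>b\<in>B_tot \<tau>0 a. t b \<in> carrier (P_fibre \<tau>0 a b) \<and>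
           t b [^]\<^bsub>P_fibre \<tau>0 a b\<^esub> N = \<one>\<^bsub>P_fibre \<tau>0 a b\<^esub>) \<and>
        X = {t b \<otimes>\<^bsub>P_fibre \<tau>0 a b\<^esub> h | b h.
               b \<in> B_tot \<tau>0 a \<and> h \<in> H \<inter> carrier (P_fibre \<tau>0 a b)})"


section \<open>Circle bundles, codimension and maximal compact subgroups\<close>

text \<open>Since \<open>\<P>\<close> is a \<open>\<complex>\<^sup>\<times>\<close>-bundle over \<open>A \<times>\<^sub>S B\<close>, a local trivialisation is an equivariant
  map \<open>\<psi>\<close> to \<open>\<complex>\<^sup>\<times>\<close> on an invariant open set \<open>V\<close>; a circle bundle in \<open>\<P>\<close> corresponds to
  the unit circle in suitable local trivialisations.\<close>

definition circle_subbundle ::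
    "complex ^ 'd ^ 'd \<Rightarrow> complex ^ 'd lat ^ 'd lat \<Rightarrow> 'd::finite point set set \<Rightarrow> bool" where
  "circle_subbundle \<tau>0 a C \<longleftrightarrow> C \<subseteq> P_tot \<tau>0 a \<and>
     (\<forall>c\<in>P_tot \<tau>0 a. \<exists>V \<psi>. openin (P_top \<tau>0 a) V \<and> c \<in> V \<and>
        continuous_map (subtopology (P_top \<tau>0 a) V) euclidean \<psi> \<and>
        (\<forall>x\<in>V. \<psi> x \<noteq> 0) \<and>
        (\<forall>x\<in>V. \<forall>t. t \<noteq> 0 \<longrightarrow>
           Cstar_act \<tau>0 a t x \<in> V \<and> \<psi> (Cstar_act \<tau>0 a t x) = t * \<psi> x) \<and>
        C \<inter> V = {x \<in> V. cmod (\<psi> x) = 1})"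

definition real_codimension_one :: "'a topology \<Rightarrow> 'a set \<Rightarrow> bool" where
  "real_codimension_one T C \<longleftrightarrow> C \<subseteq> topspace T \<and>
     (\<forall>c\<in>C. \<exists>V \<phi>. openin T V \<and> c \<in> V \<and>
        homeomorphic_map (subtopology T V)
          (prod_topology (subtopology T (C \<inter> V)) euclideanreal) \<phi> \<and>
        (\<forall>x\<in>C \<inter> V. \<phi> x = (x, 0)))"

definition maximal_compact_subgroup :: "'a topology \<Rightarrow> 'a monoid \<Rightarrow> 'a set \<Rightarrow> bool" where
  "maximal_compact_subgroup T G K \<longleftrightarrow> subgroup K G \<and> compactin T K \<and>
     (\<forall>K'. subgroup K' G \<and> compactin T K' \<and> K \<subseteq> K' \<longrightarrow> K' = K)"

end

theory Submission
  imports Defs "HOL-Complex_Analysis.Cauchy_Integral_Formula"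
begin

text \<open>A point of \<open>D\<close> is \<open>p (\<tau>, 0, 0, 0)\<close> for a unique unipotent \<open>p\<close> with real entries \<open>x\<close>, \<open>y\<close>
  and a complex entry \<open>z\<close>. In the coordinates \<open>(\<tau>, x, y, z)\<close> the group \<open>P\<close> acts by affine maps, the
  fibre of \<open>\<P>\<close> at \<open>(\<tau>, x)\<close> is the group of pairs \<open>(y, z)\<close> modulo integral pairs, and its maximal compact
  subgroup is \<open>Im z = 0\<close>. On lattices \<open>f\<^sup>\<or>\<close> is minus the transpose of \<open>f\<close>, so \<open>\<alpha>\<^sub>\<int>\<close> is symmetric with
  even diagonal, and the Ribet section is \<open>x \<mapsto> (\<alpha>\<^sub>\<int> x, \<langle>x, \<alpha>\<^sub>\<int> x\<rangle> / 2)\<close>: it is real, whence it lies in the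
  circle bundle, and \<open>\<alpha>\<^sub>\<int>\<close> being invertible, the points \<open>x\<close> at which a multiple \<open>n r\<^sub>f\<close> has a prescribed
  value of \<open>y\<close> become dense with \<open>n\<close> and the values of \<open>z\<close> there become dense modulo 1. A torsion
  translate of a family of subgroups whose fibres are points would be of bounded order.\<close>

section \<open>Bilinear algebra in block coordinates\<close>

text \<open>Minus the transpose comes from Liouville: for each real x the isomorphism in
  \<open>dual_morphism\<close> produces a unitary character of the lattice that is the multiplier of
  an entire function without zeros. The function is bounded, hence constant, so the character is
  trivial, and as x varies its exponent must vanish. The same argument identifies the section, which
  is given only by its properties. Evenness of the diagonal makes \<langle>m, \<alpha> m\<rangle> /
  2 integral, so that the formula descends modulo integers; its invariance under the level group is
  the stabiliser identity g \<alpha> g^t = \<alpha>. Two obstacles shape the middle. The orbit is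
  that of a connected group, obtained by taking identity components twice, for the Zariski and for
  the Euclidean topology; an element of the level group need not preserve it, but by normality it
  does once it maps one point of the orbit into the orbit. The circle bundle needs local
  trivialisations, hence a free and properly discontinuous action; both facts come from the positive
  Hermitian form that the polarisation induces on \<open>F\<^sup>0\<close>, played against
  integrality.\<close>

abbreviation rvec :: "complex ^ 'n \<Rightarrow> bool" where "rvec \<equiv> vec_in \<real>"
abbreviation zvec :: "complex ^ 'n \<Rightarrow> bool" where "zvec \<equiv> vec_in \<int>"
abbreviation rmat :: "complex ^ 'n ^ 'm \<Rightarrow> bool" where "rmat \<equiv> mat_in \<real>"
abbreviation zmat :: "complex ^ 'n ^ 'm \<Rightarrow> bool" where "zmat \<equiv> mat_in \<int>"
abbreviation tpi :: complex where "tpi \<equiv> 2 * complex_of_real pi * \<i>"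

text \<open>Bilinear, without conjugation, because \<open>P\<close> acts complex linearly; where a
  Hermitian form is needed the conjugate \<open>cnjv\<close> is written out.\<close>

definition bdot :: "complex ^ 'n \<Rightarrow> complex ^ 'n \<Rightarrow> complex" where
  "bdot x y = (\<Sum>i\<in>UNIV. x $ i * y $ i)"

definition upper :: "complex ^ 'd lat \<Rightarrow> complex ^ 'd" where "upper m = (\<chi> k. m $ Inl k)"
definition lower :: "complex ^ 'd lat \<Rightarrow> complex ^ 'd" where "lower m = (\<chi> k. m $ Inr k)"
definition blocks :: "complex ^ 'd \<Rightarrow> complex ^ 'd \<Rightarrow> complex ^ 'd lat" where
  "blocks a b = (\<chi> i. case i of Inl k \<Rightarrow> a $ k | Inr k \<Rightarrow> b $ k)"

lemma sum_UNIV_Plus: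
  fixes f :: "'a::finite + 'b::finite \<Rightarrow> 'c::comm_monoid_add"
  shows "(\<Sum>i\<in>UNIV. f i) = (\<Sum>i\<in>UNIV. f (Inl i)) + (\<Sum>i\<in>UNIV. f (Inr i))"
  unfolding UNIV_Plus_UNIV[symmetric] by (subst sum.Plus) auto

lemma upper_blocks [simp]: "upper (blocks a b) = a"
  and lower_blocks [simp]: "lower (blocks a b) = b"
  and blocks_upper_lower [simp]: "blocks (upper m) (lower m) = m"
  by (auto simp: upper_def lower_def blocks_def vec_eq_iff split: sum.split)

lemma lat_eq_iff: "m = n \<longleftrightarrow> upper m = upper n \<and> lower m = lower n"
  by (metis blocks_upper_lower)

lemma upper_lower_linear [simp]:
  "upper (m + n) = upper m + upper n" "lower (m + n) = lower m + lower n"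
  "upper (m - n) = upper m - upper n" "lower (m - n) = lower m - lower n"
  "upper (- m) = - upper m" "lower (- m) = - lower m"
  "upper (c *s m) = c *s upper m" "lower (c *s m) = c *s lower m"
  "upper 0 = 0" "lower 0 = 0"
  by (auto simp: upper_def lower_def vec_eq_iff)

lemma bdot_linear:
  "bdot (x + x') y = bdot x y + bdot x' y" "bdot x (y + y') = bdot x y + bdot x y'"
  "bdot (x - x') y = bdot x y - bdot x' y" "bdot x (y - y') = bdot x y - bdot x y'"
  "bdot (c *s x) y = c * bdot x y" "bdot x (c *s y) = c * bdot x y"
  "bdot 0 y = 0" "bdot x 0 = 0" "bdot (- x) y = - bdot x y" "bdot x (- y) = - bdot x y"
  by (auto simp: bdot_def sum.distrib sum_subtractf sum_distrib_left sum_negf algebra_simps)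

lemma bdot_commute: "bdot x y = bdot y x"
  by (simp add: bdot_def mult.commute)

lemma bdot_axis [simp]: "bdot x (axis i 1) = x $ i" "bdot (axis i 1) x = x $ i"
  by (auto simp: bdot_def axis_def if_distrib if_distribR sum.If_cases)

lemma bdot_eqI: "(\<And>y. bdot x y = bdot x' y) \<Longrightarrow> x = x'"
  by (metis bdot_axis(1) vec_eq_iff)

lemma bdot_blocks: "bdot m n = bdot (upper m) (upper n) + bdot (lower m) (lower n)"
  by (simp add: bdot_def upper_def lower_def sum_UNIV_Plus)

lemma bdot_vmult: "bdot (x v* A) y = bdot x (A *v y)"
  unfolding bdot_def vector_matrix_mult_def matrix_vector_mult_def
  by (simp add: sum_distrib_left sum_distrib_right) (subst sum.swap, simp add: mult_ac)

lemma bdot_transpose: "bdot (transpose A *v x) y = bdot x (A *v y)"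
  by (metis bdot_vmult transpose_matrix_vector)

lemma vmult_linear:
  fixes A :: "complex ^ 'n ^ 'm"
  shows "(x + y) v* A = x v* A + y v* A" "(x - y) v* A = x v* A - y v* A"
    "(c *s x) v* A = c *s (x v* A)" "0 v* A = 0" "(- x) v* A = - (x v* A)"
  by (auto simp: vector_matrix_mult_def vec_eq_iff sum.distrib sum_subtractf sum_distrib_left
      sum_negf algebra_simps)

lemma mvmult_linear:
  fixes A :: "complex ^ 'n ^ 'm"
  shows "A *v (x + y) = A *v x + A *v y" "A *v (x - y) = A *v x - A *v y"
    "A *v (c *s x) = c *s (A *v x)" "A *v 0 = 0" "A *v (- x) = - (A *v x)"
  by (auto simp: matrix_vector_mult_def vec_eq_iff sum.distrib sum_subtractf sum_distrib_left
      sum_negf algebra_simps)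

lemma vmult_assoc: "(x v* A) v* B = x v* (A ** B)" for A :: "complex ^ 'n ^ 'm"
  by (rule bdot_eqI) (simp add: bdot_vmult matrix_vector_mul_assoc)

lemma vmult_mat_1 [simp]: "x v* mat 1 = x" for x :: "complex ^ 'n"
  by (rule bdot_eqI) (simp add: bdot_vmult)

lemma col_block_mult: "col_block \<tau> *v c = blocks (\<tau> *v c) c"
  by (auto simp: col_block_def blocks_def vec_eq_iff matrix_vector_mult_def if_distribR if_distrib
      sum.If_cases split: sum.split)

lemma row_block_mult: "row_block \<tau> *v m = upper m - \<tau> *v lower m"
  by (auto simp: row_block_def upper_def lower_def vec_eq_iff matrix_vector_mult_def sum_UNIV_Plus
      if_distribR if_distrib sum.If_cases sum_negf)

lemma vmult_col_block: "n v* col_block \<tau> = upper n v* \<tau> + lower n"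
  by (rule bdot_eqI) (simp add: bdot_vmult col_block_mult bdot_blocks bdot_linear)

lemma row_col_block [simp]: "row_block \<tau> *v (col_block \<tau> *v c) = 0"
  by (simp add: row_block_mult col_block_mult)

lemma lower_col_block [simp]: "lower (col_block \<tau> *v c) = c"
  by (simp add: col_block_mult)

text \<open>\<open>row_block \<tau>\<close> is the projection onto the upper block along the columns
  of \<open>col_block \<tau>\<close>; the lower block of a vector is its parameter in that column
  space.\<close>

lemma lat_decomp: "m = blocks (row_block \<tau> *v m) 0 + col_block \<tau> *v lower m"
  by (simp add: lat_eq_iff row_block_mult col_block_mult)

text \<open>The subspace \<open>F\<^sup>0\<close> of \<open>Gr\<close>, Lagrangian for
  \<open>Psi\<close> when \<tau> is symmetric. Writing the action of g as an equality of such
  subspaces avoids inverting a block at every use; the fractional linear formula enters later, with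
  \<open>mobius\<close>.\<close>

definition Lag :: "complex ^ 'd ^ 'd \<Rightarrow> (complex ^ 'd lat) set" where
  "Lag \<tau> = range (\<lambda>c. col_block \<tau> *v c)"

lemma Lag_iff: "m \<in> Lag \<tau> \<longleftrightarrow> row_block \<tau> *v m = 0"
proof
  assume "row_block \<tau> *v m = 0"
  then have "m = col_block \<tau> *v lower m"
    using lat_decomp[of m \<tau>] by (simp add: lat_eq_iff)
  then show "m \<in> Lag \<tau>" by (auto simp: Lag_def)
qed (auto simp: Lag_def)

lemma Lag_inject: "Lag \<tau> = Lag \<tau>' \<Longrightarrow> \<tau> = \<tau>'"
proof -
  assume eq: "Lag \<tau> = Lag \<tau>'"
  have "\<tau> *v c = \<tau>' *v c" for c
  proof -
    have "col_block \<tau> *v c \<in> Lag \<tau>'" using eq by (auto simp: Lag_def)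
    then show ?thesis by (simp add: Lag_iff row_block_mult col_block_mult)
  qed
  then show ?thesis by (simp add: matrix_eq)
qed


section \<open>The action on Hodge filtrations\<close>

definition mixvec :: "complex \<Rightarrow> complex ^ 'd lat \<Rightarrow> complex \<Rightarrow> complex ^ 'd::finite mix" where
  "mixvec a m k = (\<chi> i. case i of Inl _ \<Rightarrow> a | Inr (Inl j) \<Rightarrow> m $ j | Inr (Inr _) \<Rightarrow> k)"

lemma mixvec_eq_iff [simp]: "mixvec a m k = mixvec a' m' k' \<longleftrightarrow> a = a' \<and> m = m' \<and> k = k'"
proof
  assume "mixvec a m k = mixvec a' m' k'"
  then have *: "mixvec a m k $ i = mixvec a' m' k' $ i" for i by simp
  show "a = a' \<and> m = m' \<and> k = k'"
    using *[of "Inl ()"] *[of "Inr (Inl _)"] *[of "Inr (Inr ())"]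
    by (auto simp: mixvec_def vec_eq_iff)
qed simp

lemma mixvec_cases: obtains a m k where "x = mixvec a m k"
proof
  show "x = mixvec (x $ Inl ()) (\<chi> j. x $ Inr (Inl j)) (x $ Inr (Inr ()))"
    by (auto simp: mixvec_def vec_eq_iff split: sum.split)
qed

lemma pmat_mixvec:
  "pmat \<mu> g x y z *v mixvec a m k = mixvec (\<mu> * a + bdot x m + z * k) (g *v m + k *s y) k"
  unfolding pmat_def mixvec_def bdot_def matrix_vector_mult_def
  by (auto simp: vec_eq_iff sum_UNIV_Plus split: sum.split)

lemma to_from_mixvec:
  "to_e (mixvec a m k) = mixvec (tpi * a) m k" "from_e (mixvec a m k) = mixvec (a / tpi) m k"
  by (auto simp: to_e_def from_e_def mixvec_def vec_eq_iff split: sum.split)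

lemma actM_mixvec:
  "actM (pmat \<mu> g x y z) (mixvec a m k) =
     mixvec (\<mu> * a + tpi * (bdot x m + z * k)) (g *v m + k *s y) k"
  by (simp add: actM_def to_from_mixvec pmat_mixvec field_simps)

lemma from_to_e [simp]: "from_e (to_e c) = c"
  by (auto simp: to_e_def from_e_def vec_eq_iff)

lemma actM_mult: "actM (p ** q) m = actM p (actM q m)"
  by (simp add: actM_def matrix_vector_mul_assoc)

lemma actM_id [simp]: "actM (mat 1) m = m"
  by (auto simp: actM_def to_e_def from_e_def vec_eq_iff)

lemma moves_mult: "moves p q q' \<Longrightarrow> moves p' q' q'' \<Longrightarrow> moves (p' ** p) q q''"
  unfolding moves_def by (metis (no_types, lifting) actM_mult image_image image_cong)

lemma pmat_mult:
  "pmat \<mu> g x y z ** pmat \<mu>' g' x' y' z' =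
     pmat (\<mu> * \<mu>') (g ** g') (\<mu> *s x' + x v* g') (g *v y' + y) (\<mu> * z' + bdot x y' + z)"
proof -
  have "(pmat \<mu> g x y z ** pmat \<mu>' g' x' y' z') *v v =
      pmat (\<mu> * \<mu>') (g ** g') (\<mu> *s x' + x v* g') (g *v y' + y) (\<mu> * z' + bdot x y' + z) *v v" for v
    by (cases v rule: mixvec_cases)
      (simp add: pmat_mixvec flip: matrix_vector_mul_assoc,
       simp add: bdot_linear bdot_vmult mvmult_linear matrix_vector_mul_assoc algebra_simps
         vector_add_ldistrib vector_smult_assoc)
  then show ?thesis by (simp add: matrix_eq)
qed

lemma pmat_inject [simp]:
  "pmat \<mu> g x y z = pmat \<mu>' g' x' y' z' \<longleftrightarrow> \<mu> = \<mu>' \<and> g = g' \<and> x = x' \<and> y = y' \<and> z = z'"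
proof
  assume eq: "pmat \<mu> g x y z = pmat \<mu>' g' x' y' z'"
  have *: "mixvec (\<mu> * a + bdot x m + z * k) (g *v m + k *s y) k =
      mixvec (\<mu>' * a + bdot x' m + z' * k) (g' *v m + k *s y') k" for a m k
    using eq pmat_mixvec by metis
  have "\<mu> = \<mu>'" using *[of 1 0 0] by (simp add: bdot_linear)
  moreover have "z = z'" "y = y'" using *[of 0 0 1] by (simp_all add: bdot_linear)
  moreover have "x = x'" using *[of 0 _ 0] by (simp add: bdot_eqI)
  moreover have "g = g'" using *[of 0 _ 0] by (simp add: matrix_eq)
  ultimately show "\<mu> = \<mu>' \<and> g = g' \<and> x = x' \<and> y = y' \<and> z = z'" by simp
qed simp

lemma pmat_id: "pmat 1 (mat 1) 0 0 0 = mat 1"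
proof -
  have "pmat 1 (mat 1) 0 0 0 *v v = v" for v
    by (cases v rule: mixvec_cases) (simp add: pmat_mixvec bdot_linear)
  then show ?thesis by (metis matrix_eq matrix_vector_mul_lid)
qed

lemma F0_eq:
  "F0 (\<tau>, u, v, w) =
     {mixvec (bdot u c + k * w) (col_block \<tau> *v c + k *s blocks v 0) k | c k. True}"
proof -
  have *: "F0mat (\<tau>, u, v, w) *v b =
     mixvec (bdot u (\<chi> l. b $ Inl l) + b $ Inr () * w)
       (col_block \<tau> *v (\<chi> l. b $ Inl l) + b $ Inr () *s blocks v 0) (b $ Inr ())" for b
    unfolding F0mat_def mixvec_def bdot_def col_block_def blocks_def
    by (auto simp: vec_eq_iff sum_UNIV_Plus matrix_vector_mult_def UNIV_unit split: sum.split)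
  show ?thesis
  proof (safe; clarsimp simp: F0_def *)
    fix c k
    show "mixvec (bdot u c + k * w) (col_block \<tau> *v c + k *s blocks v 0) k \<in> range (\<lambda>ca.
        mixvec (bdot u (\<chi> l. ca $ Inl l) + ca $ Inr () * w)
       (col_block \<tau> *v (\<chi> l. ca $ Inl l) + ca $ Inr () *s blocks v 0) (ca $ Inr ()))"
      by (rule range_eqI[of _ _ "\<chi> i. case i of Inl l \<Rightarrow> c $ l | Inr _ \<Rightarrow> k"]) simp
  qed auto
qed

text \<open>The point of \<open>D\<close> with \<open>F\<^sup>0 = p F\<^sup>0(\<tau>, 0, 0, 0)\<close>, where \<open>p\<close> is the unipotent matrix with
  entries \<open>x\<close>, \<open>y\<close>, \<open>z\<close>. For real \<open>x\<close>, \<open>y\<close> these are coordinates on \<open>D\<close> in which the action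
  of \<open>P\<close> is affine.\<close>

definition upt :: "complex ^ 'd ^ 'd \<Rightarrow> complex ^ 'd lat \<Rightarrow> complex ^ 'd" where
  "upt \<tau> x = tpi *s (x v* col_block \<tau>)"

definition pt :: "complex ^ 'd ^ 'd \<Rightarrow> complex ^ 'd lat \<Rightarrow> complex ^ 'd lat \<Rightarrow> complex \<Rightarrow>
    'd::finite point" where
  "pt \<tau> x y z = (\<tau>, upt \<tau> x, row_block \<tau> *v y, tpi * z - bdot (upt \<tau> x) (lower y))"

lemma F0_base: "F0 (\<tau>, 0, 0, 0) = {mixvec 0 m k | m k. m \<in> Lag \<tau>}"
  by (auto simp: F0_eq Lag_def bdot_linear lat_eq_iff)

text \<open>By \<open>lat_decomp\<close> the \<open>Lag\<close> part of k y is absorbed into the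
  parameter, c becoming c + k \<open>lower y\<close>. This renormalisation of the last column costs
  \<open>bdot (upt \<tau> x) (lower y)\<close>, which is the correction in the fourth coordinate of
  \<open>pt\<close>.\<close>

lemma F0_pt: "F0 (pt \<tau> x y z) = actM (pmat 1 (mat 1) x y z) ` F0 (\<tau>, 0, 0, 0)"
proof -
  have *: "actM (pmat 1 (mat 1) x y z) (mixvec 0 (col_block \<tau> *v c) k) =
     mixvec (bdot (upt \<tau> x) (c + k *s lower y) + k * (tpi * z - bdot (upt \<tau> x) (lower y)))
       (col_block \<tau> *v (c + k *s lower y) + k *s blocks (row_block \<tau> *v y) 0) k" for c k
    by (simp add: actM_mixvec lat_eq_iff mvmult_linear row_block_mult col_block_mult bdot_linear
        upt_def bdot_vmult algebra_simps vector_sub_rdistrib vector_ssub_ldistrib)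
  show ?thesis
  proof safe
    fix m assume "m \<in> F0 (pt \<tau> x y z)"
    then obtain c k where m: "m = mixvec (bdot (upt \<tau> x) c + k * (tpi * z - bdot (upt \<tau> x) (lower y)))
       (col_block \<tau> *v c + k *s blocks (row_block \<tau> *v y) 0) k"
      by (auto simp: pt_def F0_eq)
    then have "m = actM (pmat 1 (mat 1) x y z) (mixvec 0 (col_block \<tau> *v (c - k *s lower y)) k)"
      using *[of "c - k *s lower y" k] by simp
    then show "m \<in> actM (pmat 1 (mat 1) x y z) ` F0 (\<tau>, 0, 0, 0)"
      by (auto simp: F0_base Lag_def)
  next
    fix m assume "m \<in> F0 (\<tau>, 0, 0, 0)"
    then obtain c k where m: "m = mixvec 0 (col_block \<tau> *v c) k"
      by (auto simp: F0_base Lag_def)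
    show "actM (pmat 1 (mat 1) x y z) m \<in> F0 (pt \<tau> x y z)"
      unfolding m * by (auto simp: pt_def F0_eq)
  qed
qed

section \<open>The Siegel space\<close>

definition cvec :: "real ^ 'n \<Rightarrow> complex ^ 'n" where "cvec r = (\<chi> i. of_real (r $ i))"
definition Rev :: "complex ^ 'n \<Rightarrow> real ^ 'n" where "Rev x = (\<chi> i. Re (x $ i))"
definition Imv :: "complex ^ 'n \<Rightarrow> real ^ 'n" where "Imv x = (\<chi> i. Im (x $ i))"
definition Rem :: "complex ^ 'n ^ 'm \<Rightarrow> real ^ 'n ^ 'm" where "Rem A = (\<chi> i j. Re (A $ i $ j))"
definition Imm :: "complex ^ 'n ^ 'm \<Rightarrow> real ^ 'n ^ 'm" where "Imm A = (\<chi> i j. Im (A $ i $ j))"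

lemma vec_in_ops:
  assumes "rvec x" "rvec y"
  shows "rvec (x + y)" "rvec (x - y)" "rvec (- x)"
  using assms by (auto simp: vec_in_def)

lemma vec_in_0 [simp]: "rvec 0" "zvec 0"
  by (auto simp: vec_in_def)

lemma vec_in_Ints_Reals: "zvec x \<Longrightarrow> rvec x"
  unfolding vec_in_def by (metis Ints_cases Reals_of_int)

lemma vec_in_scale: "c \<in> \<real> \<Longrightarrow> rvec x \<Longrightarrow> rvec (c *s x)"
  by (auto simp: vec_in_def)

lemma vec_in_mvmult: "rmat A \<Longrightarrow> rvec x \<Longrightarrow> rvec (A *v x)"
  by (auto simp: vec_in_def mat_in_def matrix_vector_mult_def intro!: sum_in_Reals)

lemma vec_in_vmult: "rmat A \<Longrightarrow> rvec x \<Longrightarrow> rvec (x v* A)"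
  by (auto simp: vec_in_def mat_in_def vector_matrix_mult_def intro!: sum_in_Reals)

lemma vec_in_upper_lower: "vec_in R m \<Longrightarrow> vec_in R (upper m)" "vec_in R m \<Longrightarrow> vec_in R (lower m)"
  by (auto simp: vec_in_def upper_def lower_def)

lemma vec_in_blocks: "vec_in R a \<Longrightarrow> vec_in R b \<Longrightarrow> vec_in R (blocks a b)"
  by (auto simp: vec_in_def blocks_def split: sum.split)

lemma vec_in_cvec [simp]: "rvec (cvec r)"
  by (auto simp: vec_in_def cvec_def)

lemma cvec_Rev: "rvec x \<Longrightarrow> cvec (Rev x) = x"
  by (auto simp: vec_in_def cvec_def Rev_def vec_eq_iff)

lemma Imv_real: "rvec x \<Longrightarrow> Imv x = 0"
  by (simp add: vec_in_def Imv_def vec_eq_iff complex_is_Real_iff)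

lemma Rev_Imv_linear [simp]:
  "Rev (x + y) = Rev x + Rev y" "Imv (x + y) = Imv x + Imv y"
  "Rev (x - y) = Rev x - Rev y" "Imv (x - y) = Imv x - Imv y"
  "Rev (- x) = - Rev x" "Imv (- x) = - Imv x" "Rev 0 = 0" "Imv 0 = 0"
  "Rev (\<i> *s x) = - Imv x" "Imv (\<i> *s x) = Rev x"
  "Rev (cvec r) = r" "Imv (cvec r) = 0"
  by (auto simp: Rev_def Imv_def vec_eq_iff cvec_def)

lemma vec_complex_eqI: "Rev x = Rev y \<Longrightarrow> Imv x = Imv y \<Longrightarrow> x = y"
  by (auto simp: Rev_def Imv_def vec_eq_iff complex_eq_iff)

lemma Rev_Imv_mult:
  "Rev (A *v x) = Rem A *v Rev x - Imm A *v Imv x"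
  "Imv (A *v x) = Rem A *v Imv x + Imm A *v Rev x"
  by (auto simp: Rev_def Imv_def Rem_def Imm_def matrix_vector_mult_def vec_eq_iff
      sum_subtractf sum.distrib)

lemma siegel_symmetric: "\<tau> \<in> siegel \<Longrightarrow> transpose \<tau> = \<tau>"
  by (simp add: siegel_def)

lemma siegel_pos: "\<tau> \<in> siegel \<Longrightarrow> x \<noteq> 0 \<Longrightarrow> 0 < x \<bullet> (Imm \<tau> *v x)"
  by (simp add: siegel_def Imm_def)

lemma siegel_Imm_inj: "\<tau> \<in> siegel \<Longrightarrow> Imm \<tau> *v x = 0 \<Longrightarrow> x = 0"
  using siegel_pos by fastforce

text \<open>Taking imaginary parts leaves \<open>Imm \<tau> *v Rev b = 0\<close>, and a positive
  definite form has no kernel. Together with the surjectivity below, real lattice vectors become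
  coordinates twice: through \<open>upt\<close> for u and through \<open>row_block\<close> for
  v.\<close>

lemma siegel_real_independent:
  assumes "\<tau> \<in> siegel" "rvec a" "rvec b" "a + \<tau> *v b = 0"
  shows "a = 0" "b = 0"
proof -
  have "Imv (a + \<tau> *v b) = 0" using assms by simp
  then have "Imm \<tau> *v Rev b = 0"
    using assms(2,3) by (simp add: Imv_real Rev_Imv_mult)
  then have "Rev b = 0" using siegel_Imm_inj assms by blast
  then show "b = 0" using assms by (intro vec_complex_eqI) (auto simp: Imv_real)
  then show "a = 0" using assms(4) by simp
qed

lemma siegel_Imm_surj:
  assumes "\<tau> \<in> siegel"
  obtains r where "Imm \<tau> *v r = s"
proof -
  have "inj ((*v) (Imm \<tau>))"
    using siegel_Imm_inj[OF assms] by (subst linear_injective_0) auto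
  then have "surj ((*v) (Imm \<tau>))"
    by (simp add: linear_injective_imp_surjective)
  then show ?thesis using that by (metis surjD)
qed

lemma siegel_real_span:
  assumes "\<tau> \<in> siegel"
  obtains a b where "rvec a" "rvec b" "u = a + \<tau> *v b"
proof -
  obtain r where r: "Imm \<tau> *v r = Imv u" using siegel_Imm_surj[OF assms] .
  have "u = cvec (Rev u - Rem \<tau> *v r) + \<tau> *v cvec r"
    using r by (intro vec_complex_eqI) (auto simp: Rev_Imv_mult)
  then show ?thesis using that vec_in_cvec by blast
qed

lemma siegel_vmult: "\<tau> \<in> siegel \<Longrightarrow> x v* \<tau> = \<tau> *v x"
  by (metis siegel_symmetric transpose_matrix_vector)

lemma upt_cong_iff:
  assumes "\<tau> \<in> siegel" "rvec x" "rvec x'"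
  shows "upt \<tau> x = upt \<tau> x' \<longleftrightarrow> x = x'"
proof
  assume "upt \<tau> x = upt \<tau> x'"
  then have "(x - x') v* col_block \<tau> = 0" by (simp add: upt_def vmult_linear)
  then have "lower (x - x') + \<tau> *v upper (x - x') = 0"
    using assms(1) unfolding vmult_col_block siegel_vmult[OF assms(1)] by (simp add: add.commute)
  from siegel_real_independent[OF assms(1) _ _ this] assms
  show "x = x'" by (simp add: lat_eq_iff vec_in_upper_lower vec_in_ops)
qed simp

lemma row_block_cong_iff:
  assumes "\<tau> \<in> siegel" "rvec x" "rvec x'"
  shows "row_block \<tau> *v x = row_block \<tau> *v x' \<longleftrightarrow> x = x'"
proof
  assume "row_block \<tau> *v x = row_block \<tau> *v x'"
  then have "row_block \<tau> *v (x - x') = 0" by (simp add: mvmult_linear)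
  then have "upper (x - x') + \<tau> *v (- lower (x - x')) = 0"
    by (simp add: row_block_mult mvmult_linear algebra_simps)
  from siegel_real_independent[OF assms(1) _ _ this] assms
  show "x = x'" by (simp add: lat_eq_iff vec_in_upper_lower vec_in_ops)
qed simp

lemma upt_surj:
  assumes "\<tau> \<in> siegel"
  obtains x where "rvec x" "u = upt \<tau> x"
proof -
  obtain a b where ab: "rvec a" "rvec b" "(1 / tpi) *s u = a + \<tau> *v b"
    using siegel_real_span[OF assms] .
  have "u = tpi *s ((1 / tpi) *s u)" by (simp add: vector_smult_assoc)
  also have "\<dots> = upt \<tau> (blocks b a)"
    by (simp add: ab(3) upt_def vmult_col_block siegel_vmult[OF assms] add.commute)
  finally show ?thesis using that ab vec_in_blocks by blast
qed

lemma row_block_surj: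
  assumes "\<tau> \<in> siegel"
  obtains y where "rvec y" "v = row_block \<tau> *v y"
proof -
  obtain a b where ab: "rvec a" "rvec b" "v = a + \<tau> *v b"
    using siegel_real_span[OF assms] .
  have "v = row_block \<tau> *v blocks a (- b)"
    by (simp add: ab(3) row_block_mult mvmult_linear)
  then show ?thesis using that ab vec_in_blocks vec_in_ops(3) by blast
qed

lemma pt_surj:
  assumes "fst q \<in> siegel"
  obtains x y z where "rvec x" "rvec y" "q = pt (fst q) x y z"
proof -
  obtain \<tau> u v w where q: "q = (\<tau>, u, v, w)" by (cases q)
  then have "\<tau> \<in> siegel" using assms by simp
  then obtain x y where xy: "rvec x" "u = upt \<tau> x" "rvec y" "v = row_block \<tau> *v y"
    using upt_surj row_block_surj by metis
  have "q = pt (fst q) x y ((w + bdot u (lower y)) / tpi)"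
    using xy q by (simp add: pt_def)
  then show ?thesis using that xy by blast
qed

lemma fst_pt [simp]: "fst (pt \<tau> x y z) = \<tau>"
  by (simp add: pt_def)

text \<open>Restricted to \<open>Lag \<tau>\<close>, x is u up to 2\<pi>i, and a real x is
  determined by u. This is how real unipotent entries are read off from an equality of
  filtrations.\<close>

lemma Lag_annihilator_real:
  assumes "\<tau> \<in> siegel" "rvec x" "\<And>m. m \<in> Lag \<tau> \<Longrightarrow> bdot x m = 0"
  shows "x = 0"
proof -
  have "upt \<tau> x = upt \<tau> 0"
    using assms(3) by (auto simp: upt_def Lag_def vmult_linear intro!: bdot_eqI)
      (auto simp: bdot_linear bdot_vmult)
  then show ?thesis by (simp add: upt_cong_iff assms)
qed

text \<open>Images of vectors with k = 0 force X to annihilate \<open>Lag \<tau>\<close>; the vector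
  with m = 0, k = 1 gives Z = 0 and puts Y into \<open>Lag \<tau>'\<close>. Reality then kills X and
  Y, whereas Z may be complex.\<close>

lemma moves_base:
  assumes "\<tau>' \<in> siegel" "\<tau> \<in> siegel" "rvec X" "rvec Y"
  shows "moves (pmat \<mu> g X Y Z) (\<tau>, 0, 0, 0) (\<tau>', 0, 0, 0) \<longleftrightarrow>
    (*v) g ` Lag \<tau> = Lag \<tau>' \<and> X = 0 \<and> Y = 0 \<and> Z = 0" (is "?L \<longleftrightarrow> ?R")
proof
  assume ?L
  then have eq: "actM (pmat \<mu> g X Y Z) ` {mixvec 0 m k | m k. m \<in> Lag \<tau>} =
      {mixvec 0 m k | m k. m \<in> Lag \<tau>'}"
    by (simp add: moves_def F0_base)
  have *: "bdot X m + Z * k = 0 \<and> g *v m + k *s Y \<in> Lag \<tau>'" if "m \<in> Lag \<tau>" for m k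
  proof -
    have "actM (pmat \<mu> g X Y Z) (mixvec 0 m k) \<in> {mixvec 0 m k | m k. m \<in> Lag \<tau>'}"
      using that eq by blast
    then show ?thesis by (auto simp: actM_mixvec)
  qed
  have 0: "0 \<in> Lag \<tau>" by (simp add: Lag_iff mvmult_linear)
  have "X = 0" using *[of _ 0] by (intro Lag_annihilator_real[OF assms(2,3)]) simp
  moreover have "Z = 0" using *[OF 0, of 1] by (simp add: bdot_linear)
  moreover have "row_block \<tau>' *v Y = row_block \<tau>' *v 0"
    using *[OF 0, of 1] by (simp add: Lag_iff mvmult_linear)
  then have "Y = 0" by (simp only: row_block_cong_iff assms vec_in_0)
  moreover have "(*v) g ` Lag \<tau> = Lag \<tau>'"
  proof
    show "(*v) g ` Lag \<tau> \<subseteq> Lag \<tau>'" using *[of _ 0] by auto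
    show "Lag \<tau>' \<subseteq> (*v) g ` Lag \<tau>"
    proof
      fix m assume "m \<in> Lag \<tau>'"
      then have "mixvec 0 m 0 \<in> actM (pmat \<mu> g X Y Z) ` {mixvec 0 m k | m k. m \<in> Lag \<tau>}"
        unfolding eq by blast
      then show "m \<in> (*v) g ` Lag \<tau>" by (auto simp: actM_mixvec)
    qed
  qed
  ultimately show ?R by simp
next
  assume R: ?R
  have "actM (pmat \<mu> g X Y Z) (mixvec 0 m k) = mixvec 0 (g *v m) k" for m k
    using R by (simp add: actM_mixvec bdot_linear)
  then have "actM (pmat \<mu> g X Y Z) ` {mixvec 0 m k | m k. m \<in> Lag \<tau>} =
      {mixvec 0 m k | m k. m \<in> (*v) g ` Lag \<tau>}"
  proof (intro equalityI subsetI)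
    fix v assume "v \<in> {mixvec 0 m k | m k. m \<in> (*v) g ` Lag \<tau>}"
    then obtain m k where "m \<in> Lag \<tau>" "v = actM (pmat \<mu> g X Y Z) (mixvec 0 m k)"
      using \<open>\<And>m k. actM (pmat \<mu> g X Y Z) (mixvec 0 m k) = mixvec 0 (g *v m) k\<close> by auto
    then show "v \<in> actM (pmat \<mu> g X Y Z) ` {mixvec 0 m k | m k. m \<in> Lag \<tau>}" by blast
  qed auto
  then show ?L using R by (simp add: moves_def F0_base)
qed

lemma pmat_unipotent_inverse:
  "pmat 1 (mat 1) (- x) (- y) (bdot x y - z) ** pmat 1 (mat 1) x y z = mat 1"
  by (simp add: pmat_mult bdot_linear pmat_id flip: pmat_id)

lemma actM_inj: "q ** p = mat 1 \<Longrightarrow> inj (actM p)"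
  by (rule inj_on_inverseI[of _ "actM q"]) (simp flip: actM_mult)

lemma moves_pt:
  assumes \<tau>: "\<tau> \<in> siegel" "\<tau>' \<in> siegel" and g: "rmat g" "\<mu> \<in> \<real>"
    and real: "rvec x0" "rvec y0" "rvec x" "rvec y" "rvec x'" "rvec y'"
  shows "moves (pmat \<mu> g x0 y0 z0) (pt \<tau> x y z) (pt \<tau>' x' y' z') \<longleftrightarrow>
    (*v) g ` Lag \<tau> = Lag \<tau>' \<and> x' v* g = \<mu> *s x + x0 \<and> y' = g *v y + y0 \<and>
    z' = \<mu> * z + bdot x0 y + z0"
proof -
  \<comment> \<open>The product of p with the unipotent matrix of x, y, z is rewritten as the
    unipotent matrix of x', y', z' times a remainder with blocks X, Y, Z. So p carries one point to
    the other iff the remainder maps the base point over \<tau> to the one over \<tau>'.\<close>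
  define X Y where "X = \<mu> *s x + x0 - x' v* g" and "Y = g *v y + y0 - y'"
  define Z where "Z = \<mu> * z + bdot x0 y + z0 - z' - bdot x' Y"
  have "pmat \<mu> g x0 y0 z0 ** pmat 1 (mat 1) x y z = pmat 1 (mat 1) x' y' z' ** pmat \<mu> g X Y Z"
    by (simp add: pmat_mult X_def Y_def Z_def)
  then have *: "actM (pmat \<mu> g x0 y0 z0) ` F0 (pt \<tau> x y z) =
      actM (pmat 1 (mat 1) x' y' z') ` actM (pmat \<mu> g X Y Z) ` F0 (\<tau>, 0, 0, 0)"
    unfolding F0_pt image_image by (simp flip: actM_mult)
  have "moves (pmat \<mu> g x0 y0 z0) (pt \<tau> x y z) (pt \<tau>' x' y' z') \<longleftrightarrow>
      moves (pmat \<mu> g X Y Z) (\<tau>, 0, 0, 0) (\<tau>', 0, 0, 0)"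
    unfolding moves_def * F0_pt[of \<tau>'] using actM_inj[OF pmat_unipotent_inverse]
    by (rule inj_image_eq_iff)
  also have "\<dots> \<longleftrightarrow> (*v) g ` Lag \<tau> = Lag \<tau>' \<and> X = 0 \<and> Y = 0 \<and> Z = 0"
    using assms unfolding X_def Y_def
    by (intro moves_base) (auto intro!: vec_in_ops vec_in_scale vec_in_mvmult vec_in_vmult)
  also have "\<dots> \<longleftrightarrow> (*v) g ` Lag \<tau> = Lag \<tau>' \<and> x' v* g = \<mu> *s x + x0 \<and> y' = g *v y + y0 \<and>
    z' = \<mu> * z + bdot x0 y + z0"
    by (auto simp: X_def Y_def Z_def bdot_linear)
  finally show ?thesis .
qed

lemma F0_W_minus1: "F0 (\<tau>, upt \<tau> x, 0, 0) \<inter> W_minus1 = {mixvec (tpi * bdot x m) m 0 | m. m \<in> Lag \<tau>}"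
proof -
  have "mixvec a m k \<in> W_minus1 \<longleftrightarrow> k = 0" for a k and m :: "complex ^ 'a lat"
    by (simp add: W_minus1_def mixvec_def)
  then show ?thesis
    by (auto simp: F0_eq Lag_def upt_def bdot_linear bdot_vmult)
qed

lemma moves_B_pt:
  assumes \<tau>: "\<tau> \<in> siegel" "\<tau>' \<in> siegel" and g: "rmat g" "\<mu> \<in> \<real>"
    and real: "rvec x0" "rvec x" "rvec x'"
  shows "moves_B (pmat \<mu> g x0 y0 z0) (\<tau>, upt \<tau> x) (\<tau>', upt \<tau>' x') \<longleftrightarrow>
    (*v) g ` Lag \<tau> = Lag \<tau>' \<and> x' v* g = \<mu> *s x + x0" (is "?L \<longleftrightarrow> ?R")
proof -
  have act: "actM (pmat \<mu> g x0 y0 z0) (mixvec (tpi * bdot x m) m 0) =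
      mixvec (tpi * bdot (\<mu> *s x + x0) m) (g *v m) 0" for m
    by (simp add: actM_mixvec bdot_linear algebra_simps)
  have L: "?L \<longleftrightarrow> {mixvec (tpi * bdot (\<mu> *s x + x0) m) (g *v m) 0 | m. m \<in> Lag \<tau>} =
      {mixvec (tpi * bdot x' m) m 0 | m. m \<in> Lag \<tau>'}"
    unfolding moves_B_def prod.case F0_W_minus1 Setcompr_eq_image image_image act ..
  show ?thesis
  proof
    assume ?L
    note eq = L[THEN iffD1, OF this]
    have *: "g *v m \<in> Lag \<tau>' \<and> bdot (\<mu> *s x + x0) m = bdot x' (g *v m)" if "m \<in> Lag \<tau>" for m
    proof -
      have "mixvec (tpi * bdot (\<mu> *s x + x0) m) (g *v m) 0 \<in> {mixvec (tpi * bdot x' m) m 0 | m. m \<in> Lag \<tau>'}"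
        using eq that by blast
      then show ?thesis by auto
    qed
    have "(*v) g ` Lag \<tau> = Lag \<tau>'"
    proof
      show "(*v) g ` Lag \<tau> \<subseteq> Lag \<tau>'" using * by auto
      show "Lag \<tau>' \<subseteq> (*v) g ` Lag \<tau>"
      proof
        fix m assume "m \<in> Lag \<tau>'"
        then have "mixvec (tpi * bdot x' m) m 0 \<in> {mixvec (tpi * bdot (\<mu> *s x + x0) m) (g *v m) 0 | m. m \<in> Lag \<tau>}"
          unfolding eq by blast
        then show "m \<in> (*v) g ` Lag \<tau>" by auto
      qed
    qed
    moreover have "\<mu> *s x + x0 - x' v* g = 0"
      using assms * by (intro Lag_annihilator_real[of \<tau>])
        (auto simp: bdot_linear bdot_vmult intro!: vec_in_ops vec_in_scale vec_in_vmult)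
    ultimately show ?R by simp
  next
    assume R: ?R
    have "bdot (\<mu> *s x + x0) m = bdot x' (g *v m)" for m
      using R by (metis bdot_vmult)
    then have "{mixvec (tpi * bdot (\<mu> *s x + x0) m) (g *v m) 0 | m. m \<in> Lag \<tau>} =
        (\<lambda>m. mixvec (tpi * bdot x' m) m 0) ` (*v) g ` Lag \<tau>"
      by (simp only: Setcompr_eq_image image_image)
    then show ?L unfolding L using R by (simp only: Setcompr_eq_image)
  qed
qed

section \<open>Points of the groups over subrings\<close>

text \<open>The part of the ring axioms used by matrix products, so that \<int>, \<real> and the
  complex numbers are treated together; inverses are supplied by \<open>GSp\<close> itself.\<close>

definition subring_pts :: "complex set \<Rightarrow> bool" where
  "subring_pts R \<longleftrightarrow> 0 \<in> R \<and> 1 \<in> R \<and> (\<forall>x\<in>R. \<forall>y\<in>R. x + y \<in> R \<and> x * y \<in> R)"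

lemma subring_pts [simp]: "subring_pts UNIV" "subring_pts \<real>" "subring_pts \<int>"
  by (auto simp: subring_pts_def)

lemma subring_pts_sum: "subring_pts R \<Longrightarrow> (\<And>i. i \<in> I \<Longrightarrow> f i \<in> R) \<Longrightarrow> sum f I \<in> R"
  by (induction I rule: infinite_finite_induct) (auto simp: subring_pts_def)

lemma mat_in_mult: "subring_pts R \<Longrightarrow> mat_in R A \<Longrightarrow> mat_in R B \<Longrightarrow> mat_in R (A ** B)"
  by (auto simp: mat_in_def matrix_matrix_mult_def intro!: subring_pts_sum) (auto simp: subring_pts_def)

lemma mat_in_mvmult: "subring_pts R \<Longrightarrow> mat_in R A \<Longrightarrow> vec_in R x \<Longrightarrow> vec_in R (A *v x)"
  by (auto simp: mat_in_def vec_in_def matrix_vector_mult_def intro!: subring_pts_sum)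
    (auto simp: subring_pts_def)

lemma mat_in_vmult: "subring_pts R \<Longrightarrow> mat_in R A \<Longrightarrow> vec_in R x \<Longrightarrow> vec_in R (x v* A)"
  by (auto simp: mat_in_def vec_in_def vector_matrix_mult_def intro!: subring_pts_sum)
    (auto simp: subring_pts_def)

lemma bdot_in: "subring_pts R \<Longrightarrow> vec_in R x \<Longrightarrow> vec_in R y \<Longrightarrow> bdot x y \<in> R"
  by (auto simp: vec_in_def bdot_def intro!: subring_pts_sum) (auto simp: subring_pts_def)

lemma mat_in_1: "subring_pts R \<Longrightarrow> mat_in R (mat 1)"
  by (auto simp: mat_in_def mat_def subring_pts_def)

lemma Psi_bdot: "Psi x y = tpi * bdot x (Jmat *v y)"
  by (simp add: Psi_def bdot_def)

lemma mvmult_axis: "(A *v axis j 1) $ i = A $ i $ j" for A :: "complex ^ 'n ^ 'm"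
  by (simp add: matrix_vector_mult_def axis_def if_distrib sum.If_cases cong: if_cong)

lemma bilinear_form_ext:
  assumes "\<And>i j. bdot (axis i 1) (A *v axis j 1) = bdot (axis i 1) (B *v axis j 1)"
  shows "A = B"
proof -
  have "A $ i $ j = B $ i $ j" for i j
    using assms[of i j] by (simp add: mvmult_axis)
  then show ?thesis by (simp add: vec_eq_iff)
qed

lemma bdot_mvmult: "bdot (A *v x) y = bdot x (transpose A *v y)"
  by (metis bdot_commute bdot_transpose transpose_transpose)

text \<open>The standard basis vectors are points over every such R, so the similitude identity on
  R-points is an identity of matrices and holds for all complex vectors; conjugate vectors may then
  be inserted.\<close>

lemma GSp_iff:
  assumes "subring_pts R"
  shows "(g, \<mu>) \<in> GSp R \<longleftrightarrow> mat_in R g \<and> (\<exists>h. mat_in R h \<and> g ** h = mat 1 \<and> h ** g = mat 1) \<and>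
     \<mu> \<in> R \<and> (\<exists>\<nu>\<in>R. \<mu> * \<nu> = 1) \<and>
     (\<forall>x y. bdot (g *v x) (Jmat *v (g *v y)) = \<mu> * bdot x (Jmat *v y))"
proof -
  have "bdot (g *v x) (Jmat *v (g *v y)) = \<mu> * bdot x (Jmat *v y)"
    if *: "\<And>x y. vec_in R x \<Longrightarrow> vec_in R y \<Longrightarrow> Psi (g *v x) (g *v y) = \<mu> * Psi x y" for x y
  proof -
    have R: "vec_in R (axis i 1)" for i
      using assms by (auto simp: vec_in_def axis_def subring_pts_def)
    have "transpose g ** Jmat ** g = (\<chi> i j. \<mu> * Jmat $ i $ j)" (is "_ = ?J")
    proof (rule bilinear_form_ext)
      fix i j :: "'a + 'a"
      have "?J *v axis j 1 = \<mu> *s (Jmat *v axis j 1)"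
        by (auto simp: vec_eq_iff matrix_vector_mult_def sum_distrib_left mult.assoc)
      then show "bdot (axis i 1) ((transpose g ** Jmat ** g) *v axis j 1) = bdot (axis i 1) (?J *v axis j 1)"
        using *[OF R R, of i j] bdot_mvmult[of g "axis i 1" "Jmat *v (g *v axis j 1)"]
        by (simp add: Psi_bdot matrix_vector_mul_assoc matrix_mul_assoc bdot_linear
            del: transpose_matrix_vector bdot_axis)
    qed
    moreover have "?J *v y = \<mu> *s (Jmat *v y)"
      by (auto simp: vec_eq_iff matrix_vector_mult_def sum_distrib_left mult.assoc)
    ultimately have "(transpose g ** Jmat ** g) *v y = \<mu> *s (Jmat *v y)" by simp
    then show ?thesis
      by (simp add: bdot_mvmult bdot_linear matrix_vector_mul_assoc matrix_mul_assoc
          del: transpose_matrix_vector)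
  qed
  then show ?thesis unfolding GSp_def by (auto simp: Psi_bdot)
qed

lemma GSp_mult:
  assumes "subring_pts R" "(g, \<mu>) \<in> GSp R" "(g', \<mu>') \<in> GSp R"
  shows "(g ** g', \<mu> * \<mu>') \<in> GSp R"
proof -
  obtain h h' where h: "mat_in R h" "g ** h = mat 1" "h ** g = mat 1"
    "mat_in R h'" "g' ** h' = mat 1" "h' ** g' = mat 1"
    using assms by (auto simp: GSp_iff)
  have "g ** g' ** (h' ** h) = g ** (g' ** h') ** h" "h' ** h ** (g ** g') = h' ** (h ** g) ** g'"
    by (simp_all only: matrix_mul_assoc)
  then have hh: "g ** g' ** (h' ** h) = mat 1" "h' ** h ** (g ** g') = mat 1" "mat_in R (h' ** h)"
    using h assms(1) by (simp_all add: mat_in_mult)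
  obtain n n' where n: "n \<in> R" "\<mu> * n = 1" "n' \<in> R" "\<mu>' * n' = 1"
    using assms by (auto simp: GSp_iff)
  have "n * n' \<in> R" using assms n by (auto simp: subring_pts_def)
  moreover have "(\<mu> * \<mu>') * (n * n') = (\<mu> * n) * (\<mu>' * n')" by (simp add: mult_ac)
  ultimately have "\<exists>\<nu>\<in>R. \<mu> * \<mu>' * \<nu> = 1" using n by (metis mult_1)
  moreover have "mat_in R (g ** g')" "\<mu> * \<mu>' \<in> R"
    using assms by (auto simp: GSp_iff mat_in_mult) (auto simp: subring_pts_def)
  moreover have "bdot ((g ** g') *v x) (Jmat *v ((g ** g') *v y)) = \<mu> * \<mu>' * bdot x (Jmat *v y)" for x y
    using assms by (simp add: GSp_iff flip: matrix_vector_mul_assoc)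
  ultimately show ?thesis using hh assms(1) by (auto simp: GSp_iff)
qed

lemma GSp_inverse:
  assumes "subring_pts R" "(g, \<mu>) \<in> GSp R"
  obtains h \<nu> where "(h, \<nu>) \<in> GSp R" "g ** h = mat 1" "h ** g = mat 1" "\<mu> * \<nu> = 1"
proof -
  obtain h \<nu> where h: "mat_in R h" "g ** h = mat 1" "h ** g = mat 1" "\<nu> \<in> R" "\<mu> * \<nu> = 1"
    using assms by (auto simp: GSp_iff)
  have "bdot (h *v x) (Jmat *v (h *v y)) = \<nu> * bdot x (Jmat *v y)" for x y
  proof -
    have "bdot (g *v (h *v x)) (Jmat *v (g *v (h *v y))) = \<mu> * bdot (h *v x) (Jmat *v (h *v y))"
      using assms by (simp add: GSp_iff)
    then have "bdot x (Jmat *v y) = \<mu> * bdot (h *v x) (Jmat *v (h *v y))"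
      using h(2) by (simp add: matrix_vector_mul_assoc)
    then have "\<nu> * bdot x (Jmat *v y) = (\<mu> * \<nu>) * bdot (h *v x) (Jmat *v (h *v y))" by simp
    then show ?thesis using h(5) by simp
  qed
  then have "(h, \<nu>) \<in> GSp R"
    using assms h by (auto simp: GSp_iff mult.commute)
  then show ?thesis using that h by blast
qed

lemma GSp_one: "subring_pts R \<Longrightarrow> (mat 1, 1) \<in> GSp R"
  by (auto simp: GSp_iff mat_in_1 subring_pts_def intro!: exI[of _ "mat 1"])

lemma GSp_mono: "subring_pts R \<Longrightarrow> GSp R \<subseteq> GSp UNIV"
  by (auto simp: GSp_iff mat_in_def)

lemma GSp_Ints_Reals: "(GSp \<int> :: 'b::finite gsp set) \<subseteq> GSp \<real>"
proof -
  have "x \<in> \<real>" if "x \<in> \<int>" for x :: complex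
    using that by (metis Ints_cases Reals_of_int)
  then have "rmat g" if "zmat g" for g :: "complex ^ 'b lat ^ 'b lat"
    using that by (simp add: mat_in_def)
  moreover have "\<exists>\<nu>\<in>\<real>. \<mu> * \<nu> = 1" if "\<exists>\<nu>\<in>\<int>. \<mu> * \<nu> = 1" for \<mu> :: complex
    using that \<open>\<And>x. x \<in> \<int> \<Longrightarrow> x \<in> \<real>\<close> by blast
  ultimately have "(g, \<mu>) \<in> GSp \<real>" if "(g, \<mu>) \<in> GSp \<int>" for g :: "complex ^ 'b lat ^ 'b lat" and \<mu>
    using that \<open>\<And>x. x \<in> \<int> \<Longrightarrow> x \<in> \<real>\<close> unfolding GSp_iff[OF subring_pts(2)] GSp_iff[OF subring_pts(3)]
    by metis
  then show ?thesis by auto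
qed

text \<open>Substituting n g for n removes the inverse: the condition becomes g a g^t = \<mu> a,
  which multiplies well and, for \<mu> = 1, makes the quadratic form of a invariant.\<close>

lemma stabilises_iff:
  assumes "(g, \<mu>) \<in> GSp UNIV"
  shows "stabilises a (g, \<mu>) \<longleftrightarrow> (\<forall>n. g *v (a *v (n v* g)) = \<mu> *s (a *v n))"
proof -
  have inv: "g ** matrix_inv g = mat 1" "matrix_inv g ** g = mat 1"
  proof -
    have "\<exists>h. g ** h = mat 1 \<and> h ** g = mat 1" using assms by (auto simp: GSp_iff)
    from someI_ex[OF this] show "g ** matrix_inv g = mat 1" "matrix_inv g ** g = mat 1"
      by (simp_all add: matrix_inv_def)
  qed
  show ?thesis unfolding stabilises_def prod.case
  proof safe
    fix n assume "\<forall>n. a *v (\<mu> *s (n v* matrix_inv g)) = g *v (a *v n)"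
    then have "a *v (\<mu> *s ((n v* g) v* matrix_inv g)) = g *v (a *v (n v* g))" by blast
    then show "g *v (a *v (n v* g)) = \<mu> *s (a *v n)"
      by (simp add: vmult_assoc inv mvmult_linear)
  next
    fix n assume "\<forall>n. g *v (a *v (n v* g)) = \<mu> *s (a *v n)"
    then have "g *v (a *v ((n v* matrix_inv g) v* g)) = \<mu> *s (a *v (n v* matrix_inv g))" by blast
    then show "a *v (\<mu> *s (n v* matrix_inv g)) = g *v (a *v n)"
      by (simp add: vmult_assoc inv mvmult_linear)
  qed
qed

definition Stab :: "complex ^ 'd lat ^ 'd lat \<Rightarrow> 'd::finite gsp set" where
  "Stab a = {q \<in> GSp UNIV. stabilises a q}"

lemma Stab_iff: "(g, \<mu>) \<in> Stab a \<longleftrightarrow> (g, \<mu>) \<in> GSp UNIV \<and> (\<forall>n. g *v (a *v (n v* g)) = \<mu> *s (a *v n))"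
  by (auto simp: Stab_def stabilises_iff)

lemma Stab_mult:
  assumes "(g, \<mu>) \<in> Stab a" "(g', \<mu>') \<in> Stab a"
  shows "(g ** g', \<mu> * \<mu>') \<in> Stab a"
proof -
  have "(g ** g') *v (a *v (n v* (g ** g'))) = (\<mu> * \<mu>') *s (a *v n)" for n
    using assms
    by (simp add: Stab_iff mvmult_linear flip: matrix_vector_mul_assoc vmult_assoc)
  then show ?thesis using assms by (auto simp: Stab_iff GSp_mult)
qed

lemma Stab_inverse:
  assumes "(g, \<mu>) \<in> Stab a" "(h, \<nu>) \<in> GSp UNIV" "g ** h = mat 1" "h ** g = mat 1" "\<mu> * \<nu> = 1"
  shows "(h, \<nu>) \<in> Stab a"
proof -
  have "h *v (a *v (n v* h)) = \<nu> *s (a *v n)" for n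
  proof -
    have "g *v (a *v ((n v* h) v* g)) = \<mu> *s (a *v (n v* h))" using assms(1) by (auto simp: Stab_iff)
    then have "g *v (a *v n) = \<mu> *s (a *v (n v* h))" by (simp add: vmult_assoc assms(4))
    then have "h *v (g *v (a *v n)) = \<mu> *s (h *v (a *v (n v* h)))" by (simp add: mvmult_linear)
    moreover have "h *v (g *v (a *v n)) = a *v n"
      by (metis assms(4) matrix_vector_mul_assoc matrix_vector_mul_lid)
    ultimately have "\<nu> *s (a *v n) = (\<nu> * \<mu>) *s (h *v (a *v (n v* h)))"
      by (simp add: vector_smult_assoc)
    then show ?thesis using assms(5) by (simp add: mult.commute)
  qed
  then show ?thesis using assms(2) by (auto simp: Stab_iff)
qed

lemma Stab_one: "(mat 1, 1) \<in> Stab a"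
  by (simp add: Stab_iff GSp_one)


section \<open>Identity components\<close>

lemma topspace_zariski [simp]: "topspace (zariski X) = UNIV"
proof -
  have "UNIV = {p. (\<lambda>_. 1 :: complex) p \<noteq> 0}" by simp
  then have "UNIV \<in> {{p. f p \<noteq> 0} | f. f \<in> polyfun X}"
    using polyfun.const[of 1 X] by (intro CollectI exI[of _ "\<lambda>_. 1"] conjI)
  then show ?thesis
    unfolding zariski_def topology_generated_by_topspace by (intro top_le Union_upper)
qed

lemma polyfun_compose:
  assumes "f \<in> polyfun Y" "\<And>g. g \<in> Y \<Longrightarrow> (\<lambda>p. g (\<phi> p)) \<in> polyfun X"
  shows "(\<lambda>p. f (\<phi> p)) \<in> polyfun X"
  using assms(1) by induction (auto intro: polyfun.intros assms(2))

lemma polyfun_sum: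
  "finite I \<Longrightarrow> (\<And>i. i \<in> I \<Longrightarrow> f i \<in> polyfun X) \<Longrightarrow> (\<lambda>p. \<Sum>i\<in>I. f i p) \<in> polyfun X"
  by (induction I rule: finite_induct) (auto intro: polyfun.intros)

lemma continuous_map_zariski:
  assumes "\<And>g. g \<in> Y \<Longrightarrow> (\<lambda>p. g (\<phi> p)) \<in> polyfun X"
  shows "continuous_map (zariski X) (zariski Y) \<phi>"
proof -
  have "openin (zariski X) (\<phi> -` U)" if U: "U \<in> {{p. f p \<noteq> 0} | f. f \<in> polyfun Y}" for U
  proof -
    obtain f where f: "U = {p. f p \<noteq> 0}" "f \<in> polyfun Y" using U by auto
    have "\<phi> -` U \<in> {{p. f p \<noteq> 0} | f. f \<in> polyfun X}"
      by (intro CollectI exI[of _ "\<lambda>p. f (\<phi> p)"] conjI polyfun_compose[OF f(2) assms])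
        (auto simp: f(1))
    then show ?thesis unfolding zariski_def by (rule topology_generated_by_Basis)
  qed
  moreover have "\<Union> {{p. f p \<noteq> 0} | f. f \<in> polyfun Y} = UNIV"
    using topspace_zariski[of Y] unfolding zariski_def topology_generated_by_topspace .
  ultimately show ?thesis
    unfolding zariski_def[of Y] continuous_on_generated_topo_iff by simp
qed

lemma continuous_map_euclidean_zariski:
  assumes "\<And>f. f \<in> X \<Longrightarrow> continuous_on UNIV f"
  shows "continuous_map euclidean (zariski X) (\<lambda>x. x)"
proof -
  have cont: "continuous_on UNIV f" if "f \<in> polyfun X" for f
    using that by induction (use assms in \<open>auto intro: continuous_on_add continuous_on_mult\<close>)
  have "openin euclidean U" if "U \<in> {{p. f p \<noteq> 0} | f. f \<in> polyfun X}" for U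
    using that cont by (auto intro!: open_Collect_neq continuous_intros)
  moreover have "\<Union> {{p. f p \<noteq> 0} | f. f \<in> polyfun X} = UNIV"
    using topspace_zariski[of X] unfolding zariski_def topology_generated_by_topspace .
  ultimately show ?thesis
    unfolding zariski_def[of X] continuous_on_generated_topo_iff by simp
qed

text \<open>Polynomial functions are continuous, so the Zariski topology is coarser than the
  Euclidean one; straight lines in the unipotent part therefore stay within one Zariski
  component.\<close>

lemma connectedin_zariski:
  assumes "\<And>f. f \<in> X \<Longrightarrow> continuous_on UNIV f" "connected T"
  shows "connectedin (zariski X) T"
  using connectedin_continuous_map_image[OF continuous_map_euclidean_zariski[OF assms(1)], of X T] assms(2)
  by simp

lemma zariski_component_subset: "zariski_component X S e \<subseteq> S"
  unfolding zariski_component_def using connected_component_of_subset_topspace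
  by (metis (no_types, lifting) inf_top.left_neutral topspace_subtopology topspace_zariski)

lemma connectedin_zariski_component: "connectedin (zariski X) (zariski_component X S e)"
  using connectedin_connected_component_of[of "subtopology (zariski X) S" e]
  by (simp add: zariski_component_def connectedin_subtopology)

lemma zariski_component_self: "e \<in> S \<Longrightarrow> e \<in> zariski_component X S e"
  by (simp add: zariski_component_def connected_component_of_refl)

lemma zariski_component_absorb:
  assumes "connectedin (zariski X) T" "T \<subseteq> S" "q \<in> T" "q \<in> zariski_component X S e"
  shows "T \<subseteq> zariski_component X S e"
proof -
  have "T \<subseteq> connected_component_of_set (subtopology (zariski X) S) q"
    using assms by (intro connected_component_of_maximal) (auto simp: connectedin_subtopology)
  also have "\<dots> = zariski_component X S e"
    using assms(4) unfolding zariski_component_def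
    by (metis connected_component_of_equiv mem_Collect_eq)
  finally show ?thesis .
qed

lemma connected_component_absorb:
  assumes "connected T" "T \<subseteq> S" "q \<in> T" "q \<in> connected_component_set S e"
  shows "T \<subseteq> connected_component_set S e"
  using connected_component_maximal[OF assms(3,1,2)] assms(4)
  by (metis connected_component_eq)

lemma mat_coords_continuous: "f \<in> mat_coords \<Longrightarrow> continuous_on UNIV f"
  by (auto simp: mat_coords_def intro!: continuous_intros)

section \<open>Group structure of the identity components\<close>

definition gmult :: "'d::finite gsp \<Rightarrow> 'd gsp \<Rightarrow> 'd gsp" where
  "gmult = (\<lambda>(g, \<mu>) (g', \<mu>'). (g ** g', \<mu> * \<mu>'))"

lemma gsp_coord_polyfun: "(\<lambda>p. fst p $ i $ j) \<in> polyfun gsp_coords" "snd \<in> polyfun gsp_coords"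
  "(\<lambda>p. snd p) \<in> polyfun gsp_coords"
  by (auto intro!: polyfun.coord simp: gsp_coords_def)

lemma mat_coord_polyfun: "(\<lambda>p. p $ i $ j) \<in> polyfun mat_coords"
  by (auto intro!: polyfun.coord simp: mat_coords_def)

lemma gmult_zariski: "continuous_map (zariski gsp_coords) (zariski gsp_coords) (gmult q)"
proof (rule continuous_map_zariski)
  fix f :: "'a gsp \<Rightarrow> complex" assume "f \<in> gsp_coords"
  then consider i j where "f = (\<lambda>q. fst q $ i $ j)" | "f = snd" by (auto simp: gsp_coords_def)
  then show "(\<lambda>p. f (gmult q p)) \<in> polyfun gsp_coords"
  proof cases
    case 1
    then have "(\<lambda>p. f (gmult q p)) = (\<lambda>p. \<Sum>k\<in>UNIV. fst q $ i $ k * fst p $ k $ j)"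
      by (auto simp: gmult_def matrix_matrix_mult_def split: prod.splits)
    then show ?thesis by (auto intro!: polyfun_sum polyfun.mult polyfun.const gsp_coord_polyfun)
  next
    case 2
    then have "(\<lambda>p. f (gmult q p)) = (\<lambda>p. snd q * snd p)"
      by (auto simp: gmult_def split: prod.splits)
    then show ?thesis by (auto intro!: polyfun.mult polyfun.const gsp_coord_polyfun)
  qed
qed

lemma continuous_on_matrix_mult [continuous_intros]:
  fixes f :: "'a::topological_space \<Rightarrow> complex ^ 'n ^ 'm" and g :: "'a \<Rightarrow> complex ^ 'k ^ 'n"
  assumes "continuous_on S f" "continuous_on S g"
  shows "continuous_on S (\<lambda>x. f x ** g x)"
  unfolding matrix_matrix_mult_def by (intro continuous_intros assms)

lemma gmult_continuous: "continuous_on S (\<lambda>p. gmult q (gmult p r))"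
  unfolding gmult_def case_prod_unfold by (intro continuous_intros)

lemma Stab_gmult: "q \<in> Stab a \<Longrightarrow> q' \<in> Stab a \<Longrightarrow> gmult q q' \<in> Stab a"
  by (cases q; cases q') (auto simp: gmult_def Stab_mult)

lemma G_alpha_eq: "G_alpha a = zariski_component gsp_coords (Stab a) (mat 1, 1)"
  by (simp add: G_alpha_def Stab_def)

lemma G_alpha_subset: "G_alpha a \<subseteq> Stab a"
  unfolding G_alpha_eq by (rule zariski_component_subset)

lemma G_alpha_one: "(mat 1, 1) \<in> G_alpha a"
  unfolding G_alpha_eq by (rule zariski_component_self) (rule Stab_one)

lemma gmult_one [simp]: "gmult q (mat 1, 1) = q" "gmult (mat 1, 1) q = q"
  by (auto simp: gmult_def split: prod.splits)

text \<open>A left translate of the identity component by \<open>q\<close> is connected, so it is contained in the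
  identity component as soon as it meets it; this gives products (\<open>q = q \<cdot> 1\<close>) as well as inverses
  (\<open>1 = q\<^sup>-\<^sup>1 \<cdot> q\<close>).\<close>

lemma G_alpha_translate:
  assumes "q \<in> Stab a" "r \<in> G_alpha a" "gmult q r \<in> G_alpha a" "p \<in> G_alpha a"
  shows "gmult q p \<in> G_alpha a"
proof -
  have "gmult q ` G_alpha a \<subseteq> G_alpha a"
    unfolding G_alpha_eq
  proof (rule zariski_component_absorb)
    show "connectedin (zariski gsp_coords) (gmult q ` zariski_component gsp_coords (Stab a) (mat 1, 1))"
      by (intro connectedin_continuous_map_image[OF gmult_zariski] connectedin_zariski_component)
    show "gmult q ` zariski_component gsp_coords (Stab a) (mat 1, 1) \<subseteq> Stab a"
      using G_alpha_subset assms(1) Stab_gmult by (fastforce simp: G_alpha_eq)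
    show "gmult q r \<in> gmult q ` zariski_component gsp_coords (Stab a) (mat 1, 1)"
      using assms(2) by (auto simp: G_alpha_eq)
    show "gmult q r \<in> zariski_component gsp_coords (Stab a) (mat 1, 1)"
      using assms(3) by (simp add: G_alpha_eq)
  qed
  then show ?thesis using assms(4) by blast
qed

lemma G_alpha_mult: "q \<in> G_alpha a \<Longrightarrow> p \<in> G_alpha a \<Longrightarrow> gmult q p \<in> G_alpha a"
  by (rule G_alpha_translate[OF _ G_alpha_one]) (use G_alpha_subset in auto)

lemma G_alpha_inverse:
  assumes "q \<in> G_alpha a" "p \<in> GSp UNIV" "gmult q p = (mat 1, 1)" "gmult p q = (mat 1, 1)"
  shows "p \<in> G_alpha a"
proof -
  have "p \<in> Stab a"
    using Stab_inverse[of "fst q" "snd q" a "fst p" "snd p"] assms G_alpha_subset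
    by (auto simp: gmult_def split: prod.splits)
  then have "gmult p (mat 1, 1) \<in> G_alpha a"
    using G_alpha_translate[OF _ assms(1) _ G_alpha_one] G_alpha_one assms(4) by metis
  then show ?thesis by simp
qed

lemma G_real_plus_subset: "G_alpha_real_plus a \<subseteq> G_alpha a \<inter> GSp \<real>"
  unfolding G_alpha_real_plus_def by (rule connected_component_subset)

lemma G_real_gmult:
  assumes "q \<in> G_alpha a \<inter> GSp \<real>" "p \<in> G_alpha a \<inter> GSp \<real>"
  shows "gmult q p \<in> G_alpha a \<inter> GSp \<real>"
  using assms G_alpha_mult GSp_mult[of \<real> "fst q" "snd q" "fst p" "snd p"]
  by (auto simp: gmult_def split: prod.splits)

lemma G_real_plus_one: "(mat 1, 1) \<in> G_alpha_real_plus a"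
  by (simp add: G_alpha_real_plus_def G_alpha_one GSp_one)

text \<open>Conjugation by q is continuous and fixes the identity, so it preserves the identity
  component. The point q itself may lie in another component, as elements of the level group
  may.\<close>

lemma G_real_plus_conj:
  assumes "q \<in> G_alpha a \<inter> GSp \<real>" "r \<in> G_alpha a \<inter> GSp \<real>" "gmult q r = (mat 1, 1)"
    "p \<in> G_alpha_real_plus a"
  shows "gmult q (gmult p r) \<in> G_alpha_real_plus a"
proof -
  let ?f = "\<lambda>p. gmult q (gmult p r)"
  have "?f ` G_alpha_real_plus a \<subseteq> connected_component_set (G_alpha a \<inter> GSp \<real>) (mat 1, 1)"
  proof (rule connected_component_maximal)
    show "(mat 1, 1) \<in> ?f ` G_alpha_real_plus a"
      using G_real_plus_one assms(3) by (force simp: image_iff)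
    show "connected (?f ` G_alpha_real_plus a)"
      by (intro connected_continuous_image gmult_continuous) (simp add: G_alpha_real_plus_def)
    show "?f ` G_alpha_real_plus a \<subseteq> G_alpha a \<inter> GSp \<real>"
      using assms G_real_plus_subset G_real_gmult by blast
  qed
  then show ?thesis using assms(4) by (auto simp: G_alpha_real_plus_def)
qed

lemma G_real_plus_mult:
  assumes "q \<in> G_alpha_real_plus a" "p \<in> G_alpha_real_plus a"
  shows "gmult q p \<in> G_alpha_real_plus a"
proof -
  have "gmult q ` G_alpha_real_plus a \<subseteq> G_alpha_real_plus a"
    unfolding G_alpha_real_plus_def
  proof (rule connected_component_absorb)
    show "gmult q ` connected_component_set (G_alpha a \<inter> GSp \<real>) (mat 1, 1) \<subseteq> G_alpha a \<inter> GSp \<real>"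
      using assms(1) G_real_plus_subset G_real_gmult
      unfolding G_alpha_real_plus_def[symmetric] by blast
    have "continuous_on S (gmult q)" for S
      using gmult_continuous[of S q "(mat 1, 1)"] by simp
    then show "connected (gmult q ` connected_component_set (G_alpha a \<inter> GSp \<real>) (mat 1, 1))"
      by (intro connected_continuous_image) auto
    show "q \<in> gmult q ` connected_component_set (G_alpha a \<inter> GSp \<real>) (mat 1, 1)"
      using G_real_plus_one[of a] by (intro image_eqI[of _ _ "(mat 1, 1)"]) (auto simp: G_alpha_real_plus_def)
    show "q \<in> connected_component_set (G_alpha a \<inter> GSp \<real>) (mat 1, 1)"
      using assms(1) by (simp add: G_alpha_real_plus_def)
  qed
  then show ?thesis using assms by blast
qed


subsection \<open>The identity component of the stabiliser in P\<close>

definition levi :: "'d::finite gsp \<Rightarrow> 'd pmatrix" where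
  "levi q = pmat (snd q) (fst q) 0 0 0"

definition levi_part :: "'d::finite pmatrix \<Rightarrow> 'd gsp" where
  "levi_part p = ((\<chi> k l. p $ Inr (Inl k) $ Inr (Inl l)), p $ Inl () $ Inl ())"

lemma mix_cases: "i = Inl () \<or> (\<exists>k. i = Inr (Inl k)) \<or> i = Inr (Inr ())" for i :: "'d mix"
  by (cases i; cases "projr i") auto

lemma levi_part_pmat [simp]: "levi_part (pmat \<mu> g x y z) = (g, \<mu>)"
  by (simp add: levi_part_def pmat_def vec_eq_iff)

lemma levi_part_zariski: "continuous_map (zariski mat_coords) (zariski gsp_coords) levi_part"
  by (rule continuous_map_zariski)
    (auto simp: gsp_coords_def levi_part_def intro!: mat_coord_polyfun)

lemma levi_part_continuous: "continuous_on S levi_part"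
  unfolding levi_part_def by (intro continuous_intros)

lemma levi_zariski: "continuous_map (zariski gsp_coords) (zariski mat_coords) levi"
proof (rule continuous_map_zariski)
  fix f :: "'a pmatrix \<Rightarrow> complex" assume "f \<in> mat_coords"
  then obtain i j where f: "f = (\<lambda>A. A $ i $ j)" by (auto simp: mat_coords_def)
  show "(\<lambda>p. f (levi p)) \<in> polyfun gsp_coords"
    unfolding f levi_def pmat_def using mix_cases[of i] mix_cases[of j]
    by (auto intro!: polyfun.const gsp_coord_polyfun)
qed

lemma continuous_on_pmat [continuous_intros]:
  assumes "continuous_on S \<mu>" "continuous_on S g" "continuous_on S x" "continuous_on S y" "continuous_on S z"
  shows "continuous_on S (\<lambda>t. pmat (\<mu> t) (g t) (x t) (y t) (z t))"
  unfolding pmat_def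
proof (intro continuous_on_vec_lambda)
  fix i j :: "'b mix"
  show "continuous_on S (\<lambda>t. case i of
        Inl _ \<Rightarrow> (case j of Inl _ \<Rightarrow> \<mu> t | Inr (Inl l) \<Rightarrow> x t $ l | Inr (Inr _) \<Rightarrow> z t)
      | Inr (Inl k) \<Rightarrow> (case j of Inl _ \<Rightarrow> 0 | Inr (Inl l) \<Rightarrow> g t $ k $ l | Inr (Inr _) \<Rightarrow> y t $ k)
      | Inr (Inr _) \<Rightarrow> (case j of Inl _ \<Rightarrow> 0 | Inr (Inl _) \<Rightarrow> 0 | Inr (Inr _) \<Rightarrow> 1))"
    using mix_cases[of i] mix_cases[of j] by (auto intro!: continuous_intros assms)
qed

lemma levi_continuous: "continuous_on S levi"
  unfolding levi_def by (intro continuous_intros)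

text \<open>The line through the block diagonal element (t = 0) and an arbitrary element with the
  same g and \<mu> (t = 1).\<close>

lemma unipotent_path_connected:
  "connected ((\<lambda>t::real. pmat \<mu> g (of_real t *s x) (of_real t *s y) (of_real t * z)) ` UNIV)"
proof -
  have "continuous_on UNIV (\<lambda>t::real. complex_of_real t *s v)" for v :: "complex ^ 'n"
    unfolding vector_scalar_mult_def by (intro continuous_intros)
  then show ?thesis by (intro connected_continuous_image continuous_intros) auto
qed

text \<open>The projection to (g, \<mu>) maps the identity component into that of the stabiliser.
  Conversely the block diagonal copy of \<open>G_alpha a\<close> is connected and contains 1, and
  from it every unipotent direction is reached along a line.\<close>

lemma P_alpha_eq: "P_alpha a = {pmat \<mu> g x y z | \<mu> g x y z. (g, \<mu>) \<in> G_alpha a}"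
proof -
  define S :: "'a pmatrix set" where "S = {pmat \<mu> g x y z | \<mu> g x y z. (g, \<mu>) \<in> Stab a}"
  have P: "P_alpha a = zariski_component mat_coords S (mat 1)"
    by (simp add: P_alpha_def S_def Stab_def)
  show ?thesis
  proof (intro equalityI subsetI)
    fix p assume p: "p \<in> P_alpha a"
    have "levi_part ` P_alpha a \<subseteq> G_alpha a"
      unfolding G_alpha_eq P
    proof (rule zariski_component_absorb)
      show "connectedin (zariski gsp_coords) (levi_part ` zariski_component mat_coords S (mat 1))"
        by (intro connectedin_continuous_map_image[OF levi_part_zariski] connectedin_zariski_component)
      show "levi_part ` zariski_component mat_coords S (mat 1) \<subseteq> Stab a"
        using zariski_component_subset[of mat_coords S "mat 1"] by (force simp: S_def)
      have "mat 1 \<in> S" unfolding S_def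
        by (intro CollectI exI conjI, rule pmat_id[symmetric], rule Stab_one)
      then show "levi_part (mat 1) \<in> levi_part ` zariski_component mat_coords S (mat 1)"
        by (intro imageI zariski_component_self)
      have "levi_part (mat 1 :: 'a pmatrix) = (mat 1, 1)" by (metis levi_part_pmat pmat_id)
      then show "levi_part (mat 1) \<in> zariski_component gsp_coords (Stab a) (mat 1, 1)"
        using G_alpha_one[of a] by (simp add: G_alpha_eq)
    qed
    then have "levi_part p \<in> G_alpha a" using p by blast
    moreover obtain \<mu> g x y z where "p = pmat \<mu> g x y z"
      using p zariski_component_subset[of mat_coords S "mat 1"] unfolding P S_def by blast
    ultimately show "p \<in> {pmat \<mu> g x y z | \<mu> g x y z. (g, \<mu>) \<in> G_alpha a}" by auto
  next
    fix p assume "p \<in> {pmat \<mu> g x y z | \<mu> g x y z. (g, \<mu>) \<in> G_alpha a}"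
    then obtain \<mu> g x y z where p: "p = pmat \<mu> g x y z" "(g, \<mu>) \<in> G_alpha a" by blast
    have one: "levi (mat 1, 1) = mat 1" by (simp add: levi_def pmat_id)
    have "levi ` G_alpha a \<subseteq> P_alpha a"
      unfolding P
    proof (rule zariski_component_absorb)
      show "connectedin (zariski mat_coords) (levi ` G_alpha a)" unfolding G_alpha_eq
        by (intro connectedin_continuous_map_image[OF levi_zariski] connectedin_zariski_component)
      show S: "levi ` G_alpha a \<subseteq> S"
        using G_alpha_subset by (fastforce simp: S_def levi_def)
      show 1: "mat 1 \<in> levi ` G_alpha a" using G_alpha_one one by (metis imageI)
      show "mat 1 \<in> zariski_component mat_coords S (mat 1)"
        using S 1 by (intro zariski_component_self) blast
    qed
    then have l: "levi (g, \<mu>) \<in> P_alpha a" using p by blast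
    let ?T = "(\<lambda>t::real. pmat \<mu> g (of_real t *s x) (of_real t *s y) (of_real t * z)) ` UNIV"
    have "?T \<subseteq> P_alpha a"
      unfolding P
    proof (rule zariski_component_absorb)
      show "connectedin (zariski mat_coords) ?T"
        using mat_coords_continuous unipotent_path_connected by (rule connectedin_zariski)
      show "?T \<subseteq> S" using p(2) G_alpha_subset by (fastforce simp: S_def)
      show "levi (g, \<mu>) \<in> ?T" by (rule image_eqI[of _ _ 0]) (auto simp: levi_def)
      show "levi (g, \<mu>) \<in> zariski_component mat_coords S (mat 1)" using l by (simp add: P)
    qed
    moreover have "p \<in> ?T" by (rule image_eqI[of _ _ 1]) (auto simp: p)
    ultimately show "p \<in> P_alpha a" by blast
  qed
qed

lemma P_alpha_real_plus_eq:
  "P_alpha_real_plus a = {pmat \<mu> g x y z | \<mu> g x y z.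
     (g, \<mu>) \<in> G_alpha_real_plus a \<and> rvec x \<and> rvec y \<and> z \<in> \<real>}"
proof -
  define S :: "'a pmatrix set" where "S = P_alpha a \<inter> Pgrp \<real>"
  have S: "S = {pmat \<mu> g x y z | \<mu> g x y z.
     (g, \<mu>) \<in> G_alpha a \<inter> GSp \<real> \<and> rvec x \<and> rvec y \<and> z \<in> \<real>}"
    unfolding S_def P_alpha_eq Pgrp_def by auto
  have P: "P_alpha_real_plus a = connected_component_set S (mat 1)"
    by (simp add: P_alpha_real_plus_def S_def)
  have one: "levi (mat 1, 1) = mat 1" by (simp add: levi_def pmat_id)
  show ?thesis
  proof (intro equalityI subsetI)
    fix p assume p: "p \<in> P_alpha_real_plus a"
    have "levi_part ` P_alpha_real_plus a \<subseteq> G_alpha_real_plus a"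
      unfolding G_alpha_real_plus_def P
    proof (rule connected_component_absorb)
      show "connected (levi_part ` connected_component_set S (mat 1))"
        by (intro connected_continuous_image levi_part_continuous) auto
      show "levi_part ` connected_component_set S (mat 1) \<subseteq> G_alpha a \<inter> GSp \<real>"
        using connected_component_subset[of S "mat 1"] by (force simp: S)
      have "mat 1 = pmat 1 (mat 1) 0 0 0" by (simp add: pmat_id)
      then have "mat 1 \<in> S" using G_alpha_one GSp_one[of \<real>] unfolding S by fastforce
      then show "levi_part (mat 1) \<in> levi_part ` connected_component_set S (mat 1)"
        by (intro imageI) simp
      have "levi_part (mat 1 :: 'a pmatrix) = (mat 1, 1)" by (metis levi_part_pmat pmat_id)
      then show "levi_part (mat 1) \<in> connected_component_set (G_alpha a \<inter> GSp \<real>) (mat 1, 1)"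
        using G_real_plus_one[of a] by (simp add: G_alpha_real_plus_def)
    qed
    then have "levi_part p \<in> G_alpha_real_plus a" using p by blast
    moreover obtain \<mu> g x y z where "p = pmat \<mu> g x y z" "rvec x" "rvec y" "z \<in> \<real>"
      using p connected_component_subset[of S "mat 1"] unfolding P S by blast
    ultimately show "p \<in> {pmat \<mu> g x y z | \<mu> g x y z.
       (g, \<mu>) \<in> G_alpha_real_plus a \<and> rvec x \<and> rvec y \<and> z \<in> \<real>}" by auto
  next
    fix p assume "p \<in> {pmat \<mu> g x y z | \<mu> g x y z.
       (g, \<mu>) \<in> G_alpha_real_plus a \<and> rvec x \<and> rvec y \<and> z \<in> \<real>}"
    then obtain \<mu> g x y z where p: "p = pmat \<mu> g x y z" "(g, \<mu>) \<in> G_alpha_real_plus a"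
      and real: "rvec x" "rvec y" "z \<in> \<real>" by blast
    have sub: "levi ` G_alpha_real_plus a \<subseteq> S"
    proof safe
      fix g \<mu> assume "(g, \<mu>) \<in> G_alpha_real_plus a"
      then have "(g, \<mu>) \<in> G_alpha a \<inter> GSp \<real>" using G_real_plus_subset by blast
      then show "levi (g, \<mu>) \<in> S" unfolding S levi_def by fastforce
    qed
    have "levi ` G_alpha_real_plus a \<subseteq> P_alpha_real_plus a"
      unfolding P
    proof (rule connected_component_maximal)
      show "mat 1 \<in> levi ` G_alpha_real_plus a" using G_real_plus_one one by (metis imageI)
      show "connected (levi ` G_alpha_real_plus a)"
        by (intro connected_continuous_image levi_continuous) (simp add: G_alpha_real_plus_def)
    qed (rule sub)
    then have l: "levi (g, \<mu>) \<in> P_alpha_real_plus a" using p by blast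
    let ?T = "(\<lambda>t::real. pmat \<mu> g (of_real t *s x) (of_real t *s y) (of_real t * z)) ` UNIV"
    have "?T \<subseteq> P_alpha_real_plus a"
      unfolding P
    proof (rule connected_component_absorb[OF unipotent_path_connected])
      have "pmat \<mu> g (of_real t *s x) (of_real t *s y) (of_real t * z) \<in> S" for t
      proof -
        have "(g, \<mu>) \<in> G_alpha a \<inter> GSp \<real>" using p(2) G_real_plus_subset by blast
        moreover have "rvec (of_real t *s x)" "rvec (of_real t *s y)" "of_real t * z \<in> \<real>"
          using real by (auto intro!: vec_in_scale)
        ultimately show ?thesis unfolding S by blast
      qed
      then show "?T \<subseteq> S" by blast
      show "levi (g, \<mu>) \<in> ?T" by (rule image_eqI[of _ _ 0]) (auto simp: levi_def)
      show "levi (g, \<mu>) \<in> connected_component_set S (mat 1)" using l by (simp add: P)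
    qed
    moreover have "p \<in> ?T" by (rule image_eqI[of _ _ 1]) (auto simp: p)
    ultimately show "p \<in> P_alpha_real_plus a" by blast
  qed
qed

lemma H_alpha_eq:
  "H_alpha \<tau>0 a = {\<tau> \<in> siegel. \<exists>(g, \<mu>)\<in>G_alpha_real_plus a. (*v) g ` Lag \<tau>0 = Lag \<tau>}"
  unfolding H_alpha_def Lag_def ..

lemma pt_zero: "pt \<tau> 0 0 0 = (\<tau>, 0, 0, 0)"
  by (simp add: pt_def upt_def vmult_linear mvmult_linear bdot_linear)

text \<open>Real unipotent matrices together with U(\<complex>) act transitively on the fibres of D
  over the Siegel space, so membership in the orbit is decided by \<tau>.\<close>

lemma D_alpha_eq:
  fixes \<tau>0 :: "complex ^ 'd ^ 'd"
  assumes "\<tau>0 \<in> siegel"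
  shows "D_alpha \<tau>0 a = {q. fst q \<in> H_alpha \<tau>0 a}"
proof (intro equalityI subsetI)
  fix q assume "q \<in> D_alpha \<tau>0 a"
  then obtain p h where q: "fst q \<in> siegel" "p \<in> P_alpha_real_plus a" "h \<in> Ugrp UNIV"
    "moves (p ** h) (\<tau>0, 0, 0, 0) q" unfolding D_alpha_def by blast
  obtain \<mu> g x y z where p: "p = pmat \<mu> g x y z" "(g, \<mu>) \<in> G_alpha_real_plus a"
    "rvec x" "rvec y" "z \<in> \<real>" using q(2) unfolding P_alpha_real_plus_eq by blast
  obtain z' where h: "h = pmat 1 (mat 1) 0 0 z'" using q(3) by (auto simp: Ugrp_def)
  obtain x1 y1 z1 where q1: "rvec x1" "rvec y1" "q = pt (fst q) x1 y1 z1"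
    using pt_surj[OF q(1)] .
  have "p ** h = pmat \<mu> g x y (\<mu> * z' + z)"
    by (simp add: p h pmat_mult bdot_linear mvmult_linear)
  then have "moves (pmat \<mu> g x y (\<mu> * z' + z)) (pt \<tau>0 0 0 0) (pt (fst q) x1 y1 z1)"
    using q(4) q1(3) by (simp add: pt_zero)
  moreover have g: "rmat g" "\<mu> \<in> \<real>"
    using p(2) G_real_plus_subset[of a] by (auto simp: GSp_iff)
  ultimately have "(*v) g ` Lag \<tau>0 = Lag (fst q)"
    using moves_pt[OF assms q(1) g p(3,4) vec_in_0(1) vec_in_0(1) q1(1,2)] by blast
  then show "q \<in> {q. fst q \<in> H_alpha \<tau>0 a}" using q(1) p(2) by (auto simp: H_alpha_eq)
next
  fix q :: "'d point" assume "q \<in> {q. fst q \<in> H_alpha \<tau>0 a}"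
  then obtain g \<mu> where q: "fst q \<in> siegel" "(g, \<mu>) \<in> G_alpha_real_plus a"
    "(*v) g ` Lag \<tau>0 = Lag (fst q)" by (auto simp: H_alpha_eq)
  obtain x y z where xyz: "rvec x" "rvec y" "q = pt (fst q) x y z"
    using pt_surj[OF q(1)] .
  have g: "rmat g" "\<mu> \<in> \<real>" "\<mu> \<noteq> 0"
    using q(2) G_real_plus_subset[of a] by (auto simp: GSp_iff)
  \<comment> \<open>Starting from x = 0, the transformation rule forces the block
    \<open>x v* g\<close>. The complex z has to come from U, on the right, where it gets multiplied
    by \<mu>; hence \<open>z / \<mu>\<close> below.\<close>
  have "pmat \<mu> g (x v* g) y 0 \<in> P_alpha_real_plus a"
    unfolding P_alpha_real_plus_eq using q g xyz by (auto simp: vec_in_vmult)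
  moreover have "pmat 1 (mat 1) 0 0 (z / \<mu>) \<in> Ugrp UNIV" by (auto simp: Ugrp_def)
  moreover have eq: "pmat \<mu> g (x v* g) y 0 ** pmat 1 (mat 1) 0 0 (z / \<mu>) = pmat \<mu> g (x v* g) y z"
    using g by (simp add: pmat_mult bdot_linear mvmult_linear)
  have "moves (pmat \<mu> g (x v* g) y z) (pt \<tau>0 0 0 0) (pt (fst q) x y z)"
    using assms q xyz g by (subst moves_pt) (auto simp: mvmult_linear bdot_linear vec_in_vmult)
  then have "moves (pmat \<mu> g (x v* g) y 0 ** pmat 1 (mat 1) 0 0 (z / \<mu>)) (\<tau>0, 0, 0, 0) q"
    unfolding eq by (simp add: pt_zero flip: xyz(3))
  ultimately show "q \<in> D_alpha \<tau>0 a"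
    unfolding D_alpha_def using q(1) by blast
qed

section \<open>The level group\<close>

definition Gam :: "complex ^ 'd::finite lat ^ 'd lat \<Rightarrow> (complex ^ 'd lat ^ 'd lat) set" where
  "Gam a = {g. (g, 1) \<in> Gamma_alpha3 a}"

lemma Gam_iff: "g \<in> Gam a \<longleftrightarrow> (g, 1) \<in> G_alpha a \<and> (g, 1) \<in> GSp \<int> \<and>
   (\<forall>i j. (g $ i $ j - mat 1 $ i $ j) / 3 \<in> \<int>)"
  by (auto simp: Gam_def Gamma_alpha3_def)

text \<open>The only units of \<int> are 1 and -1, and -1 is not congruent to 1 modulo 3.\<close>

lemma Gamma_alpha3_Gam: "(g, \<mu>) \<in> Gamma_alpha3 a \<longleftrightarrow> g \<in> Gam a \<and> \<mu> = 1"
proof -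
  have "\<mu> = 1" if g: "(g, \<mu>) \<in> Gamma_alpha3 a"
  proof -
    have "\<mu> \<in> \<int>" "\<exists>\<nu>\<in>\<int>. \<mu> * \<nu> = 1" "(\<mu> - 1) / 3 \<in> \<int>"
      using g by (auto simp: Gamma_alpha3_def GSp_iff)
    then obtain m n k where mnk: "\<mu> = of_int m" "\<mu> * of_int n = 1" "(\<mu> - 1) / 3 = of_int k"
      by (auto elim!: Ints_cases)
    then have "(of_int (m * n) :: complex) = of_int 1" by simp
    then have "m * n = 1" unfolding of_int_eq_iff .
    moreover have "\<mu> - 1 = 3 * of_int k" using mnk(3) by (simp add: field_simps)
    then have "(of_int (m - 1) :: complex) = of_int (3 * k)" using mnk(1) by simp
    then have "m - 1 = 3 * k" unfolding of_int_eq_iff .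
    ultimately have "m = 1" unfolding zmult_eq_1_iff by presburger
    then show ?thesis using mnk(1) by simp
  qed
  then show ?thesis by (auto simp: Gam_def)
qed

lemma Gam_one: "mat 1 \<in> Gam a"
  by (simp add: Gam_iff G_alpha_one GSp_one)

lemma Gam_matrix:
  assumes "g \<in> Gam a"
  shows "zmat g" "rmat g" "(g, 1) \<in> GSp \<real>" "(g, 1) \<in> GSp UNIV" "(g, 1) \<in> Stab a"
proof -
  have *: "(g, 1) \<in> G_alpha a" "(g, 1) \<in> GSp \<int>" using assms by (auto simp: Gam_iff)
  then show "zmat g" by (auto simp: GSp_iff)
  show "(g, 1) \<in> GSp \<real>" using * GSp_Ints_Reals by blast
  then show "rmat g" by (auto simp: GSp_iff)
  show "(g, 1) \<in> GSp UNIV" using * GSp_mono[OF subring_pts(3)] by blast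
  show "(g, 1) \<in> Stab a" using * G_alpha_subset by blast
qed

lemma congruent_1_mod_3_iff:
  "(\<forall>i j. (g $ i $ j - mat 1 $ i $ j) / 3 \<in> \<int>) \<longleftrightarrow> (\<exists>N. zmat N \<and> g = mat 1 + (\<chi> i j. 3 * N $ i $ j))"
  for g :: "complex ^ 'n ^ 'n"
proof
  assume *: "\<forall>i j. (g $ i $ j - mat 1 $ i $ j) / 3 \<in> \<int>"
  show "\<exists>N. zmat N \<and> g = mat 1 + (\<chi> i j. 3 * N $ i $ j)"
    using * by (intro exI[of _ "\<chi> i j. (g $ i $ j - mat 1 $ i $ j) / 3"]) (auto simp: mat_in_def vec_eq_iff diff_divide_distrib)
qed (auto simp: mat_in_def)

lemma mvmult_mat_add: "(A + B) *v x = A *v x + B *v x" for A :: "complex ^ 'n ^ 'm"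
  by (simp add: matrix_vector_mult_add_rdistrib)

lemma mvmult_mat_scale: "(\<chi> i j. c * A $ i $ j) *v x = c *s (A *v x)" for A :: "complex ^ 'n ^ 'm"
  by (auto simp: vec_eq_iff matrix_vector_mult_def sum_distrib_left mult.assoc)

lemma Gam_mult:
  assumes "g \<in> Gam a" "h \<in> Gam a"
  shows "g ** h \<in> Gam a"
proof -
  obtain M N where MN: "zmat M" "g = mat 1 + (\<chi> i j. 3 * M $ i $ j)"
    "zmat N" "h = mat 1 + (\<chi> i j. 3 * N $ i $ j)"
    using assms unfolding Gam_iff congruent_1_mod_3_iff by blast
  \<comment> \<open>(1 + 3M) h = h + 3Mh = 1 + 3(Mh + N).\<close>
  have "zmat (M ** h + N)"
    using mat_in_mult[OF subring_pts(3) MN(1) Gam_matrix(1)[OF assms(2)]] MN(3) by (auto simp: mat_in_def)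
  moreover have "(g ** h) *v x = (mat 1 + (\<chi> i j. 3 * (M ** h + N) $ i $ j)) *v x" for x
  proof -
    have "(g ** h) *v x = h *v x + 3 *s (M *v (h *v x))"
      by (simp add: MN(2) mvmult_mat_add mvmult_mat_scale flip: matrix_vector_mul_assoc)
    also have "\<dots> = (mat 1 + (\<chi> i j. 3 * (M ** h + N) $ i $ j)) *v x"
      by (subst (1) MN(4), unfold mvmult_mat_add mvmult_mat_scale)
        (simp add: vector_add_ldistrib matrix_vector_mul_assoc)
    finally show ?thesis .
  qed
  then have "g ** h = mat 1 + (\<chi> i j. 3 * (M ** h + N) $ i $ j)" by (subst matrix_eq) blast
  ultimately have "\<forall>i j. ((g ** h) $ i $ j - mat 1 $ i $ j) / 3 \<in> \<int>"
    unfolding congruent_1_mod_3_iff by blast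
  moreover have "(g ** h, 1) \<in> G_alpha a" "(g ** h, 1) \<in> GSp \<int>"
    using assms G_alpha_mult[of "(g, 1)" a "(h, 1)"] GSp_mult[of \<int> g 1 h 1]
    by (auto simp: Gam_iff gmult_def)
  ultimately show ?thesis by (simp add: Gam_iff)
qed

lemma Gam_inverse:
  assumes "g \<in> Gam a"
  obtains h where "h \<in> Gam a" "g ** h = mat 1" "h ** g = mat 1"
proof -
  obtain h \<nu> where h: "(h, \<nu>) \<in> GSp \<int>" "g ** h = mat 1" "h ** g = mat 1" "1 * \<nu> = 1"
    using GSp_inverse[OF subring_pts(3), of g 1] assms unfolding Gam_iff by metis
  obtain N where N: "zmat N" "g = mat 1 + (\<chi> i j. 3 * N $ i $ j)"
    using assms unfolding Gam_iff congruent_1_mod_3_iff by blast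
  have hZ: "zmat h" using h by (auto simp: GSp_iff)
  \<comment> \<open>From (1 + 3N) h = 1 follows h = 1 - 3Nh.\<close>
  have "zmat (- (N ** h))"
    using mat_in_mult[OF subring_pts(3) N(1) hZ] by (auto simp: mat_in_def)
  moreover have "h *v x = (mat 1 + (\<chi> i j. 3 * (- (N ** h)) $ i $ j)) *v x" for x
  proof -
    have "x = g *v (h *v x)" by (simp add: matrix_vector_mul_assoc h)
    also have "\<dots> = h *v x + 3 *s ((N ** h) *v x)"
      by (simp add: N(2) mvmult_mat_add mvmult_mat_scale flip: matrix_vector_mul_assoc)
    finally have "h *v x = x - 3 *s ((N ** h) *v x)" by (metis add_diff_cancel_right')
    moreover have "(- (N ** h)) *v x = - ((N ** h) *v x)"
      by (auto simp: vec_eq_iff matrix_vector_mult_def sum_negf)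
    ultimately show ?thesis
      unfolding mvmult_mat_add mvmult_mat_scale by simp
  qed
  then have "h = mat 1 + (\<chi> i j. 3 * (- (N ** h)) $ i $ j)" by (subst matrix_eq) blast
  ultimately have "\<forall>i j. (h $ i $ j - mat 1 $ i $ j) / 3 \<in> \<int>"
    unfolding congruent_1_mod_3_iff by blast
  moreover have "(h, 1) \<in> G_alpha a"
  proof (rule G_alpha_inverse[of "(g, 1)"])
    show "(g, 1) \<in> G_alpha a" using assms by (simp add: Gam_iff)
    show "(h, 1) \<in> GSp UNIV" using h(1,4) GSp_mono[OF subring_pts(3)] by auto
  qed (use h in \<open>auto simp: gmult_def\<close>)
  ultimately show ?thesis using that h by (simp add: Gam_iff)
qed

text \<open>Multiplying out turns the integral block n into g n, again an arbitrary integral vector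
  because g is invertible over \<int>; and \<open>P\<^sup>u\<close> lies in \<open>P_alpha a\<close>
  because the identity lies in \<open>G_alpha a\<close>.\<close>

lemma level_group_eq:
  "level_group a = {pmat 1 g m n k | g m n k. g \<in> Gam a \<and> zvec m \<and> zvec n \<and> k \<in> \<int>}"
proof -
  have Pu: "P_alpha a \<inter> Pu \<int> = Pu \<int>"
    unfolding P_alpha_eq Pu_def using G_alpha_one by blast
  have *: "pmat 1 g 0 0 0 ** pmat 1 (mat 1) m n k = pmat 1 g m (g *v n) k"
    for g :: "complex ^ 'a lat ^ 'a lat" and m n k
    by (simp add: pmat_mult bdot_linear vmult_linear)
  show ?thesis
  proof (intro equalityI subsetI)
    fix p assume "p \<in> level_group a"
    then obtain g \<mu> h where h: "(g, \<mu>) \<in> Gamma_alpha3 a" "h \<in> Pu \<int>" "p = pmat \<mu> g 0 0 0 ** h"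
      unfolding level_group_def Pu by auto
    then obtain m n k where mnk: "h = pmat 1 (mat 1) m n k" "zvec m" "zvec n" "k \<in> \<int>"
      unfolding Pu_def by auto
    have g: "g \<in> Gam a" and "p = pmat 1 g m (g *v n) k"
      using h mnk by (simp_all add: Gamma_alpha3_Gam *)
    moreover have "zvec (g *v n)"
      by (rule mat_in_mvmult[OF subring_pts(3) Gam_matrix(1)[OF g] mnk(3)])
    ultimately show "p \<in> {pmat 1 g m n k | g m n k. g \<in> Gam a \<and> zvec m \<and> zvec n \<and> k \<in> \<int>}"
      using mnk by blast
  next
    fix p assume "p \<in> {pmat 1 g m n k | g m n k. g \<in> Gam a \<and> zvec m \<and> zvec n \<and> k \<in> \<int>}"
    then obtain g m n k where p: "g \<in> Gam a" "zvec m" "zvec n" "k \<in> \<int>" "p = pmat 1 g m n k"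
 by auto
    obtain h where h: "h \<in> Gam a" "g ** h = mat 1" using Gam_inverse[OF p(1)] by metis
    have "zvec (h *v n)"
      by (rule mat_in_mvmult[OF subring_pts(3) Gam_matrix(1)[OF h(1)] p(3)])
    moreover have "p = pmat 1 g 0 0 0 ** pmat 1 (mat 1) m (h *v n) k"
      by (simp add: * matrix_vector_mul_assoc h p(5))
    moreover have "pmat 1 (mat 1) m (h *v n) k \<in> Pu \<int>" "(g, 1) \<in> Gamma_alpha3 a"
      using p calculation by (auto simp: Pu_def Gamma_alpha3_Gam)
    ultimately show "p \<in> level_group a"
      unfolding level_group_def Pu by blast
  qed
qed


section \<open>Hermitian forms on the Hodge filtration\<close>

definition cnjv :: "complex ^ 'n \<Rightarrow> complex ^ 'n" where "cnjv x = (\<chi> i. cnj (x $ i))"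

lemma cnjv_linear [simp]: "cnjv (x + y) = cnjv x + cnjv y" "cnjv (x - y) = cnjv x - cnjv y"
  "cnjv (c *s x) = cnj c *s cnjv x" "cnjv 0 = 0"
  by (auto simp: cnjv_def vec_eq_iff)

lemma upper_cnjv [simp]: "upper (cnjv x) = cnjv (upper x)"
  and lower_cnjv [simp]: "lower (cnjv x) = cnjv (lower x)"
  by (auto simp: cnjv_def upper_def lower_def)

lemma cnjv_cnjv [simp]: "cnjv (cnjv x) = x"
  by (simp add: cnjv_def)

lemma bdot_cnjv: "cnj (bdot x y) = bdot (cnjv x) (cnjv y)"
  by (simp add: bdot_def cnjv_def)

lemma cnjv_mvmult_real: "rmat g \<Longrightarrow> cnjv (g *v x) = g *v cnjv x"
  by (auto simp: cnjv_def matrix_vector_mult_def vec_eq_iff mat_in_def Reals_cnj_iff)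

lemma Jmat_mult: "Jmat *v w = blocks (- lower w) (upper w)"
  by (auto simp: Jmat_def blocks_def upper_def lower_def vec_eq_iff matrix_vector_mult_def sum_UNIV_Plus
      if_distribR if_distrib sum.If_cases sum_negf split: sum.split)

text \<open>The Hermitian form that the polarisation induces on \<open>Lag \<tau>\<close>, in the
  parameter c: for z = \<open>col_block \<tau> *v c\<close> the symplectic pairing of z with its
  conjugate is -2i times this number. Real symplectic matrices preserve it, which is the source of
  all bounds on the level group.\<close>

definition hform :: "complex ^ 'd ^ 'd \<Rightarrow> complex ^ 'd \<Rightarrow> real" where
  "hform \<tau> c = Im (bdot (\<tau> *v c) (cnjv c))"

lemma Jmat_col_block: "bdot (col_block \<tau> *v c) (Jmat *v cnjv (col_block \<tau> *v c)) = - 2 * \<i> * of_real (hform \<tau> c)"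
proof -
  have "bdot (col_block \<tau> *v c) (Jmat *v cnjv (col_block \<tau> *v c)) =
      cnj (bdot (\<tau> *v c) (cnjv c)) - bdot (\<tau> *v c) (cnjv c)"
    by (simp add: Jmat_mult col_block_mult bdot_blocks bdot_linear bdot_cnjv bdot_commute)
  also have "\<dots> = - 2 * \<i> * of_real (hform \<tau> c)"
    by (simp add: hform_def complex_eq_iff)
  finally show ?thesis .
qed

lemma hform_invariant:
  assumes "(g, 1) \<in> GSp \<real>" "g *v (col_block \<tau> *v c) = col_block \<tau>' *v c'"
  shows "hform \<tau> c = hform \<tau>' c'"
proof -
  have g: "rmat g" "bdot (g *v x) (Jmat *v (g *v y)) = bdot x (Jmat *v y)" for x y
    using assms(1) by (auto simp: GSp_iff)
  have "bdot (g *v (col_block \<tau> *v c)) (Jmat *v cnjv (g *v (col_block \<tau> *v c))) =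
      bdot (col_block \<tau> *v c) (Jmat *v cnjv (col_block \<tau> *v c))"
    unfolding cnjv_mvmult_real[OF g(1)] by (rule g(2))
  then show ?thesis unfolding assms(2) Jmat_col_block by simp
qed

lemma inner_symmetric_matrix:
  fixes A :: "real ^ 'n ^ 'n"
  shows "transpose A = A \<Longrightarrow> x \<bullet> (A *v y) = y \<bullet> (A *v x)"
  by (metis dot_lmul_matrix inner_commute transpose_matrix_vector)

text \<open>For symmetric \<tau> the two contributions of Re \<tau> cancel, so only Im \<tau>
  remains.\<close>

lemma hform_eq:
  assumes "transpose \<tau> = \<tau>"
  shows "hform \<tau> c = Rev c \<bullet> (Imm \<tau> *v Rev c) + Imv c \<bullet> (Imm \<tau> *v Imv c)"
proof -
  have "Im (bdot x (cnjv y)) = Imv x \<bullet> Rev y - Rev x \<bullet> Imv y" for x y :: "complex ^ 'a"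
    by (simp add: bdot_def cnjv_def Rev_def Imv_def inner_vec_def sum_subtractf algebra_simps)
  moreover have "transpose (Rem \<tau>) = Rem \<tau>"
    using assms by (simp add: transpose_def Rem_def vec_eq_iff)
  from inner_symmetric_matrix[OF this] have "Rev c \<bullet> (Rem \<tau> *v Imv c) = Imv c \<bullet> (Rem \<tau> *v Rev c)" .
  ultimately show ?thesis
    by (simp add: hform_def Rev_Imv_mult inner_add_left inner_diff_left inner_add_right
        inner_diff_right inner_commute)
qed

lemma hform_pos:
  assumes "\<tau> \<in> siegel" "c \<noteq> 0"
  shows "hform \<tau> c > 0"
proof -
  have "Rev c \<noteq> 0 \<or> Imv c \<noteq> 0" using assms(2) vec_complex_eqI[of c 0] by auto
  moreover have "0 \<le> r \<bullet> (Imm \<tau> *v r)" for r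
    using siegel_pos[OF assms(1), of r] by (cases "r = 0") auto
  ultimately show ?thesis
    using siegel_pos[OF assms(1)] unfolding hform_eq[OF siegel_symmetric[OF assms(1)]]
    by (meson add_pos_nonneg add_nonneg_pos)
qed

lemma hform_0 [simp]: "hform \<tau> 0 = 0"
  by (simp add: hform_def bdot_linear)

lemma hform_nonneg: "\<tau> \<in> siegel \<Longrightarrow> hform \<tau> c \<ge> 0"
  using hform_pos by (cases "c = 0") force+

lemma hform_scale: "hform \<tau> (of_real s *s c) = s\<^sup>2 * hform \<tau> c"
proof -
  have "bdot (\<tau> *v (of_real s *s c)) (cnjv (of_real s *s c)) = of_real (s\<^sup>2) * bdot (\<tau> *v c) (cnjv c)"
    by (simp add: mvmult_linear bdot_linear power2_eq_square)
  then show ?thesis unfolding hform_def by simp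
qed

text \<open>The parallelogram law, with the nonnegative term of c + c' dropped.\<close>

lemma hform_diff_le:
  assumes "\<tau> \<in> siegel"
  shows "hform \<tau> (c - c') \<le> 2 * hform \<tau> c + 2 * hform \<tau> c'"
proof -
  have "hform \<tau> (c - c') + hform \<tau> (c + c') = 2 * hform \<tau> c + 2 * hform \<tau> c'"
    by (simp add: hform_def mvmult_linear bdot_linear)
  then show ?thesis using hform_nonneg[OF assms, of "c + c'"] by linarith
qed

lemma norm_mvmult_le:
  fixes A :: "'a::real_normed_field ^ 'n ^ 'm"
  shows "norm (A *v x) \<le> (\<Sum>i\<in>UNIV. \<Sum>j\<in>UNIV. norm (A $ i $ j)) * norm x"
proof -
  have "norm (A *v x) \<le> (\<Sum>i\<in>UNIV. norm ((A *v x) $ i))"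
    unfolding norm_vec_def by (rule L2_set_le_sum) auto
  also have "\<dots> \<le> (\<Sum>i\<in>UNIV. (\<Sum>j\<in>UNIV. norm (A $ i $ j) * norm x))"
  proof (rule sum_mono)
    fix i
    have "norm ((A *v x) $ i) \<le> (\<Sum>j\<in>UNIV. norm (A $ i $ j * x $ j))"
      unfolding matrix_vector_mult_def by (simp add: norm_sum)
    also have "\<dots> \<le> (\<Sum>j\<in>UNIV. norm (A $ i $ j) * norm x)"
      by (intro sum_mono) (simp add: norm_mult mult_left_mono Finite_Cartesian_Product.norm_nth_le)
    finally show "norm ((A *v x) $ i) \<le> (\<Sum>j\<in>UNIV. norm (A $ i $ j) * norm x)" .
  qed
  finally show ?thesis by (simp add: sum_distrib_right)
qed

text \<open>The minimum over the unit sphere bounds the form at \<tau>0 below; where the entries of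
  Im \<tau> differ from those at \<tau>0 by less than half this minimum in total, the other half
  survives. Uniformity in \<tau> is what proper discontinuity requires.\<close>

lemma siegel_uniform_lower_bound:
  assumes "\<tau>0 \<in> siegel"
  obtains l where "l > 0" "\<forall>\<^sub>F \<tau> in nhds \<tau>0. \<forall>r. l * (norm r)\<^sup>2 \<le> r \<bullet> (Imm \<tau> *v r)"
proof -
  have "\<exists>x\<in>sphere (0 :: real ^ 'a) 1. \<forall>y\<in>sphere 0 1. x \<bullet> (Imm \<tau>0 *v x) \<le> y \<bullet> (Imm \<tau>0 *v y)"
    by (intro continuous_attains_inf) (auto intro!: continuous_intros)
  then obtain x where x: "norm x = 1" "\<And>y. norm y = 1 \<Longrightarrow> x \<bullet> (Imm \<tau>0 *v x) \<le> y \<bullet> (Imm \<tau>0 *v y)"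
    by auto
  define l where "l = x \<bullet> (Imm \<tau>0 *v x)"
  have l: "l > 0" using siegel_pos[OF assms, of x] x(1) unfolding l_def by force
  define S where "S \<tau> = (\<Sum>i\<in>UNIV. \<Sum>j\<in>UNIV. norm (Imm (\<tau> - \<tau>0) $ i $ j))" for \<tau>
  have "continuous_on UNIV S" unfolding S_def Imm_def
    by (simp, intro continuous_intros)
  moreover have "S \<tau>0 = 0" by (simp add: S_def Imm_def)
  ultimately have "(S \<longlongrightarrow> 0) (at \<tau>0)"
    by (metis UNIV_I continuous_on_def at_within_open open_UNIV)
  then have "(S \<longlongrightarrow> 0) (nhds \<tau>0)" using \<open>S \<tau>0 = 0\<close> by (metis tendsto_at_iff_tendsto_nhds)
  then have "\<forall>\<^sub>F \<tau> in nhds \<tau>0. S \<tau> < l / 2" by (rule order_tendstoD) (use l in simp)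
  then have "\<forall>\<^sub>F \<tau> in nhds \<tau>0. \<forall>r. l / 2 * (norm r)\<^sup>2 \<le> r \<bullet> (Imm \<tau> *v r)"
  proof (rule eventually_mono, intro allI)
    fix \<tau> and r :: "real ^ 'a" assume S: "S \<tau> < l / 2"
    have 1: "l * (norm r)\<^sup>2 \<le> r \<bullet> (Imm \<tau>0 *v r)"
    proof (cases "r = 0")
      case False
      have "l \<le> (r /\<^sub>R norm r) \<bullet> (Imm \<tau>0 *v (r /\<^sub>R norm r))"
        unfolding l_def using False by (intro x(2)) simp
      also have "\<dots> = (r \<bullet> (Imm \<tau>0 *v r)) / (norm r)\<^sup>2"
        by (simp add: scaleR_matrix_vector_assoc[symmetric] matrix_vector_mult_scaleR power2_eq_square divide_inverse mult_ac)
      finally show ?thesis using False by (simp add: field_simps)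
    qed simp
    have "\<bar>r \<bullet> (Imm (\<tau> - \<tau>0) *v r)\<bar> \<le> norm r * norm (Imm (\<tau> - \<tau>0) *v r)"
      by (rule Cauchy_Schwarz_ineq2)
    also have "\<dots> \<le> norm r * (S \<tau> * norm r)"
      unfolding S_def by (intro mult_left_mono norm_mvmult_le) auto
    also have "\<dots> \<le> norm r * (l / 2 * norm r)" using S by (intro mult_left_mono mult_right_mono) auto
    also have "\<dots> = l / 2 * (norm r)\<^sup>2" by (simp add: power2_eq_square)
    finally have 2: "\<bar>r \<bullet> (Imm (\<tau> - \<tau>0) *v r)\<bar> \<le> l / 2 * (norm r)\<^sup>2" .
    have "Imm \<tau> = Imm \<tau>0 + Imm (\<tau> - \<tau>0)" by (simp add: Imm_def vec_eq_iff)
    then have "r \<bullet> (Imm \<tau> *v r) = r \<bullet> (Imm \<tau>0 *v r) + r \<bullet> (Imm (\<tau> - \<tau>0) *v r)"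
      by (simp add: matrix_vector_mult_add_rdistrib inner_add_right)
    then show "l / 2 * (norm r)\<^sup>2 \<le> r \<bullet> (Imm \<tau> *v r)" using 1 2 by (simp add: field_simps)
  qed
  then show ?thesis using that[of "l / 2"] l by simp
qed

lemma norm_complex_vec: "(norm c)\<^sup>2 = (norm (Rev c))\<^sup>2 + (norm (Imv c))\<^sup>2" for c :: "complex ^ 'n"
proof -
  have "(norm c)\<^sup>2 = (\<Sum>i\<in>UNIV. (norm (c $ i))\<^sup>2)"
    by (simp add: norm_vec_def L2_set_def sum_nonneg)
  also have "\<dots> = (\<Sum>i\<in>UNIV. (Rev c $ i)\<^sup>2) + (\<Sum>i\<in>UNIV. (Imv c $ i)\<^sup>2)"
    by (simp add: Rev_def Imv_def cmod_power2 sum.distrib)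
  also have "\<dots> = (norm (Rev c))\<^sup>2 + (norm (Imv c))\<^sup>2"
    by (simp add: norm_vec_def L2_set_def sum_nonneg)
  finally show ?thesis .
qed

lemma hform_lower_bound:
  assumes "\<tau> \<in> siegel" "\<And>r. l * (norm r)\<^sup>2 \<le> r \<bullet> (Imm \<tau> *v r)"
  shows "l * (norm c)\<^sup>2 \<le> hform \<tau> c"
  using assms(2)[of "Rev c"] assms(2)[of "Imv c"]
  by (simp add: hform_eq siegel_symmetric[OF assms(1)] norm_complex_vec[of c] algebra_simps)

text \<open>\<open>realpart \<tau>\<close> is the real linear isomorphism from \<open>\<complex>\<^sup>d = F\<^sup>0\<close> to the real vectors, up to the
  factor 2; it transports \<open>hform\<close> to an inner product on the real vectors.\<close>

definition realpart :: "complex ^ 'd ^ 'd \<Rightarrow> complex ^ 'd \<Rightarrow> complex ^ 'd lat" where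
  "realpart \<tau> c = col_block \<tau> *v c + cnjv (col_block \<tau> *v c)"

lemma realpart_nth: "realpart \<tau> c $ i = of_real (2 * Re ((col_block \<tau> *v c) $ i))"
  by (simp add: realpart_def cnjv_def complex_add_cnj)

text \<open>The lower and upper blocks of the real vector are 2 Re c and 2 (Re \<tau> Re c - Im
  \<tau> Im c), solved in this order. The formulas for c are recorded because they give bounds
  uniform in \<tau>.\<close>

lemma realpart_surj:
  assumes "\<tau> \<in> siegel" "rvec x"
  obtains c where "realpart \<tau> c = x"
    "Rev c = Rev (lower x) /\<^sub>R 2" "Imm \<tau> *v Imv c = Rem \<tau> *v Rev c - Rev (upper x) /\<^sub>R 2"
proof -
  define r where "r = Rev (lower x) /\<^sub>R 2"
  obtain s where s: "Imm \<tau> *v s = Rem \<tau> *v r - Rev (upper x) /\<^sub>R 2" using siegel_Imm_surj[OF assms(1)] .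
  define c where "c = cvec r + \<i> *s cvec s"
  have c: "Rev c = r" "Imv c = s" by (simp_all add: c_def)
  have 1: "Rev (lower x) = 2 *\<^sub>R r" by (simp add: r_def)
  have 2: "Rev (upper x) = 2 *\<^sub>R (Rem \<tau> *v r - Imm \<tau> *v s)" using s by simp
  have lu: "lower (realpart \<tau> c) = c + cnjv c" "upper (realpart \<tau> c) = \<tau> *v c + cnjv (\<tau> *v c)"
    by (simp_all add: realpart_def col_block_mult)
  have cc: "y + cnjv y = cvec (2 *\<^sub>R Rev y)" for y :: "complex ^ 'a"
    by (simp add: cvec_def Rev_def cnjv_def vec_eq_iff complex_add_cnj)
  have "lower (realpart \<tau> c) = lower x"
    unfolding lu cc c using cvec_Rev[OF vec_in_upper_lower(2)[OF assms(2)]] 1 by simp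
  moreover have "upper (realpart \<tau> c) = upper x"
    unfolding lu cc Rev_Imv_mult c using cvec_Rev[OF vec_in_upper_lower(1)[OF assms(2)]] 2 by simp
  ultimately have "realpart \<tau> c = x" by (simp add: lat_eq_iff)
  then show ?thesis using that[of c] s c by (simp add: r_def)
qed

lemma mvmult_realpart:
  assumes "rmat g" "g *v (col_block \<tau> *v c) = col_block \<tau>' *v c'"
  shows "g *v realpart \<tau> c = realpart \<tau>' c'"
  unfolding realpart_def mvmult_linear cnjv_mvmult_real[OF assms(1), symmetric] assms(2) ..

lemma realpart_0 [simp]: "realpart \<tau> 0 = 0"
  by (simp add: realpart_def mvmult_linear)

lemma norm_realpart_nth_le: "norm (realpart \<tau> c $ i) \<le> 2 * (\<Sum>i\<in>UNIV. \<Sum>j\<in>UNIV. norm (col_block \<tau> $ i $ j)) * norm c"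
proof -
  have "norm (realpart \<tau> c $ i) \<le> 2 * norm ((col_block \<tau> *v c) $ i)"
    using abs_Re_le_cmod[of "(col_block \<tau> *v c) $ i"] by (simp add: realpart_nth norm_mult del: of_real_mult)
  also have "norm ((col_block \<tau> *v c) $ i) \<le> norm (col_block \<tau> *v c)" by (rule Finite_Cartesian_Product.norm_nth_le)
  also have "norm (col_block \<tau> *v c) \<le> (\<Sum>i\<in>UNIV. \<Sum>j\<in>UNIV. norm (col_block \<tau> $ i $ j)) * norm c"
    by (rule norm_mvmult_le)
  finally show ?thesis by simp
qed

lemma realpart_inj:
  assumes "\<tau> \<in> siegel" "realpart \<tau> c = 0"
  shows "c = 0"
proof -
  have "Rev (col_block \<tau> *v c) = 0"
    using assms(2) by (simp add: vec_eq_iff realpart_nth Rev_def)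
  then have "Rev (upper (col_block \<tau> *v c)) = 0" "Rev (lower (col_block \<tau> *v c)) = 0"
    by (simp_all add: vec_eq_iff Rev_def upper_def lower_def)
  then have "Rev c = 0" "Imm \<tau> *v Imv c = 0" by (simp_all add: col_block_mult Rev_Imv_mult)
  then show ?thesis using siegel_Imm_inj[OF assms(1)] vec_complex_eqI[of c 0] by simp
qed


subsection \<open>The level group acts freely\<close>

lemma small_Ints_eq_0: "x \<in> \<int> \<Longrightarrow> norm x < 1 \<Longrightarrow> x = 0" for x :: complex
  by (elim Ints_cases) auto

text \<open>Write \<open>\<gamma> = 1 + 3N\<close> for an element fixing \<open>\<tau>\<close>. As \<open>\<gamma>\<close> is an isometry, \<open>N\<close> contracts by \<open>2/3\<close>;
  as \<open>N\<close> is integral, it is nilpotent. So \<open>\<gamma>\<close> is a unipotent isometry, hence trivial.\<close>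

lemma Gam_free:
  fixes \<tau> :: "complex ^ 'd ^ 'd"
  assumes \<tau>: "\<tau> \<in> siegel" and g: "g \<in> Gam a" and stab: "(*v) g ` Lag \<tau> \<subseteq> Lag \<tau>"
  shows "g = mat 1"
proof -
  obtain N where N: "zmat N" "g = mat 1 + (\<chi> i j. 3 * N $ i $ j)"
    using g unfolding Gam_iff congruent_1_mod_3_iff by blast
  have gv: "g *v x = x + 3 *s (N *v x)" for x by (simp add: N mvmult_mat_add mvmult_mat_scale)
  define T where "T c = lower (N *v (col_block \<tau> *v c))" for c
  have NT: "N *v (col_block \<tau> *v c) = col_block \<tau> *v T c" for c
  proof -
    have "col_block \<tau> *v c \<in> Lag \<tau>" by (simp add: Lag_def)
    then have "g *v (col_block \<tau> *v c) \<in> Lag \<tau>" using stab by blast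
    then have "row_block \<tau> *v (g *v (col_block \<tau> *v c)) = 0" by (simp add: Lag_iff)
    then have "N *v (col_block \<tau> *v c) \<in> Lag \<tau>" by (simp add: gv mvmult_linear Lag_iff)
    then show ?thesis by (auto simp: T_def Lag_def)
  qed
  have NZ: "rmat N" using N(1) by (metis mat_in_def Ints_cases Reals_of_int)
  have Nr: "N *v realpart \<tau> c = realpart \<tau> (T c)" for c by (rule mvmult_realpart[OF NZ NT])
  \<comment> \<open>On the parameter, \<gamma> acts by sending c to c + 3 \<open>T c\<close>, where
    T is N transported to \<open>Lag \<tau>\<close>.\<close>
  have iso: "hform \<tau> (c + 3 *s T c) = hform \<tau> c" for c
    by (rule hform_invariant[OF Gam_matrix(3)[OF g], symmetric]) (simp add: gv NT mvmult_linear)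
  \<comment> \<open>3 \<open>T c\<close> is the difference of two vectors of equal length, so 9
    times the square length of \<open>T c\<close> is at most 4 times that of c.\<close>
  have contract: "hform \<tau> (T c) \<le> 4 / 9 * hform \<tau> c" for c
  proof -
    have "9 * hform \<tau> (T c) = hform \<tau> ((c + 3 *s T c) - c)" using hform_scale[of \<tau> 3 "T c"] by simp
    also have "\<dots> \<le> 4 * hform \<tau> c" using hform_diff_le[OF \<tau>, of "c + 3 *s T c" c] iso[of c] by simp
    finally show ?thesis by simp
  qed
  have iter: "hform \<tau> ((T ^^ k) c) \<le> (4 / 9) ^ k * hform \<tau> c" for k c
  proof (induction k)
    case (Suc k)
    have "hform \<tau> ((T ^^ Suc k) c) \<le> 4 / 9 * hform \<tau> ((T ^^ k) c)" using contract by simp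
    then show ?case using Suc by simp
  qed simp
  obtain l where l: "l > 0" "\<forall>\<^sub>F \<tau>' in nhds \<tau>. \<forall>r. l * (norm r)\<^sup>2 \<le> r \<bullet> (Imm \<tau>' *v r)"
    using siegel_uniform_lower_bound[OF \<tau>] .
  have lb: "l * (norm c)\<^sup>2 \<le> hform \<tau> c" for c
    using eventually_nhds_x_imp_x[OF l(2)] by (intro hform_lower_bound[OF \<tau>]) blast
  \<comment> \<open>If T z = y and T y = 0, then the m-th power of \<gamma> sends z to z + 3 m y, of
    constant length in m; this is impossible for y \<noteq> 0.\<close>
  have unip: "T y = 0 \<Longrightarrow> T z = y \<Longrightarrow> y = 0" for y z
  proof (rule ccontr)
    assume y: "T y = 0" "T z = y" "y \<noteq> 0"
    have Tadd: "T (c + s *s c') = T c + s *s T c'" for c c' s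
      by (simp add: T_def mvmult_linear)
    have "hform \<tau> (z + of_nat (3 * m) *s y) = hform \<tau> z" for m
    proof (induction m)
      case (Suc m)
      have "z + of_nat (3 * Suc m) *s y = (z + of_nat (3 * m) *s y) + 3 *s T (z + of_nat (3 * m) *s y)"
        unfolding Tadd y by (simp add: vector_sadd_rdistrib algebra_simps)
      then have "hform \<tau> (z + of_nat (3 * Suc m) *s y) =
          hform \<tau> ((z + of_nat (3 * m) *s y) + 3 *s T (z + of_nat (3 * m) *s y))"
        by (rule arg_cong)
      then show ?case unfolding iso Suc .
    qed simp
    then have "hform \<tau> (of_real (3 * real m) *s y) \<le> 4 * hform \<tau> z" for m
      using hform_diff_le[OF \<tau>, of "z + of_nat (3 * m) *s y" z] by simp
    then have *: "9 * (real m)\<^sup>2 * hform \<tau> y \<le> 4 * hform \<tau> z" for m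
      unfolding hform_scale by (simp add: power_mult_distrib)
    obtain m :: nat where "4 * hform \<tau> z < real m * hform \<tau> y"
      using reals_Archimedean3[OF hform_pos[OF \<tau> y(3)]] by metis
    have "real m \<le> real (m * m)" by (simp only: of_nat_le_iff le_square)
    then have "real m \<le> 9 * (real m)\<^sup>2" by (simp add: power2_eq_square)
    then have "real m * hform \<tau> y \<le> 9 * (real m)\<^sup>2 * hform \<tau> y"
      using hform_nonneg[OF \<tau>] by (rule mult_right_mono)
    then show False using *[of m] \<open>4 * hform \<tau> z < _\<close> by linarith
  qed
  have null: "N *v x = 0" if x: "zvec x" for x
  proof -
    obtain c where c: "realpart \<tau> c = x" using realpart_surj[OF \<tau> vec_in_Ints_Reals[OF x]] by metis
    have Nk: "zvec (realpart \<tau> ((T ^^ k) c))" for k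
      by (induction k) (use x c N(1) in \<open>auto simp flip: Nr intro: mat_in_mvmult\<close>)
    \<comment> \<open>B compares an entry of \<open>realpart \<tau> c\<close> with the norm of c;
      the contraction then pushes all entries of a high iterate below 1, where integrality makes
      them vanish.\<close>
    define B where "B = 2 * (\<Sum>i\<in>UNIV. \<Sum>j\<in>UNIV. norm (col_block \<tau> $ i $ j))"
    have B: "B \<ge> 0" by (simp add: B_def sum_nonneg)
    have "\<exists>k. B\<^sup>2 * ((4 / 9) ^ k * hform \<tau> c) / l < 1"
    proof -
      have "(\<lambda>k. B\<^sup>2 * ((4 / 9) ^ k * hform \<tau> c) / l) \<longlonglongrightarrow> B\<^sup>2 * (0 * hform \<tau> c) / l"
        using l(1) by (intro tendsto_intros LIMSEQ_realpow_zero) auto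
      then have "\<forall>\<^sub>F k in sequentially. B\<^sup>2 * ((4 / 9) ^ k * hform \<tau> c) / l < 1"
        by (rule order_tendstoD) simp
      then show ?thesis by (meson eventually_happens trivial_limit_sequentially)
    qed
    then obtain k where k: "B\<^sup>2 * ((4 / 9) ^ k * hform \<tau> c) / l < 1" by blast
    have Tk: "(T ^^ k) c = 0"
    proof (rule realpart_inj[OF \<tau>])
      have "norm (realpart \<tau> ((T ^^ k) c) $ i) < 1" for i
      proof -
        have "(norm (realpart \<tau> ((T ^^ k) c) $ i))\<^sup>2 \<le> (B * norm ((T ^^ k) c))\<^sup>2"
          unfolding B_def by (intro power_mono norm_realpart_nth_le) auto
        also have "\<dots> = B\<^sup>2 * (norm ((T ^^ k) c))\<^sup>2" by (simp add: power_mult_distrib)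
        also have "\<dots> \<le> B\<^sup>2 * (hform \<tau> ((T ^^ k) c) / l)"
          using lb[of "(T ^^ k) c"] l(1) by (intro mult_left_mono) (auto simp: field_simps)
        also have "\<dots> \<le> B\<^sup>2 * (((4 / 9) ^ k * hform \<tau> c) / l)"
          using iter[of k c] l(1) by (intro mult_left_mono divide_right_mono) auto
        also have "\<dots> < 1" using k by simp
        finally show ?thesis by (simp add: power_less_one_iff)
      qed
      then show "realpart \<tau> ((T ^^ k) c) = 0"
        using Nk[of k] by (simp add: vec_eq_iff vec_in_def small_Ints_eq_0)
    qed
    have "T c = 0"
    proof (rule ccontr)
      assume "T c \<noteq> 0"
      \<comment> \<open>Were the index j at least 2, the last nonzero iterate would be a y excluded
        by \<open>unip\<close>.\<close>
      define j where "j = (LEAST j. (T ^^ j) c = 0)"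
      have j: "(T ^^ j) c = 0" unfolding j_def using Tk by (rule LeastI)
      have jm: "(T ^^ i) c \<noteq> 0" if "i < j" for i using that not_less_Least j_def by blast
      have T0: "T 0 = 0" by (simp add: T_def mvmult_linear lower_def vec_eq_iff)
      have "j \<noteq> 0" using j \<open>T c \<noteq> 0\<close> T0 by (cases j) auto
      moreover have "j \<noteq> 1" using j \<open>T c \<noteq> 0\<close> by (auto simp: One_nat_def)
      ultimately have "j = Suc (Suc (j - 2))" by simp
      then obtain i where i: "j = Suc (Suc i)" ..
      have "T ((T ^^ Suc i) c) = 0" using j unfolding i by simp
      from unip[OF this, of "(T ^^ i) c"] have "(T ^^ Suc i) c = 0" by simp
      then show False using jm[of "Suc i"] i by simp
    qed
    then show ?thesis using Nr[of c] c by simp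
  qed
  have "zvec (axis j 1)" for j :: "'d lat" by (auto simp: vec_in_def axis_def)
  from null[OF this] have "N $ i $ j = 0" for i j using mvmult_axis[of N j i] by simp
  then show ?thesis using N(2) by (simp add: vec_eq_iff)
qed


subsection \<open>Proper discontinuity\<close>

lemma finite_bounded_integral_matrices: "finite {g :: complex ^ 'n ^ 'm. zmat g \<and> (\<forall>i j. norm (g $ i $ j) \<le> K)}"
proof (rule finite_subset)
  let ?Z = "(of_int :: int \<Rightarrow> complex) ` {- \<lceil>K\<rceil>..\<lceil>K\<rceil>}"
  show "{g :: complex ^ 'n ^ 'm. zmat g \<and> (\<forall>i j. norm (g $ i $ j) \<le> K)} \<subseteq>
      (\<lambda>f. \<chi> i j. f (i, j)) ` (PiE UNIV (\<lambda>_. ?Z))"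
  proof safe
    fix g :: "complex ^ 'n ^ 'm" assume g: "zmat g" "\<forall>i j. norm (g $ i $ j) \<le> K"
    have "g $ i $ j \<in> ?Z" for i j
    proof -
      obtain z where z: "g $ i $ j = of_int z" using g(1) unfolding mat_in_def by (metis Ints_cases)
      then have "\<bar>real_of_int z\<bar> \<le> K" using g(2) by (metis norm_of_int)
      then have "z \<in> {- \<lceil>K\<rceil>..\<lceil>K\<rceil>}" by (auto; linarith)
      then show ?thesis using z by blast
    qed
    then show "g \<in> (\<lambda>f. \<chi> i j. f (i, j)) ` (PiE UNIV (\<lambda>_. ?Z))"
      by (intro image_eqI[of _ _ "\<lambda>(i, j). g $ i $ j"]) (auto simp: vec_eq_iff)
  qed
  show "finite ((\<lambda>f. \<chi> i j. f (i, j)) ` (PiE UNIV (\<lambda>_. ?Z)) :: (complex ^ 'n ^ 'm) set)"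
    by (intro finite_imageI finite_PiE) auto
qed

text \<open>The matrix g preserves \<open>hform\<close>, and near \<tau>0 this form is comparable
  with the Euclidean norm, uniformly at the source \<tau> and the target \<tau>'. Each standard
  basis vector is the real part of a bounded vector of \<open>Lag \<tau>\<close>, so its image, a
  column of g, is bounded.\<close>

lemma siegel_transporters_bounded:
  fixes \<tau>0 :: "complex ^ 'd ^ 'd"
  assumes \<tau>0: "\<tau>0 \<in> siegel"
  obtains U K where "open U" "\<tau>0 \<in> U"
    "\<And>\<tau> \<tau>' g i j. \<tau> \<in> U \<inter> siegel \<Longrightarrow> \<tau>' \<in> U \<inter> siegel \<Longrightarrow> (g, 1) \<in> GSp \<real> \<Longrightarrow>
       (*v) g ` Lag \<tau> \<subseteq> Lag \<tau>' \<Longrightarrow> norm (g $ i $ j) \<le> K"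
proof -
  obtain l where l: "l > 0" "\<forall>\<^sub>F \<tau> in nhds \<tau>0. \<forall>r. l * (norm r)\<^sup>2 \<le> r \<bullet> (Imm \<tau> *v r)"
    using siegel_uniform_lower_bound[OF \<tau>0] .
  define S where "S \<tau> = (\<Sum>i\<in>UNIV. \<Sum>j\<in>UNIV. norm (\<tau> $ i $ j)) +
    (\<Sum>i\<in>UNIV. \<Sum>j\<in>UNIV. norm (col_block \<tau> $ i $ j))" for \<tau> :: "complex ^ 'd ^ 'd"
  have "continuous_on UNIV S"
    unfolding S_def col_block_def sum_UNIV_Plus by (simp, intro continuous_intros)
  then have "(S \<longlongrightarrow> S \<tau>0) (nhds \<tau>0)"
    by (metis UNIV_I continuous_on_def at_within_open open_UNIV tendsto_at_iff_tendsto_nhds)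
  then have "\<forall>\<^sub>F \<tau> in nhds \<tau>0. S \<tau> < S \<tau>0 + 1" by (rule order_tendstoD) simp
  with l(2) have "\<forall>\<^sub>F \<tau> in nhds \<tau>0. S \<tau> < S \<tau>0 + 1 \<and> (\<forall>r. l * (norm r)\<^sup>2 \<le> r \<bullet> (Imm \<tau> *v r))"
    by eventually_elim auto
  then obtain U where U: "open U" "\<tau>0 \<in> U" "\<And>\<tau>. \<tau> \<in> U \<Longrightarrow> S \<tau> < S \<tau>0 + 1"
    "\<And>\<tau> r. \<tau> \<in> U \<Longrightarrow> l * (norm r)\<^sup>2 \<le> r \<bullet> (Imm \<tau> *v r)"
    unfolding eventually_nhds by blast
  define M where "M = S \<tau>0 + 1"
  have S0: "0 \<le> (\<Sum>i\<in>UNIV. \<Sum>j\<in>UNIV. norm (\<tau> $ i $ j))" "0 \<le> (\<Sum>i\<in>UNIV. \<Sum>j\<in>UNIV. norm (col_block \<tau> $ i $ j))"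
    for \<tau> :: "complex ^ 'd ^ 'd" by (simp_all add: sum_nonneg)
  have M: "M \<ge> 0" using S0[of \<tau>0] by (simp add: M_def S_def)
  have SM: "(\<Sum>i\<in>UNIV. \<Sum>j\<in>UNIV. norm (\<tau> $ i $ j)) \<le> M"
    "(\<Sum>i\<in>UNIV. \<Sum>j\<in>UNIV. norm (col_block \<tau> $ i $ j)) \<le> M" if "\<tau> \<in> U" for \<tau>
    using U(3)[OF that] S0[of \<tau>] by (simp_all add: M_def S_def)
  have ReM: "norm (Rem \<tau> *v r) \<le> M * norm r" "norm (Imm \<tau> *v r) \<le> M * norm r" if "\<tau> \<in> U" for \<tau> r
  proof -
    have "norm (Rem \<tau> *v r) \<le> (\<Sum>i\<in>UNIV. \<Sum>j\<in>UNIV. norm (Rem \<tau> $ i $ j)) * norm r"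
      "norm (Imm \<tau> *v r) \<le> (\<Sum>i\<in>UNIV. \<Sum>j\<in>UNIV. norm (Imm \<tau> $ i $ j)) * norm r"
      by (rule norm_mvmult_le)+
    moreover have "(\<Sum>i\<in>UNIV. \<Sum>j\<in>UNIV. norm (Rem \<tau> $ i $ j)) \<le> (\<Sum>i\<in>UNIV. \<Sum>j\<in>UNIV. norm (\<tau> $ i $ j))"
      "(\<Sum>i\<in>UNIV. \<Sum>j\<in>UNIV. norm (Imm \<tau> $ i $ j)) \<le> (\<Sum>i\<in>UNIV. \<Sum>j\<in>UNIV. norm (\<tau> $ i $ j))"
      unfolding Rem_def Imm_def by (simp_all add: sum_mono abs_Re_le_cmod abs_Im_le_cmod)
    ultimately show "norm (Rem \<tau> *v r) \<le> M * norm r" "norm (Imm \<tau> *v r) \<le> M * norm r"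
      using SM(1)[OF that] by (meson mult_right_mono norm_ge_zero order_trans)+
  qed
  \<comment> \<open>H bounds \<open>hform\<close> at the c whose real part is a basis vector: M is
    the share of Re c, which has norm at most 1; the product is the share of Im c, from the bounds M
    + 1 for Im \<tau> Im c and (M + 1) / l for Im c. K converts H back into a bound on
    entries.\<close>
  define H where "H = M + (M + 1) * ((M + 1) / l)"
  define K where "K = 2 * M * sqrt (H / l)"
  show ?thesis
  proof (rule that[OF U(1,2)])
    fix \<tau> \<tau>' g i j
    assume \<tau>: "\<tau> \<in> U \<inter> siegel" and \<tau>': "\<tau>' \<in> U \<inter> siegel" and g: "(g, 1) \<in> GSp \<real>"
      and L: "(*v) g ` Lag \<tau> \<subseteq> Lag \<tau>'"
    define x :: "complex ^ 'd lat" where "x = axis j 1"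
    have x: "rvec x" by (auto simp: x_def vec_in_def axis_def)
    obtain c where c: "realpart \<tau> c = x" "Rev c = Rev (lower x) /\<^sub>R 2"
      "Imm \<tau> *v Imv c = Rem \<tau> *v Rev c - Rev (upper x) /\<^sub>R 2"
      using realpart_surj[OF _ x] \<tau> by blast
    have nx: "norm (Rev (lower x)) \<le> 1" "norm (Rev (upper x)) \<le> 1"
    proof -
      have "Rev (lower x) = (case j of Inl _ \<Rightarrow> 0 | Inr k \<Rightarrow> axis k 1)"
        "Rev (upper x) = (case j of Inl k \<Rightarrow> axis k 1 | Inr _ \<Rightarrow> 0)"
        by (auto simp: x_def lower_def upper_def Rev_def axis_def vec_eq_iff split: sum.split)
      then show "norm (Rev (lower x)) \<le> 1" "norm (Rev (upper x)) \<le> 1"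
        by (auto split: sum.splits)
    qed
    have nR: "norm (Rev c) \<le> 1" unfolding c(2) using nx by simp
    have nY: "norm (Imm \<tau> *v Imv c) \<le> M + 1"
    proof -
      have "norm (Imm \<tau> *v Imv c) \<le> norm (Rem \<tau> *v Rev c) + norm (Rev (upper x) /\<^sub>R 2)"
        unfolding c(3) by (rule norm_triangle_ineq4)
      also have "norm (Rem \<tau> *v Rev c) \<le> M * norm (Rev c)" using ReM \<tau> by blast
      also have "M * norm (Rev c) \<le> M * 1" using nR M by (rule mult_left_mono)
      finally show ?thesis using nx by simp
    qed
    have nI: "norm (Imv c) \<le> (M + 1) / l"
    proof (cases "Imv c = 0")
      case False
      have "l * (norm (Imv c))\<^sup>2 \<le> Imv c \<bullet> (Imm \<tau> *v Imv c)" using U(4) \<tau> by blast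
      also have "\<dots> \<le> norm (Imv c) * norm (Imm \<tau> *v Imv c)" by (rule norm_cauchy_schwarz)
      also have "\<dots> \<le> norm (Imv c) * (M + 1)" using nY by (intro mult_left_mono) auto
      finally have "norm (Imv c) * (l * norm (Imv c)) \<le> norm (Imv c) * (M + 1)"
        by (simp add: power2_eq_square mult_ac)
      then have "l * norm (Imv c) \<le> M + 1" by (rule mult_left_le_imp_le) (use False in simp)
      then show ?thesis using l(1) by (simp add: pos_le_divide_eq mult.commute)
    qed (use M l in simp)
    have "hform \<tau> c = Rev c \<bullet> (Imm \<tau> *v Rev c) + Imv c \<bullet> (Imm \<tau> *v Imv c)"
      using \<tau> by (intro hform_eq siegel_symmetric) auto
    also have "Rev c \<bullet> (Imm \<tau> *v Rev c) \<le> norm (Rev c) * norm (Imm \<tau> *v Rev c)" by (rule norm_cauchy_schwarz)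
    also have "\<dots> \<le> 1 * (M * 1)"
    proof (intro mult_mono)
      have "norm (Imm \<tau> *v Rev c) \<le> M * norm (Rev c)" using ReM \<tau> by blast
      also have "\<dots> \<le> M * 1" using nR M by (rule mult_left_mono)
      finally show "norm (Imm \<tau> *v Rev c) \<le> M * 1" .
    qed (use nR in auto)
    also have "Imv c \<bullet> (Imm \<tau> *v Imv c) \<le> norm (Imv c) * norm (Imm \<tau> *v Imv c)" by (rule norm_cauchy_schwarz)
    also have "\<dots> \<le> (M + 1) / l * (M + 1)" using nI nY M l by (intro mult_mono) auto
    finally have hH: "hform \<tau> c \<le> H" by (simp add: H_def mult_ac)
    define c' where "c' = lower (g *v (col_block \<tau> *v c))"
    have c': "g *v (col_block \<tau> *v c) = col_block \<tau>' *v c'"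
    proof -
      have "g *v (col_block \<tau> *v c) \<in> Lag \<tau>'" using L by (auto simp: Lag_def)
      then show ?thesis by (auto simp: c'_def Lag_def)
    qed
    have gR: "rmat g" using g by (auto simp: GSp_iff)
    have "l * (norm c')\<^sup>2 \<le> hform \<tau>' c'" using \<tau>' U(4) by (intro hform_lower_bound) auto
    also have "\<dots> \<le> H" using hH hform_invariant[OF g c'] by simp
    finally have "(norm c')\<^sup>2 \<le> H / l" using l(1) by (simp add: field_simps)
    then have nc': "norm c' \<le> sqrt (H / l)" by (simp add: real_le_rsqrt)
    have "g $ i $ j = realpart \<tau>' c' $ i"
      using mvmult_realpart[OF gR c'] c(1) mvmult_axis[of g j i] by (simp add: x_def)
    also have "norm \<dots> \<le> 2 * (\<Sum>i\<in>UNIV. \<Sum>j\<in>UNIV. norm (col_block \<tau>' $ i $ j)) * norm c'"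
      by (rule norm_realpart_nth_le)
    also have "\<dots> \<le> 2 * M * sqrt (H / l)"
      using SM(2)[of \<tau>'] S0(2)[of \<tau>'] \<tau>' M nc' by (intro mult_mono) auto
    finally show "norm (g $ i $ j) \<le> K" by (simp add: K_def)
  qed
qed

lemma Lag_image_subset_iff: "(*v) g ` Lag \<tau> \<subseteq> Lag \<tau>' \<longleftrightarrow> row_block \<tau>' ** g ** col_block \<tau> = 0"
proof -
  have "(*v) g ` Lag \<tau> \<subseteq> Lag \<tau>' \<longleftrightarrow> (\<forall>c. row_block \<tau>' *v (g *v (col_block \<tau> *v c)) = 0)"
    by (simp add: Lag_def[of \<tau>] image_subset_iff Lag_iff)
  also have "\<dots> \<longleftrightarrow> (\<forall>c. (row_block \<tau>' ** g ** col_block \<tau>) *v c = 0 *v c)"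
    by (simp add: matrix_vector_mul_assoc matrix_mul_assoc)
  also have "\<dots> \<longleftrightarrow> row_block \<tau>' ** g ** col_block \<tau> = 0"
    by (metis matrix_eq)
  finally show ?thesis .
qed

lemma continuous_on_col_block [continuous_intros]:
  fixes f :: "'a::topological_space \<Rightarrow> complex ^ 'd ^ 'd"
  assumes "continuous_on S f" shows "continuous_on S (\<lambda>x. col_block (f x))"
  unfolding col_block_def
proof (intro continuous_on_vec_lambda)
  fix i :: "'d lat" and j
  show "continuous_on S (\<lambda>x. case i of Inl k \<Rightarrow> f x $ k $ j | Inr k \<Rightarrow> if k = j then 1 else 0)"
    by (cases i) (auto intro!: continuous_intros assms)
qed

lemma continuous_on_row_block [continuous_intros]:
  fixes f :: "'a::topological_space \<Rightarrow> complex ^ 'd ^ 'd"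
  assumes "continuous_on S f" shows "continuous_on S (\<lambda>x. row_block (f x))"
  unfolding row_block_def
proof (intro continuous_on_vec_lambda)
  fix i and j :: "'d lat"
  show "continuous_on S (\<lambda>x. case j of Inl l \<Rightarrow> if i = l then 1 else 0 | Inr l \<Rightarrow> - f x $ i $ l)"
    by (cases j) (auto intro!: continuous_intros assms)
qed

text \<open>Only finitely many integral g obey the bound just proved. By freeness none of them other
  than 1 fixes \<tau>0, and failing to carry \<tau> to \<tau>' is an open condition on the pair, so
  a smaller neighbourhood excludes them all.\<close>

lemma Gam_properly_discontinuous:
  fixes \<tau>0 :: "complex ^ 'd ^ 'd"
  assumes \<tau>0: "\<tau>0 \<in> siegel"
  obtains U where "open U" "\<tau>0 \<in> U"
    "\<And>\<tau> \<tau>' g. \<tau> \<in> U \<inter> siegel \<Longrightarrow> \<tau>' \<in> U \<inter> siegel \<Longrightarrow> g \<in> Gam a \<Longrightarrow>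
       (*v) g ` Lag \<tau> \<subseteq> Lag \<tau>' \<Longrightarrow> g = mat 1"
proof -
  obtain U K where U: "open U" "\<tau>0 \<in> U"
    "\<And>\<tau> \<tau>' g i j. \<tau> \<in> U \<inter> siegel \<Longrightarrow> \<tau>' \<in> U \<inter> siegel \<Longrightarrow> (g, 1) \<in> GSp \<real> \<Longrightarrow>
       (*v) g ` Lag \<tau> \<subseteq> Lag \<tau>' \<Longrightarrow> norm (g $ i $ j) \<le> K"
    using siegel_transporters_bounded[OF \<tau>0] by blast
  define F where "F = {g. zmat g \<and> (\<forall>i j. norm (g $ i $ j) \<le> K)} \<inter> Gam a - {mat 1}"
  have finF: "finite F" unfolding F_def
    by (intro finite_Diff finite_Int disjI1 finite_bounded_integral_matrices)
  define W where "W = (\<Inter>g\<in>F. {p. row_block (snd p) ** g ** col_block (fst p) \<noteq> 0})"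
  have "open W" unfolding W_def
    by (intro open_INT finF ballI open_Collect_neq continuous_intros)
  moreover have "(\<tau>0, \<tau>0) \<in> W"
    using Gam_free[OF \<tau>0] by (auto simp: W_def F_def Lag_image_subset_iff)
  ultimately obtain A B where AB: "open A" "open B" "\<tau>0 \<in> A" "\<tau>0 \<in> B" "A \<times> B \<subseteq> W"
    by (auto elim!: open_prod_elim)
  show ?thesis
  proof (rule that[of "U \<inter> A \<inter> B"])
    fix \<tau> \<tau>' g
    assume *: "\<tau> \<in> U \<inter> A \<inter> B \<inter> siegel" "\<tau>' \<in> U \<inter> A \<inter> B \<inter> siegel" "g \<in> Gam a"
      "(*v) g ` Lag \<tau> \<subseteq> Lag \<tau>'"
    have "norm (g $ i $ j) \<le> K" for i j
      using * Gam_matrix(3)[OF *(3)] by (intro U(3)[of \<tau> \<tau>']) auto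
    moreover have "g \<notin> F" using * AB(5) by (force simp: W_def Lag_image_subset_iff)
    ultimately show "g = mat 1" using Gam_matrix(1)[OF *(3)] *(3) by (auto simp: F_def)
  qed (use U AB in auto)
qed

section \<open>The action on the orbit of the base point\<close>

lemma matrix_inv_right_left:
  assumes "invertible A"
  shows "A ** matrix_inv A = mat 1" "matrix_inv A ** A = mat 1"
  using someI_ex[OF assms[unfolded invertible_def]] by (simp_all add: matrix_inv_def)

text \<open>Cramer's rule writes each entry of the inverse as a quotient of determinants, which are
  polynomials in the entries.\<close>

lemma continuous_on_matrix_inv:
  fixes f :: "'a::topological_space \<Rightarrow> 'b::real_normed_field ^ 'n ^ 'n"
  assumes "continuous_on S f" "\<And>x. x \<in> S \<Longrightarrow> invertible (f x)"
  shows "continuous_on S (\<lambda>x. matrix_inv (f x))"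
proof -
  have cont_det: "continuous_on S (\<lambda>x. det (h x))" if "\<And>i j. continuous_on S (\<lambda>x. h x $ i $ j)"
    for h :: "'a \<Rightarrow> 'b ^ 'n ^ 'n"
    unfolding det_def by (intro continuous_intros that)
  have entry: "matrix_inv (f x) $ i $ j =
      det (\<chi> p q. if q = i then axis j 1 $ p else f x $ p $ q) / det (f x)" if "x \<in> S" for x i j
  proof -
    have "f x *v (matrix_inv (f x) *v axis j 1) = axis j 1"
      using matrix_inv_right_left(1)[OF assms(2)[OF that]] by (simp add: matrix_vector_mul_assoc)
    moreover have "det (f x) \<noteq> 0" using assms(2)[OF that] by (simp add: invertible_det_nz)
    ultimately have "matrix_inv (f x) *v axis j 1 =
        (\<chi> k. det (\<chi> p q. if q = k then axis j 1 $ p else f x $ p $ q) / det (f x))"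
      by (simp add: cramer)
    moreover have "(matrix_inv (f x) *v axis j 1) $ i = matrix_inv (f x) $ i $ j"
      by (simp add: matrix_vector_mult_def axis_def if_distrib sum.If_cases cong: if_cong)
    ultimately show ?thesis by simp
  qed
  have "continuous_on S (\<lambda>x. matrix_inv (f x) $ i $ j)" for i j
  proof (subst continuous_on_cong[OF refl entry])
    show "continuous_on S (\<lambda>x. det (\<chi> p q. if q = i then axis j 1 $ p else f x $ p $ q) / det (f x))"
    proof (intro continuous_on_divide cont_det ballI)
      fix p q
      show "continuous_on S (\<lambda>x. (\<chi> p q. if q = i then axis j 1 $ p else f x $ p $ q) $ p $ q)"
        by (cases "q = i") (auto intro!: continuous_intros assms)
      show "continuous_on S (\<lambda>x. f x $ p $ q)" by (intro continuous_intros assms)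
    next
      fix x assume "x \<in> S"
      then show "det (f x) \<noteq> 0" using assms(2) by (simp add: invertible_det_nz)
    qed
  qed auto
  then have "continuous_on S (\<lambda>x. \<chi> i j. matrix_inv (f x) $ i $ j)"
    by (intro continuous_on_vec_lambda)
  then show ?thesis by simp
qed

lemma continuous_on_mvmult [continuous_intros]:
  fixes f :: "'a::topological_space \<Rightarrow> 'b::real_normed_field ^ 'n ^ 'm"
  assumes "continuous_on S f" "continuous_on S g"
  shows "continuous_on S (\<lambda>x. f x *v g x)"
  unfolding matrix_vector_mult_def by (intro continuous_intros assms)

lemma continuous_on_vmult [continuous_intros]:
  fixes f :: "'a::topological_space \<Rightarrow> 'b::real_normed_field ^ 'n ^ 'm"
  assumes "continuous_on S f" "continuous_on S g"
  shows "continuous_on S (\<lambda>x. g x v* f x)"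
  unfolding vector_matrix_mult_def by (intro continuous_intros assms)

lemma continuous_on_bdot [continuous_intros]:
  "continuous_on S f \<Longrightarrow> continuous_on S g \<Longrightarrow> continuous_on S (\<lambda>x. bdot (f x) (g x))"
  unfolding bdot_def by (intro continuous_intros)

lemma continuous_on_smult [continuous_intros]:
  fixes f :: "'a::topological_space \<Rightarrow> complex"
  shows "continuous_on S f \<Longrightarrow> continuous_on S g \<Longrightarrow> continuous_on S (\<lambda>x. f x *s g x)"
  unfolding vector_scalar_mult_def by (intro continuous_intros)

lemma continuous_on_lat_parts [continuous_intros]:
  "continuous_on S f \<Longrightarrow> continuous_on S (\<lambda>x. upper (f x))"
  "continuous_on S f \<Longrightarrow> continuous_on S (\<lambda>x. lower (f x))"
  unfolding upper_def lower_def by (intro continuous_intros; assumption)+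

lemma continuous_on_real_parts [continuous_intros]:
  "continuous_on S f \<Longrightarrow> continuous_on S (\<lambda>x. Rev (f x))"
  "continuous_on S f \<Longrightarrow> continuous_on S (\<lambda>x. Imv (f x))"
  "continuous_on S g \<Longrightarrow> continuous_on S (\<lambda>x. Rem (g x))"
  "continuous_on S g \<Longrightarrow> continuous_on S (\<lambda>x. Imm (g x))"
  "continuous_on S r \<Longrightarrow> continuous_on S (\<lambda>x. cvec (r x))"
  unfolding Rev_def Imv_def Rem_def Imm_def cvec_def by (intro continuous_intros; assumption)+

lemma continuous_on_blocks [continuous_intros]:
  fixes f :: "'a::topological_space \<Rightarrow> complex ^ 'd"
  assumes "continuous_on S f" "continuous_on S g"
  shows "continuous_on S (\<lambda>x. blocks (f x) (g x))"
  unfolding blocks_def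
proof (intro continuous_on_vec_lambda)
  fix i :: "'d lat"
  show "continuous_on S (\<lambda>x. case i of Inl k \<Rightarrow> f x $ k | Inr k \<Rightarrow> g x $ k)"
    by (cases i) (auto intro!: continuous_intros assms)
qed

section \<open>The fractional linear action on the Siegel space\<close>

lemma siegel_Imm_invertible: "\<tau> \<in> siegel \<Longrightarrow> invertible (Imm \<tau>)"
  using siegel_Imm_inj by (metis invertible_left_inverse matrix_left_invertible_ker)

text \<open>\<open>g\<close> maps \<open>(\<tau>; 1) \<complex>\<^sup>d\<close> to the column space of \<open>g (\<tau>; 1)\<close>, which is normalised by dividing by
  its lower block.\<close>

definition upperM :: "complex ^ 'd ^ 'd lat \<Rightarrow> complex ^ 'd ^ 'd" where "upperM K = (\<chi> i. K $ Inl i)"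
definition lowerM :: "complex ^ 'd ^ 'd lat \<Rightarrow> complex ^ 'd ^ 'd" where "lowerM K = (\<chi> i. K $ Inr i)"

definition mobius :: "complex ^ 'd::finite lat ^ 'd lat \<Rightarrow> complex ^ 'd ^ 'd \<Rightarrow> complex ^ 'd ^ 'd" where
  "mobius g \<tau> = upperM (g ** col_block \<tau>) ** matrix_inv (lowerM (g ** col_block \<tau>))"

lemma upperM_mult: "upperM K *v c = upper (K *v c)" and lowerM_mult: "lowerM K *v c = lower (K *v c)"
  by (auto simp: upperM_def lowerM_def upper_def lower_def matrix_vector_mult_def vec_eq_iff)

text \<open>If the lower block of g z vanishes, so does that of its conjugate, and with them the
  Hermitian form at g z; by invariance this contradicts positivity on
  \<open>Lag \<tau>\<close>.\<close>

lemma lowerM_invertible: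
  assumes "\<tau> \<in> siegel" "(g, 1) \<in> GSp \<real>"
  shows "invertible (lowerM (g ** col_block \<tau>))"
proof -
  have "c = 0" if "lowerM (g ** col_block \<tau>) *v c = 0" for c
  proof (rule ccontr)
    assume "c \<noteq> 0"
    let ?z = "col_block \<tau> *v c"
    have "lower (g *v ?z) = 0" using that by (simp add: lowerM_mult matrix_vector_mul_assoc)
    then have "bdot (g *v ?z) (Jmat *v cnjv (g *v ?z)) = 0"
      by (simp add: Jmat_mult bdot_blocks bdot_linear)
    moreover have "rmat g" "\<And>x y. bdot (g *v x) (Jmat *v (g *v y)) = bdot x (Jmat *v y)"
      using assms(2) by (auto simp: GSp_iff)
    ultimately have "bdot ?z (Jmat *v cnjv ?z) = 0" by (simp only: cnjv_mvmult_real)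
    then show False using hform_pos[OF assms(1) \<open>c \<noteq> 0\<close>] by (simp add: Jmat_col_block)
  qed
  then show ?thesis by (metis invertible_left_inverse matrix_left_invertible_ker)
qed

text \<open>Symmetry of the new matrix says that its column space is isotropic, and positivity of
  its imaginary part that \<open>hform\<close> is positive there; g preserves both.\<close>

lemma mobius_Lag:
  assumes "\<tau> \<in> siegel" "(g, 1) \<in> GSp \<real>"
  shows "mobius g \<tau> \<in> siegel" "(*v) g ` Lag \<tau> = Lag (mobius g \<tau>)"
proof -
  let ?K = "g ** col_block \<tau>"
  note inv = matrix_inv_right_left[OF lowerM_invertible[OF assms]]
  have K: "?K *v c = col_block (mobius g \<tau>) *v (lowerM ?K *v c)" for c
  proof -
    have "mobius g \<tau> *v (lowerM ?K *v c) = upperM ?K *v c"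
      by (simp add: mobius_def matrix_vector_mul_assoc inv flip: matrix_mul_assoc)
    then show ?thesis by (simp add: lat_eq_iff col_block_mult upperM_mult lowerM_mult)
  qed
  have K': "?K *v (matrix_inv (lowerM ?K) *v c) = col_block (mobius g \<tau>) *v c" for c
    unfolding K by (simp add: matrix_vector_mul_assoc inv)
  show Lag: "(*v) g ` Lag \<tau> = Lag (mobius g \<tau>)"
  proof (intro equalityI subsetI)
    fix m assume "m \<in> (*v) g ` Lag \<tau>"
    then obtain c where "m = ?K *v c" by (auto simp: Lag_def matrix_vector_mul_assoc)
    then show "m \<in> Lag (mobius g \<tau>)" unfolding K Lag_def by blast
  next
    fix m assume "m \<in> Lag (mobius g \<tau>)"
    then obtain c where "m = ?K *v (matrix_inv (lowerM ?K) *v c)" unfolding K' Lag_def by blast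
    then have "m = g *v (col_block \<tau> *v (matrix_inv (lowerM ?K) *v c))"
      by (simp add: matrix_vector_mul_assoc matrix_mul_assoc)
    then show "m \<in> (*v) g ` Lag \<tau>" unfolding Lag_def by blast
  qed
  have g: "bdot (g *v x) (Jmat *v (g *v y)) = bdot x (Jmat *v y)" for x y
    using assms(2) by (auto simp: GSp_iff)
  have J: "bdot (col_block \<sigma> *v c) (Jmat *v (col_block \<sigma> *v c')) = bdot c (\<sigma> *v c') - bdot c (transpose \<sigma> *v c')"
    for \<sigma> :: "complex ^ 'a ^ 'a" and c c'
    by (simp add: Jmat_mult col_block_mult bdot_blocks bdot_linear bdot_mvmult del: transpose_matrix_vector)
  have "bdot c (mobius g \<tau> *v c') = bdot c (transpose (mobius g \<tau>) *v c')" for c c'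
  proof -
    have "bdot (col_block (mobius g \<tau>) *v c) (Jmat *v (col_block (mobius g \<tau>) *v c')) = 0"
      unfolding K'[symmetric] matrix_vector_mul_assoc[symmetric] g
      unfolding matrix_vector_mul_assoc J[unfolded matrix_vector_mul_assoc] siegel_symmetric[OF assms(1)]
      by (simp flip: matrix_vector_mul_assoc add: J siegel_symmetric[OF assms(1)] del: transpose_matrix_vector)
    then show ?thesis by (simp add: J del: transpose_matrix_vector)
  qed
  then have "mobius g \<tau> *v c' = transpose (mobius g \<tau>) *v c'" for c'
    by (intro bdot_eqI) (simp add: bdot_commute del: transpose_matrix_vector)
  then have sym: "transpose (mobius g \<tau>) = mobius g \<tau>" by (metis matrix_eq)
  have "0 < x \<bullet> (Imm (mobius g \<tau>) *v x)" if "x \<noteq> 0" for x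
  proof -
    let ?c = "matrix_inv (lowerM ?K) *v cvec x"
    have "lowerM ?K *v ?c = cvec x" by (simp add: matrix_vector_mul_assoc inv)
    moreover have "cvec x \<noteq> 0" using that by (auto simp: cvec_def vec_eq_iff)
    ultimately have "?c \<noteq> 0" by (metis mvmult_linear(4))
    then have "0 < hform \<tau> ?c" by (rule hform_pos[OF assms(1)])
    also have "\<dots> = hform (mobius g \<tau>) (cvec x)"
      by (rule hform_invariant[OF assms(2)]) (use K'[of "cvec x"] in \<open>simp add: matrix_vector_mul_assoc matrix_mul_assoc\<close>)
    finally show ?thesis by (simp add: hform_eq[OF sym])
  qed
  then show "mobius g \<tau> \<in> siegel" using sym by (simp add: siegel_def Imm_def)
qed

lemma mobius_eqI:
  assumes "\<tau> \<in> siegel" "(g, 1) \<in> GSp \<real>" "(*v) g ` Lag \<tau> = Lag \<tau>'"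
  shows "\<tau>' = mobius g \<tau>"
  using mobius_Lag(2)[OF assms(1,2)] assms(3) Lag_inject by metis

lemma mobius_continuous:
  assumes "(g, 1) \<in> GSp \<real>" "continuous_on S f" "\<And>x. x \<in> S \<Longrightarrow> f x \<in> siegel"
  shows "continuous_on S (\<lambda>x. mobius g (f x))"
  unfolding mobius_def
proof (intro continuous_intros continuous_on_matrix_inv)
  show "continuous_on S (\<lambda>x. upperM (g ** col_block (f x)))" "continuous_on S (\<lambda>x. lowerM (g ** col_block (f x)))"
    unfolding upperM_def lowerM_def by (intro continuous_intros assms)+
qed (use lowerM_invertible assms in blast)

section \<open>Stability of the orbit under the level group\<close>

lemma G_real_plus_inverse:
  assumes "q \<in> G_alpha_real_plus a" "p \<in> G_alpha a \<inter> GSp \<real>" "gmult p q = (mat 1, 1)"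
  shows "p \<in> G_alpha_real_plus a"
proof -
  have "gmult p ` G_alpha_real_plus a \<subseteq> connected_component_set (G_alpha a \<inter> GSp \<real>) (mat 1, 1)"
  proof (rule connected_component_maximal)
    show "(mat 1, 1) \<in> gmult p ` G_alpha_real_plus a" using assms by (metis imageI)
    have "continuous_on S (gmult p)" for S using gmult_continuous[of S p "(mat 1, 1)"] by simp
    then show "connected (gmult p ` G_alpha_real_plus a)"
      by (intro connected_continuous_image) (auto simp: G_alpha_real_plus_def)
    show "gmult p ` G_alpha_real_plus a \<subseteq> G_alpha a \<inter> GSp \<real>"
      using assms(2) G_real_plus_subset G_real_gmult by blast
  qed
  then have "gmult p (mat 1, 1) \<in> connected_component_set (G_alpha a \<inter> GSp \<real>) (mat 1, 1)"
    using G_real_plus_one by blast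
  then show ?thesis by (simp add: G_alpha_real_plus_def)
qed

lemma G_real_inverse:
  assumes "q \<in> G_alpha a \<inter> GSp \<real>"
  obtains p where "p \<in> G_alpha a \<inter> GSp \<real>" "gmult p q = (mat 1, 1)" "gmult q p = (mat 1, 1)"
proof -
  obtain h \<nu> where h: "(h, \<nu>) \<in> GSp \<real>" "fst q ** h = mat 1" "h ** fst q = mat 1" "snd q * \<nu> = 1"
    using GSp_inverse[OF subring_pts(2), of "fst q" "snd q"] assms by auto
  have "gmult q (h, \<nu>) = (mat 1, 1)" "gmult (h, \<nu>) q = (mat 1, 1)"
    using h by (auto simp: gmult_def mult.commute split: prod.splits)
  moreover have "(h, \<nu>) \<in> G_alpha a"
  proof (rule G_alpha_inverse[of q])
    show "q \<in> G_alpha a" using assms by blast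
    show "(h, \<nu>) \<in> GSp UNIV" using h(1) GSp_mono[OF subring_pts(2)] by blast
  qed (use calculation in auto)
  ultimately show ?thesis using that h(1) by blast
qed

lemma fst_gmult: "fst (gmult p q) = fst p ** fst q"
  by (auto simp: gmult_def split: prod.splits)

lemma image_mvmult: "(*v) (A ** B) ` S = (*v) A ` (*v) B ` S" for A :: "complex ^ 'n ^ 'm"
  by (simp add: image_image matrix_vector_mul_assoc)

lemma H_alpha_iff: "\<tau> \<in> H_alpha \<tau>0 a \<longleftrightarrow> \<tau> \<in> siegel \<and> (\<exists>q\<in>G_alpha_real_plus a. (*v) (fst q) ` Lag \<tau>0 = Lag \<tau>)"
  by (simp add: H_alpha_eq case_prod_unfold)

text \<open>\<open>\<gamma>\<close> normalises \<open>G\<^sub>\<alpha>(\<real>)\<^sup>+\<close>, so it maps the orbit of \<open>\<tau>\<^sub>0\<close> to an orbit.\<close>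

lemma Gam_preserves_orbit:
  assumes g: "g \<in> Gam a" and \<tau>: "\<tau>1 \<in> H_alpha \<tau>0 a" "\<tau>2 \<in> H_alpha \<tau>0 a" "(*v) g ` Lag \<tau>1 = Lag \<tau>2"
    and \<tau>3: "\<tau>3 \<in> H_alpha \<tau>0 a"
  shows "mobius g \<tau>3 \<in> H_alpha \<tau>0 a"
proof -
  obtain p1 p2 p3 where p: "p1 \<in> G_alpha_real_plus a" "p2 \<in> G_alpha_real_plus a" "p3 \<in> G_alpha_real_plus a"
    "(*v) (fst p1) ` Lag \<tau>0 = Lag \<tau>1" "(*v) (fst p2) ` Lag \<tau>0 = Lag \<tau>2" "(*v) (fst p3) ` Lag \<tau>0 = Lag \<tau>3"
    using \<tau> \<tau>3 by (auto simp: H_alpha_iff)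
  have q: "(g, 1) \<in> G_alpha a \<inter> GSp \<real>" using g Gam_matrix(3) by (auto simp: Gam_iff)
  obtain r where r: "r \<in> G_alpha a \<inter> GSp \<real>" "gmult r (g, 1) = (mat 1, 1)" "gmult (g, 1) r = (mat 1, 1)"
    using G_real_inverse[OF q] .
  have "p1 \<in> G_alpha a \<inter> GSp \<real>" using p(1) G_real_plus_subset by blast
  then obtain s where s: "s \<in> G_alpha a \<inter> GSp \<real>" "gmult s p1 = (mat 1, 1)"
    using G_real_inverse by metis
  have s': "s \<in> G_alpha_real_plus a" by (rule G_real_plus_inverse[OF p(1) s])
  \<comment> \<open>With s inverse to p1 and r inverse to \<gamma>, the factors read from the right
    carry \<tau>0 to \<tau>2, \<tau>1, \<tau>0, by \<gamma> and r away and back to \<tau>0, then to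
    \<tau>3 and to \<gamma> \<tau>3. Grouped as here, every factor is an element of the component or
    a conjugate of one.\<close>
  let ?p = "gmult (gmult (g, 1) (gmult p3 r)) (gmult (gmult (g, 1) (gmult s r)) p2)"
  have P: "?p \<in> G_alpha_real_plus a"
    by (intro G_real_plus_mult G_real_plus_conj q r p s')
  have rg: "fst r ** g = mat 1" using r(2) by (auto simp: gmult_def split: prod.splits)
  have sp: "fst s ** fst p1 = mat 1" using s(2) by (auto simp: gmult_def split: prod.splits)
  have id: "(*v) (mat 1) ` S = S" for S :: "(complex ^ 'a lat) set" by (auto simp: image_def)
  have "(*v) (fst ?p) ` Lag \<tau>0 = (*v) g ` (*v) (fst p3) ` (*v) (fst r) ` (*v) g ` (*v) (fst s) ` (*v) (fst r) ` Lag \<tau>2"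
    by (simp add: fst_gmult image_mvmult p)
  also have "(*v) (fst r) ` Lag \<tau>2 = Lag \<tau>1"
    unfolding \<tau>(3)[symmetric] image_mvmult[symmetric] rg id ..
  also have "(*v) (fst s) ` Lag \<tau>1 = Lag \<tau>0"
    unfolding p(4)[symmetric] image_mvmult[symmetric] sp id ..
  also have "(*v) (fst r) ` (*v) g ` Lag \<tau>0 = Lag \<tau>0"
    unfolding image_mvmult[symmetric] rg id ..
  also have "(*v) g ` (*v) (fst p3) ` Lag \<tau>0 = Lag (mobius g \<tau>3)"
    using \<tau>3 Gam_matrix(3)[OF g] by (simp add: p mobius_Lag H_alpha_iff)
  finally show ?thesis
    using P \<tau>3 Gam_matrix(3)[OF g] mobius_Lag(1)[of \<tau>3 g] by (auto simp: H_alpha_iff)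
qed


section \<open>Continuity of the real coordinates\<close>

text \<open>Inverts \<open>pt\<close> explicitly: the imaginary part of u / 2\<pi>i is Im \<tau> r
  and yields the upper block r, after which the real part yields the lower one. Continuity is
  thereby reduced to that of \<open>matrix_inv\<close>.\<close>

definition xco :: "'d::finite point \<Rightarrow> complex ^ 'd lat" where
  "xco = (\<lambda>(\<tau>, u, v, w). let s = (1 / tpi) *s u; r = matrix_inv (Imm \<tau>) *v Imv s
     in blocks (cvec r) (cvec (Rev s - Rem \<tau> *v r)))"

definition yco :: "'d::finite point \<Rightarrow> complex ^ 'd lat" where
  "yco = (\<lambda>(\<tau>, u, v, w). let r = - (matrix_inv (Imm \<tau>) *v Imv v)
     in blocks (cvec (Rev v + Rem \<tau> *v r)) (cvec r))"

definition zco :: "'d::finite point \<Rightarrow> complex" where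
  "zco q = (case q of (\<tau>, u, v, w) \<Rightarrow> (w + bdot u (lower (yco q))) / tpi)"

lemma coords_pt:
  assumes "\<tau> \<in> siegel" "rvec x" "rvec y"
  shows "xco (pt \<tau> x y z) = x" "yco (pt \<tau> x y z) = y" "zco (pt \<tau> x y z) = z"
proof -
  have inv: "matrix_inv (Imm \<tau>) *v (Imm \<tau> *v r) = r" for r
    using matrix_inv_right_left[OF siegel_Imm_invertible[OF assms(1)]] by (simp add: matrix_vector_mul_assoc)
  have real: "cvec (Rev (upper x)) = upper x" "cvec (Rev (lower x)) = lower x"
    "cvec (Rev (upper y)) = upper y" "cvec (Rev (lower y)) = lower y"
    "Imv (upper x) = 0" "Imv (lower x) = 0" "Imv (upper y) = 0" "Imv (lower y) = 0"
    using assms by (simp_all add: cvec_Rev Imv_real vec_in_upper_lower)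
  have "(1 / tpi) *s upt \<tau> x = \<tau> *v upper x + lower x"
    by (simp add: upt_def vmult_col_block siegel_vmult[OF assms(1)] vector_smult_assoc)
  then show "xco (pt \<tau> x y z) = x"
    by (simp add: xco_def pt_def Let_def Rev_Imv_mult real inv)
  have neg: "A *v (- r) = - (A *v r)" for A :: "real ^ 'b ^ 'b" and r
    by (auto simp: vec_eq_iff matrix_vector_mult_def sum_negf)
  have "Imv (row_block \<tau> *v y) = Imm \<tau> *v (- Rev (lower y))"
    by (simp add: row_block_mult Rev_Imv_mult real neg)
  then have "matrix_inv (Imm \<tau>) *v Imv (row_block \<tau> *v y) = - Rev (lower y)"
    using inv by metis
  then show Y: "yco (pt \<tau> x y z) = y"
    by (simp add: yco_def pt_def Let_def row_block_mult Rev_Imv_mult real)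
  show "zco (pt \<tau> x y z) = z" unfolding zco_def Y by (simp add: pt_def)
qed

lemma coords_real: "rvec (xco q)" "rvec (yco q)"
  by (auto simp: xco_def yco_def Let_def vec_in_blocks split: prod.splits)

lemma pt_coords:
  assumes "fst q \<in> siegel"
  shows "pt (fst q) (xco q) (yco q) (zco q) = q"
proof -
  obtain x y z where "rvec x" "rvec y" "q = pt (fst q) x y z" using pt_surj[OF assms] .
  then show ?thesis using coords_pt[OF assms] by metis
qed

lemma coords_continuous:
  assumes "\<And>q. q \<in> S \<Longrightarrow> fst q \<in> siegel"
  shows "continuous_on S xco" "continuous_on S yco" "continuous_on S zco"
proof -
  have inv: "continuous_on S (\<lambda>q. matrix_inv (Imm (fst q)))"
    by (intro continuous_on_matrix_inv continuous_intros siegel_Imm_invertible assms)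
  show "continuous_on S xco"
    unfolding xco_def case_prod_unfold Let_def by (intro continuous_intros inv)
  show Y: "continuous_on S yco"
    unfolding yco_def case_prod_unfold Let_def by (intro continuous_intros inv)
  show "continuous_on S zco"
    unfolding zco_def case_prod_unfold by (intro continuous_intros Y) auto
qed

lemma pt_continuous:
  assumes "continuous_on S \<tau>" "continuous_on S x" "continuous_on S y" "continuous_on S z"
  shows "continuous_on S (\<lambda>p. pt (\<tau> p) (x p) (y p) (z p))"
  unfolding pt_def upt_def by (intro continuous_intros assms)

section \<open>The quotient by the level group\<close>

lemma level_groupI:
  "g \<in> Gam a \<Longrightarrow> zvec m \<Longrightarrow> zvec n \<Longrightarrow> k \<in> \<int> \<Longrightarrow> pmat 1 g m n k \<in> level_group a"
  by (auto simp: level_group_eq)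

lemma level_groupE:
  assumes "p \<in> level_group a"
  obtains g m n k where "p = pmat 1 g m n k" "g \<in> Gam a" "zvec m" "zvec n" "k \<in> \<int>"
  using assms unfolding level_group_eq by auto

lemma vec_in_uminus: "rvec x \<Longrightarrow> rvec (- x)"
  by (rule vec_in_ops(3))

lemma level_group_mult: "p \<in> level_group a \<Longrightarrow> q \<in> level_group a \<Longrightarrow> p ** q \<in> level_group a"
proof -
  assume "p \<in> level_group a" "q \<in> level_group a"
  then obtain g m n k g' m' n' k' where p: "p = pmat 1 g m n k" "g \<in> Gam a" "zvec m" "zvec n" "k \<in> \<int>"
    and q: "q = pmat 1 g' m' n' k'" "g' \<in> Gam a" "zvec m'" "zvec n'" "k' \<in> \<int>"
    unfolding level_group_eq by auto
  have add: "zvec (x + y)" if "zvec x" "zvec y" for x y :: "complex ^ 'b"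
    using that by (auto simp: vec_in_def)
  have "p ** q = pmat 1 (g ** g') (m' + m v* g') (g *v n' + n) (k' + bdot m n' + k)"
    by (simp add: p(1) q(1) pmat_mult)
  moreover have "zvec (m' + m v* g')" "zvec (g *v n' + n)" "k' + bdot m n' + k \<in> \<int>"
    using p q Gam_matrix(1)[OF p(2)] Gam_matrix(1)[OF q(2)]
    by (auto intro!: add mat_in_mvmult mat_in_vmult bdot_in)
  ultimately show "p ** q \<in> level_group a"
    by (metis level_groupI Gam_mult[OF p(2) q(2)])
qed

lemma level_group_inverse:
  assumes "p \<in> level_group a"
  obtains q where "q \<in> level_group a" "p ** q = mat 1" "q ** p = mat 1"
proof -
  obtain g m n k where p: "p = pmat 1 g m n k" "g \<in> Gam a" "zvec m" "zvec n" "k \<in> \<int>"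
    using assms unfolding level_group_eq by auto
  obtain h where h: "h \<in> Gam a" "g ** h = mat 1" "h ** g = mat 1" using Gam_inverse[OF p(2)] .
  define q where "q = pmat 1 h (- (m v* h)) (- (h *v n)) (bdot m (h *v n) - k)"
  have neg: "zvec (- x)" if "zvec x" for x :: "complex ^ 'b"
    using that by (auto simp: vec_in_def)
  have "zvec (m v* h)" "zvec (h *v n)" "bdot m (h *v n) \<in> \<int>"
    using p Gam_matrix(1)[OF h(1)] by (auto intro!: mat_in_mvmult mat_in_vmult bdot_in)
  then have "q \<in> level_group a"
    unfolding q_def by (intro level_groupI h(1) neg Ints_diff p(5))
  moreover have "p ** q = mat 1" "q ** p = mat 1"
    by (simp_all add: p(1) q_def pmat_mult h vmult_assoc vmult_linear bdot_linear bdot_vmult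
        mvmult_linear matrix_vector_mul_assoc pmat_id)
  ultimately show ?thesis using that by blast
qed

lemma level_group_one: "mat 1 \<in> level_group a"
proof -
  have "pmat 1 (mat 1) 0 0 0 \<in> level_group a" by (intro level_groupI Gam_one vec_in_0 Ints_0)
  then show ?thesis by (simp add: pmat_id)
qed

lemma actM_image_mult: "actM p ` S = S' \<Longrightarrow> actM p' ` S' = S'' \<Longrightarrow> actM (p' ** p) ` S = S''"
  by (simp add: actM_mult[abs_def] flip: image_image)

lemma actM_image_inverse:
  assumes "actM p ` S = S'" "r ** p = mat 1"
  shows "actM r ` S' = S"
proof -
  have "actM r ` S' = (\<lambda>m. actM (r ** p) m) ` S" unfolding assms(1)[symmetric] image_image actM_mult ..
  then show ?thesis by (simp add: assms(2))
qed

lemma moves_inverse: "moves p q q' \<Longrightarrow> r ** p = mat 1 \<Longrightarrow> moves r q' q"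
  unfolding moves_def by (rule actM_image_inverse)

lemma moves_B_mult: "moves_B p q q' \<Longrightarrow> moves_B p' q' q'' \<Longrightarrow> moves_B (p' ** p) q q''"
  unfolding moves_B_def case_prod_unfold by (rule actM_image_mult)

lemma moves_B_inverse: "moves_B p q q' \<Longrightarrow> r ** p = mat 1 \<Longrightarrow> moves_B r q' q"
  unfolding moves_B_def case_prod_unfold by (rule actM_image_inverse)

lemma moves_id: "moves (mat 1) q q" and moves_B_id: "moves_B (mat 1) q' q'"
  by (simp_all add: moves_def moves_B_def case_prod_unfold)

text \<open>The quotient, its fibres and its topology are treated for an arbitrary matrix a; the
  properties of \<alpha> enter with the locale \<open>ribet_family\<close>.\<close>

locale poincare_family =
  fixes \<tau>0 :: "complex ^ 'd ^ 'd" and a :: "complex ^ ('d + 'd) ^ ('d + 'd)"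
  assumes base: "\<tau>0 \<in> siegel"
begin

abbreviation "H \<equiv> H_alpha \<tau>0 a"
abbreviation "D \<equiv> D_alpha \<tau>0 a"
abbreviation "R \<equiv> P_rel \<tau>0 a"
abbreviation "RB \<equiv> B_rel \<tau>0 a"
abbreviation "Ptot \<equiv> P_tot \<tau>0 a"
abbreviation "Btot \<equiv> B_tot \<tau>0 a"
abbreviation "Ptop \<equiv> P_top \<tau>0 a"
abbreviation "Fib b \<equiv> P_fibre \<tau>0 a b"
abbreviation "cls q \<equiv> R `` {q}"
abbreviation "clsB q \<equiv> RB `` {q}"
abbreviation "cpt \<tau> x y z \<equiv> cls (pt \<tau> x y z)"
abbreviation "cptB \<tau> x \<equiv> clsB (\<tau>, upt \<tau> x)"

lemma H_siegel: "\<tau> \<in> H \<Longrightarrow> \<tau> \<in> siegel"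
  by (simp add: H_alpha_iff)

lemma D_iff: "q \<in> D \<longleftrightarrow> fst q \<in> H"
  using D_alpha_eq[OF base] by simp

lemma base_in_H: "\<tau>0 \<in> H"
  unfolding H_alpha_iff using base G_real_plus_one[of a] by (force simp: image_def)

lemma R_iff: "(q, q') \<in> R \<longleftrightarrow> q \<in> D \<and> q' \<in> D \<and> (\<exists>p\<in>level_group a. moves p q q')"
  by (simp add: P_rel_def)

lemma R_equiv: "equiv D R"
proof (rule equivI)
  show "refl_on D R"
  proof (rule refl_onI)
    fix q assume "q \<in> D" then show "(q, q) \<in> R"
      unfolding R_iff using moves_id[of q] level_group_one[of a] by blast
  qed
  show "sym R"
  proof (rule symI)
    fix q q' assume "(q, q') \<in> R"
    then obtain p where p: "q \<in> D" "q' \<in> D" "p \<in> level_group a" "moves p q q'" unfolding R_iff by blast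
    obtain r where "r \<in> level_group a" "r ** p = mat 1" using level_group_inverse[OF p(3)] by metis
    then show "(q', q) \<in> R" unfolding R_iff using p moves_inverse[OF p(4)] by blast
  qed
  show "trans R"
  proof (rule transI)
    fix q q' q'' assume "(q, q') \<in> R" "(q', q'') \<in> R"
    then obtain p p' where p: "q \<in> D" "q'' \<in> D" "p \<in> level_group a" "moves p q q'"
      "p' \<in> level_group a" "moves p' q' q''" unfolding R_iff by blast
    then show "(q, q'') \<in> R"
      unfolding R_iff using moves_mult[OF p(4,6)] level_group_mult[OF p(5,3)] by blast
  qed
  show "R \<subseteq> D \<times> D" using R_iff by auto
qed

lemma B_rel_iff: "(q, q') \<in> RB \<longleftrightarrow> fst q \<in> H \<and> fst q' \<in> H \<and> (\<exists>p\<in>level_group a. moves_B p q q')"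
  by (simp add: B_rel_def)

lemma B_rel_equiv: "equiv (H \<times> UNIV) (RB)"
proof (rule equivI)
  show "refl_on (H \<times> UNIV) (RB)"
  proof (rule refl_onI)
    fix q :: "'d bpoint" assume "q \<in> H \<times> UNIV" then show "(q, q) \<in> RB"
      unfolding B_rel_iff using moves_B_id[of q] level_group_one[of a] by auto
  qed
  show "sym (RB)"
  proof (rule symI)
    fix q q' assume "(q, q') \<in> RB"
    then obtain p where p: "fst q \<in> H" "fst q' \<in> H" "p \<in> level_group a" "moves_B p q q'"
      unfolding B_rel_iff by blast
    obtain r where "r \<in> level_group a" "r ** p = mat 1" using level_group_inverse[OF p(3)] by metis
    then show "(q', q) \<in> RB" unfolding B_rel_iff using p moves_B_inverse[OF p(4)] by blast
  qed
  show "trans (RB)"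
  proof (rule transI)
    fix q q' q'' assume "(q, q') \<in> RB" "(q', q'') \<in> RB"
    then obtain p p' where p: "fst q \<in> H" "fst q'' \<in> H" "p \<in> level_group a" "moves_B p q q'"
      "p' \<in> level_group a" "moves_B p' q' q''" unfolding B_rel_iff by blast
    then show "(q, q'') \<in> RB"
      unfolding B_rel_iff using moves_B_mult[OF p(4,6)] level_group_mult[OF p(5,3)] by blast
  qed
  show "RB \<subseteq> (H \<times> UNIV) \<times> (H \<times> UNIV)"
    by (auto simp: B_rel_def)
qed

text \<open>The term \<open>bdot m y\<close> is the cocycle of the Poincare torsor in real
  coordinates. It is additive in y, which gives the group law on fibres, and real, which makes Im z
  invariant.\<close>

lemma R_pt_iff:
  assumes "\<tau> \<in> H" "\<tau>' \<in> H" "rvec x" "rvec y" "rvec x'" "rvec y'"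
  shows "(pt \<tau> x y z, pt \<tau>' x' y' z') \<in> R \<longleftrightarrow>
    (\<exists>g\<in>Gam a. \<exists>m n k. zvec m \<and> zvec n \<and> k \<in> \<int> \<and> (*v) g ` Lag \<tau> = Lag \<tau>' \<and>
       x' v* g = x + m \<and> y' = g *v y + n \<and> z' = z + bdot m y + k)"
proof -
  have *: "moves (pmat 1 g m n k) (pt \<tau> x y z) (pt \<tau>' x' y' z') \<longleftrightarrow> (*v) g ` Lag \<tau> = Lag \<tau>' \<and>
       x' v* g = x + m \<and> y' = g *v y + n \<and> z' = z + bdot m y + k"
    if "g \<in> Gam a" "zvec m" "zvec n" for g m n k
    using moves_pt[of \<tau> \<tau>' g 1 m n x y x' y' k z z'] assms that Gam_matrix(2)[OF that(1)] H_siegel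
      vec_in_Ints_Reals by auto
  have "(pt \<tau> x y z, pt \<tau>' x' y' z') \<in> R \<longleftrightarrow>
      (\<exists>p\<in>level_group a. moves p (pt \<tau> x y z) (pt \<tau>' x' y' z'))"
    using assms by (simp add: R_iff D_iff)
  also have "\<dots> \<longleftrightarrow> (\<exists>g\<in>Gam a. \<exists>m n k. zvec m \<and> zvec n \<and> k \<in> \<int> \<and>
      moves (pmat 1 g m n k) (pt \<tau> x y z) (pt \<tau>' x' y' z'))"
    unfolding level_group_eq by blast
  finally show ?thesis using * by (auto; metis)
qed

lemma B_rel_pt_iff:
  assumes "\<tau> \<in> H" "\<tau>' \<in> H" "rvec x" "rvec x'"
  shows "((\<tau>, upt \<tau> x), (\<tau>', upt \<tau>' x')) \<in> RB \<longleftrightarrow>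
    (\<exists>g\<in>Gam a. \<exists>m. zvec m \<and> (*v) g ` Lag \<tau> = Lag \<tau>' \<and> x' v* g = x + m)"
proof -
  have *: "moves_B (pmat 1 g m n k) (\<tau>, upt \<tau> x) (\<tau>', upt \<tau>' x') \<longleftrightarrow>
      (*v) g ` Lag \<tau> = Lag \<tau>' \<and> x' v* g = x + m"
    if "g \<in> Gam a" "zvec m" for g m n k
    using moves_B_pt[of \<tau> \<tau>' g 1 m x x' n k] assms that Gam_matrix(2)[OF that(1)] H_siegel
      vec_in_Ints_Reals by auto
  have "((\<tau>, upt \<tau> x), (\<tau>', upt \<tau>' x')) \<in> RB \<longleftrightarrow>
      (\<exists>p\<in>level_group a. moves_B p (\<tau>, upt \<tau> x) (\<tau>', upt \<tau>' x'))"
    using assms by (simp add: B_rel_def)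
  also have "\<dots> \<longleftrightarrow> (\<exists>g\<in>Gam a. \<exists>m n k. zvec m \<and> zvec n \<and> k \<in> \<int> \<and>
      moves_B (pmat 1 g m n k) (\<tau>, upt \<tau> x) (\<tau>', upt \<tau>' x'))"
    unfolding level_group_eq by blast
  finally show ?thesis using * vec_in_0(2) Ints_0 by (auto; metis)
qed

lemma D_cases:
  assumes "q \<in> D"
  obtains \<tau> x y z where "\<tau> \<in> H" "rvec x" "rvec y" "q = pt \<tau> x y z"
  using pt_surj[of q] assms H_siegel D_iff by metis

lemma BH_cases:
  assumes "q \<in> H \<times> UNIV"
  obtains \<tau> x where "\<tau> \<in> H" "rvec x" "q = (\<tau>, upt \<tau> x)"
  using upt_surj[of "fst q" "snd q"] assms H_siegel by (metis SigmaE fst_conv snd_conv)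

lemma P_tot_cases:
  assumes "c \<in> Ptot"
  obtains \<tau> x y z where "\<tau> \<in> H" "rvec x" "rvec y" "c = cpt \<tau> x y z"
  using assms unfolding P_tot_def by (metis D_cases quotientE)

lemma B_tot_cases:
  assumes "b \<in> Btot"
  obtains \<tau> x where "\<tau> \<in> H" "rvec x" "b = cptB \<tau> x"
  using assms unfolding B_tot_def by (metis BH_cases quotientE)

lemma pt_in_D: "\<tau> \<in> H \<Longrightarrow> pt \<tau> x y z \<in> D"
  by (simp add: D_iff)

lemma cpt_in_P_tot: "\<tau> \<in> H \<Longrightarrow> cpt \<tau> x y z \<in> Ptot"
  unfolding P_tot_def by (intro quotientI pt_in_D)

lemma cptB_in_B_tot: "\<tau> \<in> H \<Longrightarrow> cptB \<tau> x \<in> Btot"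
  unfolding B_tot_def by (intro quotientI) auto

lemma cls_eq_iff: "q \<in> D \<Longrightarrow> q' \<in> D \<Longrightarrow> cls q = cls q' \<longleftrightarrow> (q, q') \<in> R"
  using eq_equiv_class_iff[OF R_equiv] by blast

lemma clsB_eq_iff: "q \<in> H \<times> UNIV \<Longrightarrow> q' \<in> H \<times> UNIV \<Longrightarrow> clsB q = clsB q' \<longleftrightarrow> (q, q') \<in> RB"
  using eq_equiv_class_iff[OF B_rel_equiv] by blast

lemma cls_eqI: "(q, q') \<in> R \<Longrightarrow> cls q = cls q'"
  using equiv_class_eq[OF R_equiv] by blast

text \<open>Group law, unit and \<open>\<complex>\<^sup>\<times>\<close>-action are defined by
  saturating a set of representatives; to identify the result it suffices that this set is nonempty
  and lies in one class.\<close>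

lemma Image_subset_class:
  assumes "S \<subseteq> cls q" "s \<in> S"
  shows "R `` S = cls q"
proof -
  have "cls t = cls q" if "t \<in> S" for t
    using that assms(1) cls_eqI by blast
  then show ?thesis using assms(2) unfolding Image_def by blast
qed

text \<open>Freeness in relative form: the element that relates two points is determined by their
  projections to the Siegel space.\<close>

lemma Gam_fixes:
  assumes "g \<in> Gam a" "g' \<in> Gam a" "\<tau> \<in> siegel" "(*v) g ` Lag \<tau> = (*v) g' ` Lag \<tau>"
  shows "g = g'"
proof -
  obtain h where h: "h \<in> Gam a" "g' ** h = mat 1" "h ** g' = mat 1" using Gam_inverse[OF assms(2)] .
  have "(*v) (h ** g) ` Lag \<tau> = (*v) (h ** g') ` Lag \<tau>" unfolding image_mvmult assms(4) ..
  then have "(*v) (h ** g) ` Lag \<tau> \<subseteq> Lag \<tau>" unfolding h by auto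
  then have "h ** g = mat 1" by (intro Gam_free[OF assms(3) Gam_mult[OF h(1) assms(1)]])
  then have "g' ** (h ** g) = g'" by simp
  then show ?thesis by (simp add: matrix_mul_assoc h)
qed

lemma cpt_eq_iff:
  assumes "\<tau> \<in> H" "rvec x" "rvec y" "rvec y'"
  shows "cpt \<tau> x y z = cpt \<tau> x y' z' \<longleftrightarrow> zvec (y' - y) \<and> z' - z \<in> \<int>"
proof
  assume "cpt \<tau> x y z = cpt \<tau> x y' z'"
  then have "(pt \<tau> x y z, pt \<tau> x y' z') \<in> R" using cls_eq_iff pt_in_D assms by blast
  then obtain g m n k where g: "g \<in> Gam a" "zvec m" "zvec n" "k \<in> \<int>" "(*v) g ` Lag \<tau> = Lag \<tau>"
      "x v* g = x + m" "y' = g *v y + n" "z' = z + bdot m y + k"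
    using R_pt_iff[of \<tau> \<tau> x y x y'] assms by blast
  have "g = mat 1" using Gam_free[OF H_siegel[OF assms(1)] g(1)] g(5) by blast
  then show "zvec (y' - y) \<and> z' - z \<in> \<int>" using g by (simp add: bdot_linear)
next
  assume *: "zvec (y' - y) \<and> z' - z \<in> \<int>"
  have "(*v) (mat 1) ` Lag \<tau> = Lag \<tau>" by (auto simp: image_def)
  then have "(pt \<tau> x y z, pt \<tau> x y' z') \<in> R"
    unfolding R_pt_iff[OF assms(1,1,2,3,2,4)]
    by (intro bexI[OF _ Gam_one] exI[of _ 0] exI[of _ "y' - y"] exI[of _ "z' - z"])
      (use * in \<open>auto simp: bdot_linear\<close>)
  then show "cpt \<tau> x y z = cpt \<tau> x y' z'" by (rule cls_eqI)
qed


subsection \<open>The fibres\<close>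

lemma cls_proj:
  assumes "\<tau> \<in> H" "rvec x" "rvec y"
  shows "P_proj \<tau>0 a (cpt \<tau> x y z) = cptB \<tau> x"
proof -
  have "(\<lambda>(\<tau>, u, v, w). (\<tau>, u)) ` cpt \<tau> x y z \<subseteq> cptB \<tau> x"
  proof (rule subsetI)
    fix t assume "t \<in> (\<lambda>(\<tau>, u, v, w). (\<tau>, u)) ` cpt \<tau> x y z"
    then obtain q where q: "(pt \<tau> x y z, q) \<in> R" "t = (fst q, fst (snd q))"
      by (auto simp: case_prod_unfold)
    obtain \<sigma> x' y' z' where q': "\<sigma> \<in> H" "rvec x'" "rvec y'" "q = pt \<sigma> x' y' z'"
      using q(1) D_cases R_iff by metis
    then obtain g m where "g \<in> Gam a" "zvec m" "(*v) g ` Lag \<tau> = Lag \<sigma>" "x' v* g = x + m"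
      using q(1) R_pt_iff[of \<tau> \<sigma> x y x' y' z z'] assms by auto
    then have "((\<tau>, upt \<tau> x), (\<sigma>, upt \<sigma> x')) \<in> RB"
      using B_rel_pt_iff[of \<tau> \<sigma> x x'] assms q' by blast
    then show "t \<in> cptB \<tau> x" using q(2) q'(4) by (simp add: pt_def)
  qed
  moreover have "(\<tau>, upt \<tau> x) \<in> (\<lambda>(\<tau>, u, v, w). (\<tau>, u)) ` cpt \<tau> x y z"
    using equiv_class_self[OF R_equiv pt_in_D[OF assms(1)]] by (force simp: pt_def)
  moreover have "clsB t = cptB \<tau> x" if "t \<in> cptB \<tau> x" for t
    using that equiv_class_eq[OF B_rel_equiv] by blast
  ultimately show ?thesis unfolding P_proj_def Image_def by blast
qed

lemma fibre_carrier:
  assumes "\<tau> \<in> H" "rvec x"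
  shows "carrier (Fib (cptB \<tau> x)) = {cpt \<tau> x y z | y z. rvec y}"
proof (intro equalityI subsetI)
  fix c assume "c \<in> carrier (Fib (cptB \<tau> x))"
  then have c: "c \<in> Ptot" "P_proj \<tau>0 a c = cptB \<tau> x" by (auto simp: P_fibre_def)
  then obtain \<tau>' x' y' z' where c': "\<tau>' \<in> H" "rvec x'" "rvec y'" "c = cpt \<tau>' x' y' z'"
    using P_tot_cases by metis
  then have "cptB \<tau>' x' = cptB \<tau> x" using c(2) cls_proj by metis
  then have "((\<tau>', upt \<tau>' x'), (\<tau>, upt \<tau> x)) \<in> RB"
    using clsB_eq_iff assms c' by blast
  then obtain g m where g: "g \<in> Gam a" "zvec m" "(*v) g ` Lag \<tau>' = Lag \<tau>" "x v* g = x' + m"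
    using B_rel_pt_iff c' assms by blast
  have y: "rvec (g *v y')" using c'(3) Gam_matrix(2)[OF g(1)] by (simp add: vec_in_mvmult)
  \<comment> \<open>The element relating the two points of B, taken with n = 0 and k = 0, moves the
    representative into the fibre over the prescribed \<tau> and x.\<close>
  have "(pt \<tau>' x' y' z', pt \<tau> x (g *v y') (z' + bdot m y')) \<in> R"
    unfolding R_pt_iff[OF c'(1) assms(1) c'(2,3) assms(2) y]
    by (intro bexI[OF _ g(1)] exI[of _ m] exI[of _ 0]) (use g in auto)
  then have "c = cpt \<tau> x (g *v y') (z' + bdot m y')" unfolding c'(4) by (rule cls_eqI)
  then show "c \<in> {cpt \<tau> x y z | y z. rvec y}" using y by blast
next
  fix c assume "c \<in> {cpt \<tau> x y z | y z. rvec y}"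
  then show "c \<in> carrier (Fib (cptB \<tau> x))"
    using assms cls_proj cpt_in_P_tot by (auto simp: P_fibre_def)
qed

lemma pt_add: "pt \<tau> x y z = (\<tau>', u, v, w) \<Longrightarrow> pt \<tau> x y' z' = (\<tau>', u, v', w') \<Longrightarrow>
    (\<tau>', u, v + v', w + w') = pt \<tau> x (y + y') (z + z')"
  by (auto simp: pt_def mvmult_linear bdot_linear algebra_simps)

text \<open>The definition adds representatives with common \<tau> and u. Reality gives them the
  same x, freeness the same g and hence the same m, and then the shifts \<open>bdot m y\<close> and
  \<open>bdot m y'\<close> add up to the one for y + y'.\<close>

lemma fibre_mult:
  assumes "\<tau> \<in> H" "rvec x" "rvec y" "rvec y'"
  shows "cpt \<tau> x y z \<otimes>\<^bsub>Fib b\<^esub> cpt \<tau> x y' z' = cpt \<tau> x (y + y') (z + z')"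
proof -
  define S where "S = {(\<tau>', u, v + v', w + w') | \<tau>' u v w v' w'.
      (\<tau>', u, v, w) \<in> cpt \<tau> x y z \<and> (\<tau>', u, v', w') \<in> cpt \<tau> x y' z'}"
  have yy: "rvec (y + y')" using assms by (simp add: vec_in_ops)
  have "S \<subseteq> cpt \<tau> x (y + y') (z + z')"
  proof safe
    fix s1 s2 s3 s4 assume "(s1, s2, s3, s4) \<in> S"
    then obtain v w v' w' where s: "s3 = v + v'" "s4 = w + w'"
      "(pt \<tau> x y z, (s1, s2, v, w)) \<in> R" "(pt \<tau> x y' z', (s1, s2, v', w')) \<in> R"
      by (auto simp: S_def)
    obtain \<sigma> x1 y1 z1 where q1: "\<sigma> \<in> H" "rvec x1" "rvec y1" "(s1, s2, v, w) = pt \<sigma> x1 y1 z1"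
      using s(3) D_cases R_iff by metis
    obtain \<sigma>' x2 y2 z2 where q2: "\<sigma>' \<in> H" "rvec x2" "rvec y2" "(s1, s2, v', w') = pt \<sigma>' x2 y2 z2"
      using s(4) D_cases R_iff by metis
    have eq: "\<sigma>' = \<sigma>" "x2 = x1"
      using q1 q2 upt_cong_iff[OF H_siegel, of \<sigma> x2 x1] by (auto simp: pt_def)
    obtain g m n k where g: "g \<in> Gam a" "zvec m" "zvec n" "k \<in> \<int>" "(*v) g ` Lag \<tau> = Lag \<sigma>"
      "x1 v* g = x + m" "y1 = g *v y + n" "z1 = z + bdot m y + k"
      using s(3) R_pt_iff[of \<tau> \<sigma> x y x1 y1] assms q1 by auto
    obtain g' m' n' k' where g': "g' \<in> Gam a" "zvec m'" "zvec n'" "k' \<in> \<int>" "(*v) g' ` Lag \<tau> = Lag \<sigma>"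
      "x1 v* g' = x + m'" "y2 = g' *v y' + n'" "z2 = z' + bdot m' y' + k'"
      using s(4) R_pt_iff[of \<tau> \<sigma> x y' x1 y2] assms q1 q2 unfolding eq by auto
    have gg: "g' = g" using Gam_fixes[OF g'(1) g(1) H_siegel[OF assms(1)]] g(5) g'(5) by simp
    then have mm: "m' = m" using g(6) g'(6) by simp
    have "(s1, s2, s3, s4) = pt \<sigma> x1 (y1 + y2) (z1 + z2)"
      unfolding s by (rule pt_add) (use q1 q2 eq in auto)
    moreover have "(pt \<tau> x (y + y') (z + z'), pt \<sigma> x1 (y1 + y2) (z1 + z2)) \<in> R"
      unfolding R_pt_iff[OF assms(1) q1(1) assms(2) yy q1(2) vec_in_ops(1)[OF q1(3) q2(3)]]
      by (intro bexI[OF _ g(1)] exI[of _ m] exI[of _ "n + n'"] exI[of _ "k + k'"])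
        (use g g' gg mm in \<open>auto simp: mvmult_linear bdot_linear vec_in_def\<close>)
    ultimately show "(pt \<tau> x (y + y') (z + z'), (s1, s2, s3, s4)) \<in> R" by simp
  qed
  moreover have "pt \<tau> x (y + y') (z + z') \<in> S"
  proof -
    obtain u v w v' w' where *: "pt \<tau> x y z = (\<tau>, u, v, w)" "pt \<tau> x y' z' = (\<tau>, u, v', w')"
      by (auto simp: pt_def)
    have "(\<tau>, u, v, w) \<in> cpt \<tau> x y z" "(\<tau>, u, v', w') \<in> cpt \<tau> x y' z'"
      using equiv_class_self[OF R_equiv pt_in_D[OF assms(1)]] * by metis+
    then show ?thesis unfolding pt_add[OF *, symmetric] S_def by blast
  qed
  ultimately have "R `` S = cpt \<tau> x (y + y') (z + z')" by (rule Image_subset_class)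
  then show ?thesis by (simp add: P_fibre_def S_def)
qed

lemma fibre_one:
  assumes "\<tau> \<in> H" "rvec x"
  shows "\<one>\<^bsub>Fib (cptB \<tau> x)\<^esub> = cpt \<tau> x 0 0"
proof -
  let ?S = "(\<lambda>(\<tau>, u). (\<tau>, u, 0, 0)) ` cptB \<tau> x"
  have zero: "pt \<sigma> s 0 0 = (\<sigma>, upt \<sigma> s, 0, 0)" for \<sigma> :: "complex ^ 'd ^ 'd" and s
    by (simp add: pt_def mvmult_linear bdot_linear)
  have "?S \<subseteq> cpt \<tau> x 0 0"
  proof safe
    fix \<sigma> u assume *: "((\<tau>, upt \<tau> x), (\<sigma>, u)) \<in> RB"
    then obtain s where s: "\<sigma> \<in> H" "rvec s" "u = upt \<sigma> s"
      using upt_surj[of \<sigma> u] H_siegel by (auto simp: B_rel_def)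
    obtain g m where g: "g \<in> Gam a" "zvec m" "(*v) g ` Lag \<tau> = Lag \<sigma>" "s v* g = x + m"
      using * s B_rel_pt_iff[of \<tau> \<sigma> x s] assms by auto
    have "(pt \<tau> x 0 0, pt \<sigma> s 0 0) \<in> R"
      unfolding R_pt_iff[OF assms(1) s(1) assms(2) vec_in_0(1) s(2) vec_in_0(1)]
      by (intro bexI[OF _ g(1)] exI[of _ m] exI[of _ 0]) (use g in \<open>auto simp: bdot_linear mvmult_linear\<close>)
    then show "(pt \<tau> x 0 0, (\<sigma>, u, 0, 0)) \<in> R" by (simp add: zero s)
  qed
  moreover have "pt \<tau> x 0 0 \<in> ?S"
    unfolding zero using equiv_class_self[OF B_rel_equiv, of "(\<tau>, upt \<tau> x)"] assms(1)
    by (intro image_eqI[of _ _ "(\<tau>, upt \<tau> x)"]) auto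
  ultimately have "R `` ?S = cpt \<tau> x 0 0" by (rule Image_subset_class)
  then show ?thesis by (simp add: P_fibre_def)
qed

lemma fibre_group:
  assumes "b \<in> Btot"
  shows "group (Fib b)"
proof -
  obtain \<tau> x where b: "\<tau> \<in> H" "rvec x" "b = cptB \<tau> x" using B_tot_cases[OF assms] .
  note car = fibre_carrier[OF b(1,2), folded b(3)] and one = fibre_one[OF b(1,2), folded b(3)]
    and mult = fibre_mult[OF b(1,2), where b = b]
  show ?thesis
  proof (rule groupI)
    fix c c' assume "c \<in> carrier (Fib b)" "c' \<in> carrier (Fib b)"
    then obtain y z y' z' where c: "c = cpt \<tau> x y z" "rvec y" "c' = cpt \<tau> x y' z'" "rvec y'"
      unfolding car by blast
    then show "c \<otimes>\<^bsub>Fib b\<^esub> c' \<in> carrier (Fib b)"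
      unfolding car c(1,3) mult[OF c(2,4)] using vec_in_ops(1) by blast
  next
    show "\<one>\<^bsub>Fib b\<^esub> \<in> carrier (Fib b)"
      unfolding car one using vec_in_0 by blast
  next
    fix c c' c'' assume "c \<in> carrier (Fib b)" "c' \<in> carrier (Fib b)" "c'' \<in> carrier (Fib b)"
    then obtain y z y' z' y'' z'' where c: "c = cpt \<tau> x y z" "rvec y" "c' = cpt \<tau> x y' z'" "rvec y'"
       "c'' = cpt \<tau> x y'' z''" "rvec y''"
      unfolding car by blast
    show "c \<otimes>\<^bsub>Fib b\<^esub> c' \<otimes>\<^bsub>Fib b\<^esub> c'' = c \<otimes>\<^bsub>Fib b\<^esub> (c' \<otimes>\<^bsub>Fib b\<^esub> c'')"
      unfolding c(1,3,5) mult[OF c(2,4)] mult[OF c(4,6)] mult[OF vec_in_ops(1)[OF c(2,4)] c(6)]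
        mult[OF c(2) vec_in_ops(1)[OF c(4,6)]] by (simp add: add.assoc)
  next
    fix c assume "c \<in> carrier (Fib b)"
    then obtain y z where c: "c = cpt \<tau> x y z" "rvec y" unfolding car by blast
    show "\<one>\<^bsub>Fib b\<^esub> \<otimes>\<^bsub>Fib b\<^esub> c = c"
      unfolding c(1) one mult[OF vec_in_0(1) c(2)] by simp
    have "cpt \<tau> x (- y) (- z) \<otimes>\<^bsub>Fib b\<^esub> c = \<one>\<^bsub>Fib b\<^esub>"
      unfolding c(1) one mult[OF vec_in_uminus[OF c(2)] c(2)] by simp
    moreover have "cpt \<tau> x (- y) (- z) \<in> carrier (Fib b)"
      unfolding car using vec_in_uminus[OF c(2)] by blast
    ultimately show "\<exists>c'\<in>carrier (Fib b). c' \<otimes>\<^bsub>Fib b\<^esub> c = \<one>\<^bsub>Fib b\<^esub>" by blast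
  qed
qed

lemma fibre_inv:
  assumes "\<tau> \<in> H" "rvec x" "rvec y"
  shows "inv\<^bsub>Fib (cptB \<tau> x)\<^esub> (cpt \<tau> x y z) = cpt \<tau> x (- y) (- z)"
proof (rule group.inv_equality[OF fibre_group[OF cptB_in_B_tot[OF assms(1)]]])
  show "cpt \<tau> x (- y) (- z) \<otimes>\<^bsub>Fib (cptB \<tau> x)\<^esub> cpt \<tau> x y z = \<one>\<^bsub>Fib (cptB \<tau> x)\<^esub>"
    using assms by (simp add: fibre_mult fibre_one vec_in_uminus)
  show "cpt \<tau> x y z \<in> carrier (Fib (cptB \<tau> x))"
    "cpt \<tau> x (- y) (- z) \<in> carrier (Fib (cptB \<tau> x))"
    using assms by (auto simp: fibre_carrier intro: vec_in_uminus)
qed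

lemma fibre_nat_pow:
  assumes "\<tau> \<in> H" "rvec x" "rvec y"
  shows "cpt \<tau> x y z [^]\<^bsub>Fib (cptB \<tau> x)\<^esub> (n::nat) = cpt \<tau> x (of_nat n *s y) (of_nat n * z)"
proof (induction n)
  case 0
  then show ?case by (simp add: nat_pow_def fibre_one[OF assms(1,2)])
next
  case (Suc n)
  have "rvec (of_nat n *s y)" using assms(3) by (intro vec_in_scale) auto
  then show ?case
    using Suc fibre_mult[OF assms(1,2) _ assms(3), of "of_nat n *s y"]
    by (simp add: nat_pow_def vector_sadd_rdistrib algebra_simps)
qed

lemma fibre_int_pow:
  assumes "\<tau> \<in> H" "rvec x" "rvec y"
  shows "cpt \<tau> x y z [^]\<^bsub>Fib (cptB \<tau> x)\<^esub> (n::int) = cpt \<tau> x (of_int n *s y) (of_int n * z)"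
proof (cases "n \<ge> 0")
  case True
  then obtain k where "n = int k" using zero_le_imp_eq_int by blast
  then show ?thesis using fibre_nat_pow[OF assms, of z k] by (simp add: int_pow_int)
next
  case False
  then have "n = - int (nat (- n))" by simp
  then obtain k where k: "n = - int k" ..
  interpret group "Fib (cptB \<tau> x)" by (rule fibre_group[OF cptB_in_B_tot[OF assms(1)]])
  have c: "cpt \<tau> x y z \<in> carrier (Fib (cptB \<tau> x))"
    using assms by (auto simp: fibre_carrier)
  have r: "rvec (of_nat k *s y)" using assms(3) by (intro vec_in_scale) auto
  have "cpt \<tau> x y z [^]\<^bsub>Fib (cptB \<tau> x)\<^esub> n = inv\<^bsub>Fib (cptB \<tau> x)\<^esub> cpt \<tau> x (of_nat k *s y) (of_nat k * z)"
    unfolding k int_pow_neg[OF c] int_pow_int fibre_nat_pow[OF assms] ..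
  then show ?thesis unfolding fibre_inv[OF assms(1,2) r] by (simp add: k)
qed


subsection \<open>The quotient topology\<close>

lemma istopology_quotient:
  "istopology (\<lambda>V. V \<subseteq> Ptot \<and> openin (top_of_set D) (\<Union>V))"
  unfolding istopology_def
proof (intro conjI allI impI)
  fix V W assume V: "V \<subseteq> Ptot \<and> openin (top_of_set D) (\<Union>V)"
    and W: "W \<subseteq> Ptot \<and> openin (top_of_set D) (\<Union>W)"
  have "\<Union>(V \<inter> W) = \<Union>V \<inter> \<Union>W"
    using V W quotient_disj[OF R_equiv] unfolding P_tot_def by blast
  then show "openin (top_of_set D) (\<Union>(V \<inter> W))" using V W by auto
next
  fix K assume K: "\<forall>V\<in>K. V \<subseteq> Ptot \<and> openin (top_of_set D) (\<Union>V)"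
  have "\<Union>(\<Union>K) = (\<Union>V\<in>K. \<Union>V)" by blast
  then show "openin (top_of_set D) (\<Union>(\<Union>K))" using K by auto
qed blast+

lemma openin_P_top: "openin (Ptop) V \<longleftrightarrow> V \<subseteq> Ptot \<and> openin (top_of_set D) (\<Union>V)"
  unfolding P_top_def topology_inverse'[OF istopology_quotient] ..

lemma Union_P_tot: "\<Union>(Ptot) = D"
  unfolding P_tot_def by (rule Union_quotient[OF R_equiv])

lemma topspace_P_top [simp]: "topspace (Ptop) = Ptot"
proof -
  have "openin (Ptop) (Ptot)" by (simp add: openin_P_top Union_P_tot)
  then have "Ptot \<subseteq> topspace (Ptop)" by (rule openin_subset)
  moreover have "topspace (Ptop) \<subseteq> Ptot"
    using openin_topspace[of "Ptop"] unfolding openin_P_top by blast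
  ultimately show ?thesis by blast
qed

lemma cls_in_P_tot: "q \<in> D \<Longrightarrow> cls q \<in> Ptot"
  unfolding P_tot_def by (rule quotientI)

lemma Union_preimage:
  assumes "V \<subseteq> Ptot"
  shows "\<Union>V = {q \<in> D. cls q \<in> V}"
proof (intro equalityI subsetI)
  fix q assume "q \<in> \<Union>V"
  then obtain c where c: "c \<in> V" "q \<in> c" by blast
  then have "c \<in> D // R" using assms unfolding P_tot_def by blast
  then obtain p where p: "c = cls p" "p \<in> D" by (rule quotientE)
  then have "cls q = c" "q \<in> D" using c(2) cls_eqI R_iff by auto
  then show "q \<in> {q \<in> D. cls q \<in> V}" using c by simp
next
  fix q assume "q \<in> {q \<in> D. cls q \<in> V}"
  then show "q \<in> \<Union>V" using equiv_class_self[OF R_equiv] by blast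
qed

text \<open>An element of the level group may carry D off itself, so one pair of points of D related
  by p is presupposed. \<open>Gam_preserves_orbit\<close> then makes p act on all of D, by a formula
  continuous in the real coordinates.\<close>

lemma level_group_continuous:
  assumes p: "p \<in> level_group a" and q0: "q0 \<in> D" "q0' \<in> D" "moves p q0 q0'"
  obtains \<phi> where "continuous_on D \<phi>" "\<phi> ` D \<subseteq> D" "\<And>q q'. q \<in> D \<Longrightarrow> q' \<in> D \<and> moves p q q' \<longleftrightarrow> q' = \<phi> q"
proof -
  obtain g m n k where p': "p = pmat 1 g m n k" "g \<in> Gam a" "zvec m" "zvec n" "k \<in> \<int>"
    using level_groupE[OF p] .
  obtain h where h: "h \<in> Gam a" "g ** h = mat 1" "h ** g = mat 1" using Gam_inverse[OF p'(2)] .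
  note gR = Gam_matrix(2)[OF p'(2)] and hR = Gam_matrix(2)[OF h(1)] and gS = Gam_matrix(3)[OF p'(2)]
  have mn: "rvec m" "rvec n" using p' vec_in_Ints_Reals by auto
  define \<phi> where "\<phi> q = pt (mobius g (fst q)) ((xco q + m) v* h) (g *v yco q + n) (zco q + bdot m (yco q) + k)" for q
  have real: "rvec ((xco q + m) v* h)" "rvec (g *v yco q + n)" for q
    using coords_real[of q] gR hR mn by (auto intro!: vec_in_vmult vec_in_mvmult vec_in_ops)
  have moves: "moves p q (pt \<tau>' x' y' z') \<longleftrightarrow> \<tau>' = mobius g (fst q) \<and> x' = (xco q + m) v* h \<and>
      y' = g *v yco q + n \<and> z' = zco q + bdot m (yco q) + k"
    if q: "q \<in> D" "\<tau>' \<in> siegel" "rvec x'" "rvec y'" for q \<tau>' x' y' z'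
  proof -
    have s: "fst q \<in> siegel" using q H_siegel D_iff by blast
    have "moves p q (pt \<tau>' x' y' z') \<longleftrightarrow>
        moves (pmat 1 g m n k) (pt (fst q) (xco q) (yco q) (zco q)) (pt \<tau>' x' y' z')"
      by (simp add: p'(1) pt_coords[OF s])
    also have "\<dots> \<longleftrightarrow> (*v) g ` Lag (fst q) = Lag \<tau>' \<and> x' v* g = xco q + m \<and> y' = g *v yco q + n \<and>
        z' = zco q + bdot m (yco q) + k"
      using moves_pt[OF s q(2) gR _ mn coords_real[of q] q(3,4), of 1 k "zco q" z'] by simp
    also have "(*v) g ` Lag (fst q) = Lag \<tau>' \<longleftrightarrow> \<tau>' = mobius g (fst q)"
      using mobius_eqI[OF s gS] mobius_Lag(2)[OF s gS] by auto
    also have "x' v* g = xco q + m \<longleftrightarrow> x' = (xco q + m) v* h"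
      using h by (metis vmult_assoc vmult_mat_1)
    finally show ?thesis .
  qed
  obtain \<tau>' x' y' z' where q0': "\<tau>' \<in> H" "rvec x'" "rvec y'" "q0' = pt \<tau>' x' y' z'"
    using D_cases[OF q0(2)] .
  have H: "mobius g \<tau> \<in> H" if "\<tau> \<in> H" for \<tau>
  proof (rule Gam_preserves_orbit[OF p'(2), of "fst q0" _ \<tau>'])
    show "fst q0 \<in> H" using q0 D_iff by simp
    then show "(*v) g ` Lag (fst q0) = Lag \<tau>'"
      using moves[OF q0(1) H_siegel[OF q0'(1)] q0'(2,3), of z'] q0 q0'(4) mobius_Lag(2)[OF H_siegel gS] by simp
  qed (use q0' that in auto)
  show ?thesis
  proof (rule that)
    have sieg: "q \<in> D \<Longrightarrow> fst q \<in> siegel" for q :: "'d point" using H_siegel D_iff by blast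
    show "continuous_on D \<phi>" unfolding \<phi>_def
      by (intro pt_continuous mobius_continuous gS continuous_intros coords_continuous sieg)
    show "\<phi> ` D \<subseteq> D" using H by (auto simp: \<phi>_def D_iff)
    fix q q' assume q: "q \<in> D"
    show "q' \<in> D \<and> moves p q q' \<longleftrightarrow> q' = \<phi> q"
    proof
      assume *: "q' \<in> D \<and> moves p q q'"
      then obtain \<sigma> x y z where q': "\<sigma> \<in> H" "rvec x" "rvec y" "q' = pt \<sigma> x y z"
        using D_cases by metis
      then show "q' = \<phi> q" using moves[OF q H_siegel[OF q'(1)] q'(2,3)] * by (simp add: \<phi>_def)
    next
      assume q': "q' = \<phi> q"
      have "mobius g (fst q) \<in> H" using q D_iff H by simp
      then show "q' \<in> D \<and> moves p q q'"
        using moves[OF q H_siegel real] unfolding q' \<phi>_def by (simp add: D_iff)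
    qed
  qed
qed

text \<open>The quotient map is open because the saturation of an open set is the union of its
  translates. The translate by p is a preimage under the inverse of p, or is empty when p moves no
  point of the set into D.\<close>

lemma openin_cls_image:
  assumes "openin (top_of_set D) O'"
  shows "openin (Ptop) (cls ` O')"
proof -
  have sub: "O' \<subseteq> D" by (rule openin_imp_subset[OF assms])
  then have tot: "cls ` O' \<subseteq> Ptot" using cls_in_P_tot by blast
  have "\<Union>(cls ` O') = (\<Union>p\<in>level_group a. {q \<in> D. \<exists>q'\<in>O'. moves p q' q})"
  proof (intro equalityI subsetI)
    fix q assume "q \<in> \<Union>(cls ` O')"
    then obtain q' where "q' \<in> O'" "(q', q) \<in> R" by blast
    then show "q \<in> (\<Union>p\<in>level_group a. {q \<in> D. \<exists>q'\<in>O'. moves p q' q})" unfolding R_iff by blast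
  next
    fix q assume "q \<in> (\<Union>p\<in>level_group a. {q \<in> D. \<exists>q'\<in>O'. moves p q' q})"
    then obtain q' where "q' \<in> O'" "(q', q) \<in> R" unfolding R_iff using sub by blast
    then show "q \<in> \<Union>(cls ` O')" by blast
  qed
  moreover have "openin (top_of_set D) {q \<in> D. \<exists>q'\<in>O'. moves p q' q}" if p: "p \<in> level_group a" for p
  proof (cases "{q \<in> D. \<exists>q'\<in>O'. moves p q' q} = {}")
    case True
    then show ?thesis by (simp only: openin_empty)
  next
    case False
    then obtain q0 q0' where q0: "q0 \<in> D" "q0' \<in> O'" "moves p q0' q0" by blast
    obtain r where r: "r \<in> level_group a" "p ** r = mat 1" "r ** p = mat 1"
      using level_group_inverse[OF p] .
    obtain \<phi> where \<phi>: "continuous_on D \<phi>" "\<phi> ` D \<subseteq> D" "\<And>q q'. q \<in> D \<Longrightarrow> q' \<in> D \<and> moves r q q' \<longleftrightarrow> q' = \<phi> q"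
      using level_group_continuous[OF r(1) q0(1) _ moves_inverse[OF q0(3) r(3)]] q0(2) sub by blast
    have "{q \<in> D. \<exists>q'\<in>O'. moves p q' q} = D \<inter> \<phi> -` O'"
    proof (intro equalityI subsetI)
      fix q assume "q \<in> {q \<in> D. \<exists>q'\<in>O'. moves p q' q}"
      then obtain q' where q: "q \<in> D" "q' \<in> O'" "moves p q' q" by blast
      then have "q' = \<phi> q" using \<phi>(3)[of q q'] moves_inverse[OF q(3) r(3)] sub by blast
      then show "q \<in> D \<inter> \<phi> -` O'" using q by auto
    next
      fix q assume q: "q \<in> D \<inter> \<phi> -` O'"
      then have "moves r q (\<phi> q)" using \<phi>(3) by blast
      from moves_inverse[OF this r(2)] show "q \<in> {q \<in> D. \<exists>q'\<in>O'. moves p q' q}" using q by blast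
    qed
    also have "openin (top_of_set D) \<dots>"
      by (rule continuous_openin_preimage[OF \<phi>(1) _ assms]) (use \<phi>(2) in auto)
    finally show ?thesis .
  qed
  ultimately have "openin (top_of_set D) (\<Union>(cls ` O'))" by auto
  then show ?thesis using tot by (simp add: openin_P_top)
qed

lemma openin_P_top_preimage: "V \<subseteq> Ptot \<Longrightarrow> openin (Ptop) V \<longleftrightarrow> openin (top_of_set D) {q \<in> D. cls q \<in> V}"
  by (simp add: openin_P_top Union_preimage)

end

section \<open>The circle bundle\<close>

lemma real_bdot_Im: "rvec x \<Longrightarrow> rvec y \<Longrightarrow> Im (bdot x y) = 0"
  using bdot_in[OF subring_pts(2)] complex_is_Real_iff by blast

lemma Ints_Im: "k \<in> \<int> \<Longrightarrow> Im k = 0"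
  by (elim Ints_cases) simp

lemma pt_shift: "pt \<tau> x y z = (\<sigma>, u, v, w) \<Longrightarrow> (\<sigma>, u, v, w + s) = pt \<tau> x y (z + s / tpi)"
  by (auto simp: pt_def field_simps)

context poincare_family
begin

section \<open>The height and the circle bundle\<close>

definition ht :: "'d point set \<Rightarrow> real" where "ht c = Im (zco (SOME q. q \<in> c))"

text \<open>The shift of z is \<open>bdot m y + k\<close> with m and k integral and y real. So
  -2\<pi> Im z is the logarithm of an invariant norm on the torsor.\<close>

lemma zco_Im_invariant:
  assumes "(q, q') \<in> R"
  shows "Im (zco q) = Im (zco q')"
proof -
  obtain \<tau> x y z where q: "\<tau> \<in> H" "rvec x" "rvec y" "q = pt \<tau> x y z"
    using D_cases R_iff assms by metis
  obtain \<tau>' x' y' z' where q': "\<tau>' \<in> H" "rvec x'" "rvec y'" "q' = pt \<tau>' x' y' z'"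
    using D_cases R_iff assms by metis
  obtain m k where "zvec m" "k \<in> \<int>" "z' = z + bdot m y + k"
    using R_pt_iff[OF q(1) q'(1) q(2,3) q'(2,3)] assms unfolding q(4) q'(4) by blast
  then have "Im z' = Im z" using real_bdot_Im[OF vec_in_Ints_Reals q(3)] Ints_Im by simp
  then show ?thesis
    unfolding q(4) q'(4) coords_pt(3)[OF H_siegel[OF q(1)] q(2,3)] coords_pt(3)[OF H_siegel[OF q'(1)] q'(2,3)]
    by simp
qed

lemma ht_cls: "q \<in> D \<Longrightarrow> ht (cls q) = Im (zco q)"
proof -
  assume "q \<in> D"
  then have "q \<in> cls q" by (rule equiv_class_self[OF R_equiv])
  then have "(SOME p. p \<in> cls q) \<in> cls q" by (rule someI)
  then show ?thesis unfolding ht_def using zco_Im_invariant[of q "SOME p. p \<in> cls q"] by simp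
qed

lemma ht_cpt: "\<tau> \<in> H \<Longrightarrow> rvec x \<Longrightarrow> rvec y \<Longrightarrow> ht (cpt \<tau> x y z) = Im z"
  by (simp add: ht_cls pt_in_D coords_pt H_siegel)

definition Circ :: "'d point set set" where "Circ = {c \<in> Ptot. ht c = 0}"

lemma continuous_map_cls: "continuous_map (top_of_set D) (Ptop) (\<lambda>q. cls q)"
  unfolding continuous_map
proof (intro conjI allI impI)
  show "(\<lambda>q. cls q) ` topspace (top_of_set D) \<subseteq> topspace (Ptop)"
    using cls_in_P_tot by auto
  fix V assume V: "openin (Ptop) V"
  then have "V \<subseteq> Ptot" by (simp add: openin_P_top)
  then show "openin (top_of_set D) {q \<in> topspace (top_of_set D). cls q \<in> V}"
    using V openin_P_top_preimage by simp
qed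

lemma continuous_map_from_P_top:
  fixes f :: "'d point set \<Rightarrow> 'b::topological_space"
  assumes "continuous_on D (\<lambda>q. f (cls q))"
  shows "continuous_map (Ptop) euclidean f"
  unfolding continuous_map
proof (intro conjI allI impI)
  fix V :: "'b set" assume "openin euclidean V"
  then have "open V" by simp
  then have "openin (top_of_set D) (D \<inter> (\<lambda>q. f (cls q)) -` V)"
    by (rule continuous_openin_preimage_gen[OF assms])
  also have "D \<inter> (\<lambda>q. f (cls q)) -` V = {q \<in> D. cls q \<in> {c \<in> Ptot. f c \<in> V}}"
    using cls_in_P_tot by auto
  finally show "openin (Ptop) {c \<in> topspace (Ptop). f c \<in> V}"
    by (subst openin_P_top_preimage) auto
qed simp

lemma D_siegel: "q \<in> D \<Longrightarrow> fst q \<in> siegel"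
  using H_siegel D_iff by blast

lemma ht_continuous: "continuous_map (Ptop) euclideanreal ht"
proof (rule continuous_map_from_P_top)
  have "continuous_on D (\<lambda>q. Im (zco q))"
    by (intro continuous_intros coords_continuous D_siegel)
  then show "continuous_on D (\<lambda>q. ht (cls q))"
    by (rule continuous_on_eq) (simp add: ht_cls)
qed

text \<open>Two logarithms of the same number differ by 2\<pi>i times an integer, which enters z as
  an integer and is absorbed by the block k.\<close>

lemma Cstar_cpt:
  assumes "\<tau> \<in> H" "rvec x" "rvec y"
  shows "Cstar_act \<tau>0 a (exp s) (cpt \<tau> x y z) = cpt \<tau> x y (z + s / tpi)"
proof -
  define S where "S = {(\<sigma>, u, v, w + s') | \<sigma> u v w s'. (\<sigma>, u, v, w) \<in> cpt \<tau> x y z \<and> exp s' = exp s}"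
  have "S \<subseteq> cpt \<tau> x y (z + s / tpi)"
  proof (rule subsetI)
    fix t assume "t \<in> S"
    then obtain \<sigma>' u v w s' where t: "t = (\<sigma>', u, v, w + s')" "(pt \<tau> x y z, (\<sigma>', u, v, w)) \<in> R" "exp s' = exp s"
      by (auto simp: S_def)
    obtain \<sigma> x1 y1 z1 where q: "\<sigma> \<in> H" "rvec x1" "rvec y1" "(\<sigma>', u, v, w) = pt \<sigma> x1 y1 z1"
      using t(2) D_cases R_iff by metis
    obtain g m n k where g: "g \<in> Gam a" "zvec m" "zvec n" "k \<in> \<int>" "(*v) g ` Lag \<tau> = Lag \<sigma>"
      "x1 v* g = x + m" "y1 = g *v y + n" "z1 = z + bdot m y + k"
      using t(2) R_pt_iff[OF assms(1) q(1) assms(2,3) q(2,3)] unfolding q(4) by blast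
    obtain j :: int where j: "s' = s + (of_int (2 * j) * pi) * \<i>" using t(3) unfolding exp_eq by blast
    have "s' / tpi = s / tpi + of_int j" unfolding j by (simp add: field_simps)
    then have "t = pt \<sigma> x1 y1 (z1 + (s / tpi + of_int j))"
      using pt_shift[OF q(4)[symmetric], of s'] t(1) by simp
    moreover have "(pt \<tau> x y (z + s / tpi), pt \<sigma> x1 y1 (z1 + (s / tpi + of_int j))) \<in> R"
      unfolding R_pt_iff[OF assms(1) q(1) assms(2,3) q(2,3)]
      by (intro bexI[OF _ g(1)] exI[of _ m] exI[of _ n] exI[of _ "k + of_int j"]) (use g in auto)
    ultimately show "t \<in> cpt \<tau> x y (z + s / tpi)" by simp
  qed
  moreover have "pt \<tau> x y (z + s / tpi) \<in> S"
  proof -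
    obtain u v w where *: "pt \<tau> x y z = (\<tau>, u, v, w)" by (auto simp: pt_def)
    have "(\<tau>, u, v, w) \<in> cpt \<tau> x y z"
      using equiv_class_self[OF R_equiv pt_in_D[OF assms(1)]] * by metis
    then show ?thesis unfolding pt_shift[OF *, symmetric] S_def by blast
  qed
  ultimately have "R `` S = cpt \<tau> x y (z + s / tpi)" by (rule Image_subset_class)
  then show ?thesis by (simp add: Cstar_act_def S_def)
qed

text \<open>Over a set W so small that equivalent points of W have g = 1 and m = 0, z is defined
  modulo \<int> and exp(2\<pi>i z) descends. The set W leaves z free, so its image V is stable under
  \<open>\<complex>\<^sup>\<times>\<close>.\<close>

lemma circle_subbundle_Circ: "circle_subbundle \<tau>0 a Circ"
  unfolding circle_subbundle_def
proof (intro conjI ballI)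
  show "Circ \<subseteq> Ptot" by (auto simp: Circ_def)
  fix c assume "c \<in> Ptot"
  then obtain \<tau>1 x1 y1 z1 where c: "\<tau>1 \<in> H" "rvec x1" "rvec y1" "c = cpt \<tau>1 x1 y1 z1"
    using P_tot_cases by metis
  obtain U where U: "open U" "\<tau>1 \<in> U"
    "\<And>\<tau> \<tau>' g. \<tau> \<in> U \<inter> siegel \<Longrightarrow> \<tau>' \<in> U \<inter> siegel \<Longrightarrow> g \<in> Gam a \<Longrightarrow>
       (*v) g ` Lag \<tau> \<subseteq> Lag \<tau>' \<Longrightarrow> g = mat 1"
    using Gam_properly_discontinuous[OF H_siegel[OF c(1)]] by blast
  \<comment> \<open>The radius 1/2 ensures that two vectors of the set that differ by an integral
    vector coincide.\<close>
  define B where "B x = {x'. \<forall>i. norm (x' $ i - x $ i) < 1 / 2}" for x :: "complex ^ ('d + 'd)"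
  have openB: "open (B x)" for x
  proof -
    have "B x = (\<Inter>i. {x'. norm (x' $ i - x $ i) < 1 / 2})" by (auto simp: B_def)
    moreover have "open {x'. norm (x' $ i - x $ i) < 1 / 2}" for i
      by (intro open_Collect_less continuous_intros)
    ultimately show ?thesis by auto
  qed
  have B_Ints: "x' = x''" if "x' \<in> B x" "x'' \<in> B x" "zvec (x' - x'')" for x x' x''
  proof -
    have "norm ((x' - x'') $ i) < 1" for i
    proof -
      have "norm ((x' - x'') $ i) \<le> norm (x' $ i - x $ i) + norm (x'' $ i - x $ i)"
        using norm_triangle_ineq4[of "x' $ i - x $ i" "x'' $ i - x $ i"] by simp
      also have "\<dots> < 1 / 2 + 1 / 2" using that(1,2) by (intro add_strict_mono) (auto simp: B_def)
      finally show ?thesis by simp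
    qed
    then have "(x' - x'') $ i = 0" for i using that(3) unfolding vec_in_def by (intro small_Ints_eq_0) auto
    then have "x' - x'' = 0" by (simp add: vec_eq_iff)
    then show ?thesis by simp
  qed
  define W where "W = {q \<in> D. fst q \<in> U \<and> xco q \<in> B x1 \<and> yco q \<in> B y1}"
  have "W = D \<inter> (\<lambda>q. (fst q, xco q, yco q)) -` (U \<times> B x1 \<times> B y1)" by (auto simp: W_def)
  moreover have "continuous_on D (\<lambda>q. (fst q, xco q, yco q))"
    by (intro continuous_intros coords_continuous D_siegel)
  ultimately have openW: "openin (top_of_set D) W"
    using continuous_openin_preimage_gen[of D _ "U \<times> B x1 \<times> B y1"] U(1) openB by (simp add: open_Times)
  have W: "pt \<tau> x y z \<in> W \<longleftrightarrow> \<tau> \<in> U \<and> x \<in> B x1 \<and> y \<in> B y1" if "\<tau> \<in> H" "rvec x" "rvec y" for \<tau> x y z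
    using that by (simp add: W_def pt_in_D coords_pt H_siegel)
  have Wrel: "zco q' - zco q \<in> \<int>" if q: "q \<in> W" "q' \<in> W" "(q, q') \<in> R" for q q'
  proof -
    obtain \<tau> x y z where p: "\<tau> \<in> H" "rvec x" "rvec y" "q = pt \<tau> x y z"
      using D_cases R_iff q(3) by metis
    obtain \<tau>' x' y' z' where p': "\<tau>' \<in> H" "rvec x'" "rvec y'" "q' = pt \<tau>' x' y' z'"
      using D_cases R_iff q(3) by metis
    obtain g m n k where g: "g \<in> Gam a" "zvec m" "zvec n" "k \<in> \<int>" "(*v) g ` Lag \<tau> = Lag \<tau>'"
      "x' v* g = x + m" "y' = g *v y + n" "z' = z + bdot m y + k"
      using R_pt_iff[OF p(1) p'(1) p(2,3) p'(2,3)] q(3) unfolding p(4) p'(4) by blast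
    have b: "\<tau> \<in> U" "x \<in> B x1" "\<tau>' \<in> U" "x' \<in> B x1"
      using q(1,2) W p p' by auto
    have "g = mat 1" using U(3)[of \<tau> \<tau>' g] b g p p' H_siegel by auto
    then have "x' - x = m" using g(6) by simp
    then have "x' = x" using B_Ints[OF b(4,2)] g(2) by simp
    then have "m = 0" using \<open>x' - x = m\<close> by simp
    then show ?thesis
      using g(4,8) p p' by (simp add: coords_pt H_siegel bdot_linear)
  qed
  define V where "V = (\<lambda>q. cls q) ` W"
  define \<psi> where "\<psi> c' = exp (tpi * zco (SOME q. q \<in> W \<and> cls q = c'))" for c'
  have WD: "q \<in> W \<Longrightarrow> q \<in> D" for q by (simp add: W_def)
  have \<psi>: "\<psi> (cls q) = exp (tpi * zco q)" if q: "q \<in> W" for q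
  proof -
    define p where "p = (SOME p. p \<in> W \<and> cls p = cls q)"
    have p: "p \<in> W \<and> cls p = cls q" unfolding p_def by (rule someI[of _ q]) (use q in simp)
    then have "(q, p) \<in> R" using cls_eq_iff[OF WD WD] q by blast
    then obtain j where "zco p - zco q = of_int j" using Wrel q p by (metis Ints_cases)
    then have "zco p = zco q + of_int j" by (simp add: algebra_simps)
    then have "tpi * zco p = tpi * zco q + (of_int (2 * j) * pi) * \<i>" by (simp add: algebra_simps)
    then have "exp (tpi * zco p) = exp (tpi * zco q)" unfolding exp_eq by blast
    then show ?thesis by (simp add: \<psi>_def p_def)
  qed
  have openV: "openin (Ptop) V" unfolding V_def by (rule openin_cls_image[OF openW])
  have Vcases: "\<exists>\<tau> x y z. \<tau> \<in> H \<and> rvec x \<and> rvec y \<and> v = cpt \<tau> x y z \<and> pt \<tau> x y z \<in> W" if v: "v \<in> V" for v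
  proof -
    obtain q where q: "v = cls q" "q \<in> W" using v unfolding V_def by (rule imageE)
    obtain \<tau> x y z where "\<tau> \<in> H" "rvec x" "rvec y" "q = pt \<tau> x y z" using D_cases[OF WD[OF q(2)]] .
    then show ?thesis using q by blast
  qed
  show "\<exists>V \<psi>. openin (Ptop) V \<and> c \<in> V \<and>
        continuous_map (subtopology (Ptop) V) euclidean \<psi> \<and>
        (\<forall>x\<in>V. \<psi> x \<noteq> 0) \<and>
        (\<forall>x\<in>V. \<forall>t. t \<noteq> 0 \<longrightarrow>
           Cstar_act \<tau>0 a t x \<in> V \<and> \<psi> (Cstar_act \<tau>0 a t x) = t * \<psi> x) \<and>
        Circ \<inter> V = {x \<in> V. cmod (\<psi> x) = 1}"
  proof (intro exI conjI ballI allI impI)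
    show "openin (Ptop) V" by (rule openV)
    have "pt \<tau>1 x1 y1 z1 \<in> W" using W c U(2) by (simp add: B_def)
    then show "c \<in> V" unfolding c(4) V_def by blast
    show "continuous_map (subtopology (Ptop) V) euclidean \<psi>"
      unfolding continuous_map
    proof (intro conjI allI impI)
      fix T :: "complex set" assume "openin euclidean T"
      then have T: "open T" by simp
      have "continuous_on W (\<lambda>q. exp (tpi * zco q))"
        by (intro continuous_intros coords_continuous D_siegel WD)
      then have "openin (top_of_set W) (W \<inter> (\<lambda>q. exp (tpi * zco q)) -` T)"
        using T by (rule continuous_openin_preimage_gen)
      then have "openin (top_of_set D) (W \<inter> (\<lambda>q. exp (tpi * zco q)) -` T)"
        by (rule openin_trans[OF _ openW])
      then have "openin (Ptop) ((\<lambda>q. cls q) ` (W \<inter> (\<lambda>q. exp (tpi * zco q)) -` T))"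
        by (rule openin_cls_image)
      moreover have "(\<lambda>q. cls q) ` (W \<inter> (\<lambda>q. exp (tpi * zco q)) -` T) = {v \<in> V. \<psi> v \<in> T}"
        unfolding V_def using \<psi> by auto
      ultimately have "openin (Ptop) {v \<in> V. \<psi> v \<in> T}" by (simp only:)
      moreover have "{v \<in> topspace (subtopology (Ptop) V). \<psi> v \<in> T} = {v \<in> V. \<psi> v \<in> T}"
        using openin_subset[OF openV] by auto
      ultimately show "openin (subtopology (Ptop) V) {v \<in> topspace (subtopology (Ptop) V). \<psi> v \<in> T}"
        unfolding openin_open_subtopology[OF openV] by auto
    qed simp
    fix v assume "v \<in> V"
    then show "\<psi> v \<noteq> 0" by (simp add: \<psi>_def)
    fix t :: complex assume "t \<noteq> 0"
    then obtain s where s: "t = exp s" by (metis exp_Ln)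
    obtain \<tau> x y z where v: "\<tau> \<in> H" "rvec x" "rvec y" "v = cpt \<tau> x y z" "pt \<tau> x y z \<in> W"
      using Vcases \<open>v \<in> V\<close> by blast
    have W': "pt \<tau> x y (z + s / tpi) \<in> W" using v(5) W[OF v(1-3)] by simp
    have act: "Cstar_act \<tau>0 a t v = cpt \<tau> x y (z + s / tpi)" unfolding s v(4) by (rule Cstar_cpt[OF v(1-3)])
    then show "Cstar_act \<tau>0 a t v \<in> V" unfolding V_def using W' by blast
    show "\<psi> (Cstar_act \<tau>0 a t v) = t * \<psi> v"
      unfolding act \<psi>[OF W'] unfolding v(4) \<psi>[OF v(5)] s coords_pt(3)[OF H_siegel[OF v(1)] v(2,3)]
      by (simp add: distrib_left exp_add)
  next
    show "Circ \<inter> V = {x \<in> V. cmod (\<psi> x) = 1}"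
    proof (intro equalityI subsetI)
      fix v assume *: "v \<in> Circ \<inter> V"
      then obtain \<tau> x y z where v: "\<tau> \<in> H" "rvec x" "rvec y" "v = cpt \<tau> x y z" "pt \<tau> x y z \<in> W"
        using Vcases by blast
      have "Im z = 0" using * ht_cpt[OF v(1-3), of z] v(4) by (simp add: Circ_def)
      then have "cmod (\<psi> v) = 1"
        unfolding v(4) \<psi>[OF v(5)] coords_pt(3)[OF H_siegel[OF v(1)] v(2,3)] by simp
      then show "v \<in> {x \<in> V. cmod (\<psi> x) = 1}" using * by simp
    next
      fix v assume *: "v \<in> {x \<in> V. cmod (\<psi> x) = 1}"
      then obtain \<tau> x y z where v: "\<tau> \<in> H" "rvec x" "rvec y" "v = cpt \<tau> x y z" "pt \<tau> x y z \<in> W"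
        using Vcases by blast
      have "cmod (exp (tpi * z)) = 1"
        using * unfolding v(4) by (simp add: \<psi>[OF v(5)] coords_pt(3)[OF H_siegel[OF v(1)] v(2,3)])
      then have "Im z = 0" by simp
      then show "v \<in> Circ \<inter> V"
        using * ht_cpt[OF v(1-3), of z] cpt_in_P_tot[OF v(1)] v(4) by (simp add: Circ_def)
    qed
  qed
qed

section \<open>The vertical flow and the codimension\<close>

definition vshift :: "real \<Rightarrow> 'd point set \<Rightarrow> 'd point set" where
  "vshift r c = Cstar_act \<tau>0 a (exp (of_real (- 2 * pi * r))) c"

lemma vshift_cpt:
  assumes "\<tau> \<in> H" "rvec x" "rvec y"
  shows "vshift r (cpt \<tau> x y z) = cpt \<tau> x y (z + \<i> * of_real r)"
proof -
  have "complex_of_real (- 2 * pi * r) / tpi = \<i> * of_real r" by (simp add: field_simps)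
  then show ?thesis unfolding vshift_def Cstar_cpt[OF assms] by simp
qed

lemma vshift_cls:
  assumes "(\<sigma>, u, v, w) \<in> D"
  shows "vshift r (cls (\<sigma>, u, v, w)) = cls (\<sigma>, u, v, w + of_real (- 2 * pi * r))"
proof -
  obtain \<tau> x y z where q: "\<tau> \<in> H" "rvec x" "rvec y" "(\<sigma>, u, v, w) = pt \<tau> x y z"
    using D_cases assms by metis
  show ?thesis unfolding pt_shift[OF q(4)[symmetric]] q(4) vshift_def Cstar_cpt[OF q(1-3)] ..
qed

text \<open>The product of a quotient map with an identity need not be a quotient map; openness of
  the class map helps instead: a product neighbourhood upstairs is found first and then pushed
  down.\<close>

lemma vshift_continuous:
  "continuous_map (prod_topology (Ptop) euclideanreal) (Ptop) (\<lambda>(c, r). vshift r c)"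
  unfolding continuous_map
proof (intro conjI allI impI)
  show "(\<lambda>(c, r). vshift r c) ` topspace (prod_topology (Ptop) euclideanreal) \<subseteq> topspace (Ptop)"
  proof clarsimp
    fix c r assume "c \<in> Ptot"
    then show "vshift r c \<in> Ptot" using P_tot_cases vshift_cpt cpt_in_P_tot by metis
  qed
  fix V assume V: "openin (Ptop) V"
  have Vsub: "V \<subseteq> Ptot" using openin_subset[OF V] by simp
  define G :: "'d point \<times> real \<Rightarrow> 'd point" where
    "G p = (fst (fst p), fst (snd (fst p)), fst (snd (snd (fst p))), snd (snd (snd (fst p))) + of_real (- 2 * pi * snd p))" for p
  have G: "vshift r (cls q) = cls (G (q, r))" if "q \<in> D" for q r
    using vshift_cls[of "fst q" "fst (snd q)" "fst (snd (snd q))" "snd (snd (snd q))" r] that by (simp add: G_def)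
  have GD: "G ` (D \<times> UNIV) \<subseteq> D" by (auto simp: G_def D_iff)
  have "continuous_on (D \<times> UNIV) G" unfolding G_def by (intro continuous_intros)
  moreover have "openin (top_of_set D) {q \<in> D. cls q \<in> V}" using V openin_P_top_preimage[OF Vsub] by simp
  ultimately have pre: "openin (top_of_set (D \<times> UNIV)) ((D \<times> UNIV) \<inter> G -` {q \<in> D. cls q \<in> V})"
    using GD by (intro continuous_openin_preimage[of _ _ D]) auto
  show "openin (prod_topology (Ptop) euclideanreal)
      {p \<in> topspace (prod_topology (Ptop) euclideanreal). (case p of (c, r) \<Rightarrow> vshift r c) \<in> V}"
    unfolding openin_prod_topology_alt
  proof (intro allI impI)
    fix c r assume "(c, r) \<in> {p \<in> topspace (prod_topology (Ptop) euclideanreal). (case p of (c, r) \<Rightarrow> vshift r c) \<in> V}"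
    then have cr: "c \<in> Ptot" "vshift r c \<in> V" by auto
    obtain q where q: "q \<in> D" "c = cls q" using cr(1) unfolding P_tot_def by (metis quotientE)
    have qr: "(q, r) \<in> (D \<times> UNIV) \<inter> G -` {q \<in> D. cls q \<in> V}"
      using q cr GD G by auto
    obtain N I where NI: "openin (top_of_set D) N" "q \<in> N" "openin (top_of_set UNIV) I" "r \<in> I"
      "N \<times> I \<subseteq> (D \<times> UNIV) \<inter> G -` {q \<in> D. cls q \<in> V}"
      using Times_in_interior_subtopology[OF qr pre] .
    show "\<exists>A B. openin (Ptop) A \<and> openin euclideanreal B \<and> c \<in> A \<and> r \<in> B \<and>
        A \<times> B \<subseteq> {p \<in> topspace (prod_topology (Ptop) euclideanreal). (case p of (c, r) \<Rightarrow> vshift r c) \<in> V}"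
    proof (intro exI conjI)
      show "openin (Ptop) ((\<lambda>q. cls q) ` N)" by (rule openin_cls_image[OF NI(1)])
      show "openin euclideanreal I" using NI(3) by simp
      show "c \<in> (\<lambda>q. cls q) ` N" "r \<in> I" using NI q by auto
      show "((\<lambda>q. cls q) ` N) \<times> I \<subseteq> {p \<in> topspace (prod_topology (Ptop) euclideanreal). (case p of (c, r) \<Rightarrow> vshift r c) \<in> V}"
      proof clarsimp
        fix q' r' assume *: "q' \<in> N" "r' \<in> I"
        then have "(q', r') \<in> (D \<times> UNIV) \<inter> G -` {q \<in> D. cls q \<in> V}" using NI(5) by blast
        then show "cls q' \<in> Ptot \<and> vshift r' (cls q') \<in> V"
          using G cls_in_P_tot by auto
      qed
    qed
  qed
qed

text \<open>The flow splits the whole space: c corresponds to the point of height 0 on its flow line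
  together with \<open>ht c\<close>. The open set of the definition is taken to be all of
  \<open>Ptot\<close>.\<close>

lemma real_codimension_one_Circ: "real_codimension_one (Ptop) Circ"
  unfolding real_codimension_one_def
proof (intro conjI ballI)
  show sub: "Circ \<subseteq> topspace (Ptop)" by (auto simp: Circ_def)
  have Int: "Circ \<inter> Ptot = Circ" using sub by auto
  have sub_id: "subtopology (Ptop) (Ptot) = Ptop"
    using subtopology_topspace[of "Ptop"] by simp
  fix c assume "c \<in> Circ"
  define \<phi> where "\<phi> c = (vshift (- ht c) c, ht c)" for c
  let ?T = "prod_topology (subtopology (Ptop) Circ) euclideanreal"
  have \<phi>_cpt: "\<phi> (cpt \<tau> x y z) = (cpt \<tau> x y (of_real (Re z)), Im z)" if "\<tau> \<in> H" "rvec x" "rvec y" for \<tau> x y z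
  proof -
    have "z + \<i> * of_real (- Im z) = of_real (Re z)" by (simp add: complex_eq_iff)
    then show ?thesis unfolding \<phi>_def ht_cpt[OF that] vshift_cpt[OF that] by simp
  qed
  have "homeomorphic_maps (Ptop) ?T \<phi> (\<lambda>(c, r). vshift r c)"
    unfolding homeomorphic_maps_def
  proof (intro conjI)
    have 1: "continuous_map (Ptop) (Ptop) (\<lambda>c. vshift (- ht c) c)"
    proof -
      have "continuous_map (Ptop) (prod_topology (Ptop) euclideanreal) (\<lambda>c. (c, - ht c))"
        by (intro continuous_map_pairedI continuous_map_id[unfolded id_def] continuous_map_minus ht_continuous)
      from continuous_map_compose[OF this vshift_continuous] show ?thesis by (simp add: o_def)
    qed
    have "vshift (- ht c) c \<in> Circ" if c': "c \<in> Ptot" for c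
    proof -
      obtain \<tau> x y z where c: "\<tau> \<in> H" "rvec x" "rvec y" "c = cpt \<tau> x y z" using P_tot_cases[OF c'] .
      have "vshift (- ht c) c = cpt \<tau> x y (of_real (Re z))" using \<phi>_cpt[OF c(1-3), of z] unfolding c(4) \<phi>_def prod.inject by blast
      then show ?thesis by (simp add: Circ_def cpt_in_P_tot ht_cpt c(1-3))
    qed
    then have "continuous_map (Ptop) (subtopology (Ptop) Circ) (\<lambda>c. vshift (- ht c) c)"
      using 1 by (intro continuous_map_into_subtopology) auto
    then show "continuous_map (Ptop) ?T \<phi>"
      unfolding \<phi>_def by (intro continuous_map_pairedI ht_continuous)
    have "?T = subtopology (prod_topology (Ptop) euclideanreal) (Circ \<times> UNIV)"
      using subtopology_Times[of "Ptop" euclideanreal Circ UNIV] by simp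
    then show "continuous_map ?T (Ptop) (\<lambda>(c, r). vshift r c)"
      using continuous_map_from_subtopology[OF vshift_continuous] by simp
    show "\<forall>c\<in>topspace (Ptop). (case \<phi> c of (c, r) \<Rightarrow> vshift r c) = c"
    proof
      fix c assume "c \<in> topspace (Ptop)"
      then have c': "c \<in> Ptot" by simp
      obtain \<tau> x y z where c: "\<tau> \<in> H" "rvec x" "rvec y" "c = cpt \<tau> x y z" using P_tot_cases[OF c'] .
      have "of_real (Re z) + \<i> * of_real (Im z) = z" by (simp add: complex_eq_iff)
      then show "(case \<phi> c of (c, r) \<Rightarrow> vshift r c) = c"
        unfolding c(4) \<phi>_cpt[OF c(1-3)] prod.case vshift_cpt[OF c(1-3)] by simp
    qed
    show "\<forall>y\<in>topspace ?T. \<phi> (case y of (c, r) \<Rightarrow> vshift r c) = y"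
    proof (clarsimp)
      fix c and r :: real assume "c \<in> Ptot" "c \<in> Circ"
      then obtain \<tau> x y z where c: "\<tau> \<in> H" "rvec x" "rvec y" "c = cpt \<tau> x y z" using P_tot_cases by metis
      have "Im z = 0" using \<open>c \<in> Circ\<close> ht_cpt[OF c(1-3), of z] c(4) by (simp add: Circ_def)
      then have "of_real (Re (z + \<i> * of_real r)) = z" "Im (z + \<i> * of_real r) = r" by (simp_all add: complex_eq_iff)
      then show "\<phi> (vshift r c) = (c, r)"
        unfolding c(4) vshift_cpt[OF c(1-3)] \<phi>_cpt[OF c(1-3)] by simp
    qed
  qed
  then have "homeomorphic_map (Ptop) ?T \<phi>" unfolding homeomorphic_map_maps by blast
  moreover have "\<phi> c = (c, 0)" if c': "c \<in> Circ" for c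
  proof -
    obtain \<tau> x y z where c: "\<tau> \<in> H" "rvec x" "rvec y" "c = cpt \<tau> x y z" using c' P_tot_cases unfolding Circ_def by blast
    have "Im z = 0" using c' ht_cpt[OF c(1-3), of z] c(4) by (simp add: Circ_def)
    then have "of_real (Re z) = z" by (simp add: complex_eq_iff)
    then show ?thesis unfolding c(4) \<phi>_cpt[OF c(1-3)] using \<open>Im z = 0\<close> by simp
  qed
  moreover have "openin (Ptop) (Ptot)" using openin_topspace[of "Ptop"] by simp
  moreover have "c \<in> Ptot" using \<open>c \<in> Circ\<close> by (simp add: Circ_def)
  ultimately show "\<exists>V \<phi>. openin (Ptop) V \<and> c \<in> V \<and>
        homeomorphic_map (subtopology (Ptop) V)
          (prod_topology (subtopology (Ptop) (Circ \<inter> V)) euclideanreal) \<phi> \<and>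
        (\<forall>x\<in>Circ \<inter> V. \<phi> x = (x, 0))"
    by (intro exI[of _ "Ptot"] exI[of _ \<phi>]) (simp add: Int sub_id)
qed

section \<open>Maximal compact subgroups of the fibres\<close>

lemma Circ_fibre:
  assumes "\<tau> \<in> H" "rvec x"
  shows "Circ \<inter> carrier (Fib (cptB \<tau> x)) = {cpt \<tau> x y (of_real r) | y r. rvec y}"
proof (intro equalityI subsetI)
  fix c assume c: "c \<in> Circ \<inter> carrier (Fib (cptB \<tau> x))"
  then obtain y z where y: "rvec y" "c = cpt \<tau> x y z" using fibre_carrier[OF assms] by auto
  then have "Im z = 0" using c ht_cpt[OF assms y(1), of z] by (simp add: Circ_def)
  then have "of_real (Re z) = z" by (simp add: complex_eq_iff)
  then show "c \<in> {cpt \<tau> x y (of_real r) | y r. rvec y}"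
    by (intro CollectI exI[of _ y] exI[of _ "Re z"]) (simp add: y)
next
  fix c assume "c \<in> {cpt \<tau> x y (of_real r) | y r. rvec y}"
  then show "c \<in> Circ \<inter> carrier (Fib (cptB \<tau> x))"
    using assms by (auto simp: Circ_def fibre_carrier cpt_in_P_tot ht_cpt)
qed

lemma Circ_fibre_compact:
  assumes "\<tau> \<in> H" "rvec x"
  shows "compactin (Ptop) {cpt \<tau> x y (of_real r) | y r. rvec y}"
proof -
  let ?f = "\<lambda>p::(real ^ ('d + 'd)) \<times> real. pt \<tau> x (cvec (fst p)) (of_real (snd p))"
  let ?K = "cbox 0 (\<chi> i. 1) \<times> {0..1} :: ((real ^ ('d + 'd)) \<times> real) set"
  have "continuous_on UNIV ?f" by (intro pt_continuous continuous_intros)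
  then have "continuous_map euclidean (top_of_set D) ?f"
    using pt_in_D[OF assms(1)] by (auto simp: continuous_map_in_subtopology)
  from continuous_map_compose[OF this continuous_map_cls]
  have "continuous_map euclidean (Ptop) (\<lambda>p. cls (?f p))" by (simp add: o_def)
  moreover have "compactin euclidean ?K" by (simp add: compact_Times)
  ultimately have "compactin (Ptop) ((\<lambda>p. cls (?f p)) ` ?K)" by (rule image_compactin[rotated])
  moreover have "(\<lambda>p. cls (?f p)) ` ?K = {cpt \<tau> x y (of_real r) | y r. rvec y}"
  proof (intro equalityI subsetI)
    fix c assume "c \<in> {cpt \<tau> x y (of_real r) | y r. rvec y}"
    then obtain y r where c: "rvec y" "c = cpt \<tau> x y (of_real r)" by blast
    define n :: "real ^ ('d + 'd)" where "n = (\<chi> i. frac (Rev y $ i))"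
    have "c = cpt \<tau> x (cvec n) (of_real (frac r))"
      unfolding c(2) cpt_eq_iff[OF assms c(1) vec_in_cvec]
    proof
      have "cvec n $ i - y $ i = of_int (- \<lfloor>Rev y $ i\<rfloor>)" for i
      proof -
        have "y $ i = of_real (Rev y $ i)" using cvec_Rev[OF c(1)] by (metis cvec_def vec_lambda_beta)
        then show ?thesis by (simp add: n_def cvec_def frac_def)
      qed
      then show "zvec (cvec n - y)" by (simp add: vec_in_def)
      have "complex_of_real (frac r) - of_real r = of_int (- \<lfloor>r\<rfloor>)" by (simp add: frac_def)
      then show "complex_of_real (frac r) - of_real r \<in> \<int>" by simp
    qed
    moreover have "(n, frac r) \<in> ?K"
      by (auto simp: mem_box_cart n_def frac_ge_0 less_imp_le[OF frac_lt_1])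
    ultimately show "c \<in> (\<lambda>p. cls (?f p)) ` ?K" by force
  next
    fix c assume "c \<in> (\<lambda>p. cls (?f p)) ` ?K"
    then obtain p where "c = cls (?f p)" by blast
    then show "c \<in> {cpt \<tau> x y (of_real r) | y r. rvec y}" using vec_in_cvec by blast
  qed
  ultimately show ?thesis by simp
qed

text \<open>The height is bounded on a compact set, while the n-th power of an element has n times
  its height; so a compact subgroup has height 0 throughout.\<close>

lemma Circ_maximal_compact:
  assumes "b \<in> Btot"
  shows "maximal_compact_subgroup (Ptop) (Fib b) (Circ \<inter> carrier (Fib b))"
proof -
  obtain \<tau> x where b: "\<tau> \<in> H" "rvec x" "b = cptB \<tau> x" using B_tot_cases[OF assms] .
  let ?G = "Fib (cptB \<tau> x)"
  let ?K = "{cpt \<tau> x y (of_real r) | y r. rvec y}"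
  interpret group ?G using fibre_group assms b(3) by simp
  note car = fibre_carrier[OF b(1,2)]
  have "subgroup ?K ?G"
  proof (rule subgroupI)
    show "?K \<subseteq> carrier ?G" unfolding car by blast
    show "?K \<noteq> {}" using vec_in_0(1) by blast
  next
    fix c assume "c \<in> ?K"
    then obtain y r where c: "rvec y" "c = cpt \<tau> x y (of_real r)" by blast
    show "inv\<^bsub>?G\<^esub> c \<in> ?K" unfolding c(2) fibre_inv[OF b(1,2) c(1)]
      using vec_in_uminus[OF c(1)] of_real_minus by (metis (mono_tags, lifting) mem_Collect_eq)
  next
    fix c c' assume "c \<in> ?K" "c' \<in> ?K"
    then obtain y r y' r' where c: "rvec y" "c = cpt \<tau> x y (of_real r)" "rvec y'" "c' = cpt \<tau> x y' (of_real r')"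
      by blast
    show "c \<otimes>\<^bsub>?G\<^esub> c' \<in> ?K" unfolding c(2,4) fibre_mult[OF b(1,2) c(1,3)]
      using vec_in_ops(1)[OF c(1,3)] of_real_add by (metis (mono_tags, lifting) mem_Collect_eq)
  qed
  moreover have "K' = ?K" if K': "subgroup K' ?G" "compactin (Ptop) K'" "?K \<subseteq> K'" for K'
  proof (intro equalityI K'(3) subsetI)
    fix c assume c: "c \<in> K'"
    then have "c \<in> carrier ?G" using subgroup.subset[OF K'(1)] by blast
    then obtain y z where y: "rvec y" "c = cpt \<tau> x y z" unfolding car by blast
    have "compactin euclideanreal (ht ` K')" by (rule image_compactin[OF K'(2) ht_continuous])
    then have "bounded (ht ` K')" using compact_imp_bounded by simp
    then obtain M where M: "\<And>c. c \<in> K' \<Longrightarrow> \<bar>ht c\<bar> \<le> M" unfolding bounded_iff by auto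
    have "real n * \<bar>Im z\<bar> \<le> M" for n
    proof -
      have "c [^]\<^bsub>?G\<^esub> n \<in> K'"
        by (induction n) (use c K'(1) in \<open>auto simp: subgroup.one_closed subgroup.m_closed\<close>)
      then have "cpt \<tau> x (of_nat n *s y) (of_nat n * z) \<in> K'"
        using fibre_nat_pow[OF b(1,2) y(1)] y(2) by simp
      from M[OF this] show ?thesis
        using ht_cpt[OF b(1,2) vec_in_scale[OF Reals_of_nat y(1)], of n "of_nat n * z"]
        by (simp add: abs_mult)
    qed
    then have "Im z = 0" using reals_Archimedean3[of "\<bar>Im z\<bar>"] by (metis not_less zero_less_abs_iff)
    then have "of_real (Re z) = z" by (simp add: complex_eq_iff)
    then show "c \<in> ?K" by (intro CollectI exI[of _ y] exI[of _ "Re z"]) (simp add: y)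
  qed
  ultimately show ?thesis
    unfolding maximal_compact_subgroup_def b(3) Circ_fibre[OF b(1,2)]
    using Circ_fibre_compact[OF b(1,2)] by blast
qed

end

section \<open>Morphisms and their matrices on lattices\<close>

lemma mat_eq_on_basis:
  fixes A B :: "complex ^ 'n ^ 'm"
  assumes "\<And>j. A *v axis j 1 = B *v axis j 1"
  shows "A = B"
  using assms mvmult_axis by (metis vec_eq_iff)

lemma vec_in_axis [simp]: "zvec (axis j 1)" "rvec (axis j 1)"
  by (auto simp: vec_in_def axis_def)

lemma upt_linear:
  "upt \<tau> (x + y) = upt \<tau> x + upt \<tau> y" "upt \<tau> (x - y) = upt \<tau> x - upt \<tau> y" "upt \<tau> 0 = 0"
  "upt \<tau> (c *s x) = c *s upt \<tau> x"
  by (simp_all add: upt_def vmult_linear vector_add_ldistrib vector_smult_assoc mult.commute)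

lemma upt_matrix: "L *v upt \<tau> n = (\<chi> i j. tpi * (L ** transpose (col_block \<tau>)) $ i $ j) *v n"
  by (simp add: upt_def mvmult_mat_scale mvmult_linear flip: matrix_vector_mul_assoc)

lemma lattice_B_upt: "lattice_B \<tau> = {upt \<tau> n | n. zvec n}"
  by (simp add: lattice_B_def upt_def)

text \<open>Both sides are complex linear in n, so the standard basis, which is integral,
  decides.\<close>

lemma linear_on_lattices:
  assumes "\<And>n. zvec n \<Longrightarrow> L *v upt \<tau> n = row_block \<tau> *v (b *v n)"
  shows "L *v upt \<tau> n = row_block \<tau> *v (b *v n)"
proof -
  have "(\<chi> i j. tpi * (L ** transpose (col_block \<tau>)) $ i $ j) = row_block \<tau> ** b"
    by (rule mat_eq_on_basis) (use assms in \<open>simp add: matrix_vector_mul_assoc flip: upt_matrix\<close>)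
  then show ?thesis unfolding upt_matrix by (simp add: matrix_vector_mul_assoc)
qed

lemma on_lattices_iff: "on_lattices \<tau> b L \<longleftrightarrow> (\<forall>n. L *v upt \<tau> n = row_block \<tau> *v (b *v n))"
  using linear_on_lattices[of L \<tau> b] unfolding on_lattices_def upt_def by blast

text \<open>The columns of b are integral lifts of the images of the lattice basis.\<close>

lemma morphism_BA_matrix:
  assumes "morphism_BA \<tau> L"
  obtains b where "zmat b" "\<And>n. L *v upt \<tau> n = row_block \<tau> *v (b *v n)"
proof -
  have "\<exists>m. zvec m \<and> L *v upt \<tau> (axis j 1) = row_block \<tau> *v m" for j
  proof -
    have "upt \<tau> (axis j 1) \<in> lattice_B \<tau>" unfolding lattice_B_upt using vec_in_axis(1) by blast
    then have "L *v upt \<tau> (axis j 1) \<in> lattice_A \<tau>" using assms by (simp add: morphism_BA_def)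
    then show ?thesis by (auto simp: lattice_A_def)
  qed
  then obtain m where m: "\<And>j. zvec (m j)" "\<And>j. L *v upt \<tau> (axis j 1) = row_block \<tau> *v m j" by metis
  define b where "b = (\<chi> i j. m j $ i)"
  have bj: "b *v axis j 1 = m j" for j by (simp add: vec_eq_iff mvmult_axis b_def)
  have "(\<chi> i j. tpi * (L ** transpose (col_block \<tau>)) $ i $ j) = row_block \<tau> ** b"
    by (rule mat_eq_on_basis) (simp add: m(2) bj flip: upt_matrix matrix_vector_mul_assoc)
  then have "L *v upt \<tau> n = row_block \<tau> *v (b *v n)" for n
    unfolding upt_matrix by (simp add: matrix_vector_mul_assoc)
  moreover have "zmat b" using m(1) by (auto simp: mat_in_def vec_in_def b_def)
  ultimately show ?thesis using that by blast
qed

lemma row_block_matrix_inj: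
  assumes "\<tau> \<in> siegel" "rmat b" "rmat b'" "\<And>n. row_block \<tau> *v (b *v n) = row_block \<tau> *v (b' *v n)"
  shows "b = b'"
proof (rule mat_eq_on_basis)
  fix j
  show "b *v axis j 1 = b' *v axis j 1"
    using assms(4)[of "axis j 1"] row_block_cong_iff[OF assms(1) vec_in_mvmult[OF assms(2)] vec_in_mvmult[OF assms(3)]]
      vec_in_axis(2) by blast
qed

lemma poincare_eq_pt_iff:
  assumes "\<tau> \<in> siegel" "rvec x" "rvec y" "rvec x'" "rvec y'"
  shows "poincare_eq (pt \<tau> x y z) (pt \<tau> x' y' z') \<longleftrightarrow>
    zvec (x' - x) \<and> zvec (y' - y) \<and> z' - z - bdot (x' - x) y \<in> \<int>"
proof -
  have "rmat (mat 1 :: complex ^ 'a lat ^ 'a lat)" by (simp add: mat_in_1)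
  note mv = moves_pt[OF assms(1,1) this Reals_1 _ _ assms(2-5)]
  have id: "(*v) (mat 1) ` S = S" for S :: "(complex ^ 'a lat) set" by (auto simp: image_def)
  have "poincare_eq (pt \<tau> x y z) (pt \<tau> x' y' z') \<longleftrightarrow> (\<exists>m n k. zvec m \<and> zvec n \<and> k \<in> \<int> \<and>
      moves (pmat 1 (mat 1) m n k) (pt \<tau> x y z) (pt \<tau> x' y' z'))"
    unfolding poincare_eq_def Pu_def by blast
  also have "\<dots> \<longleftrightarrow> (\<exists>m n k. zvec m \<and> zvec n \<and> k \<in> \<int> \<and> x' = x + m \<and> y' = y + n \<and> z' = z + bdot m y + k)"
    using mv[OF vec_in_Ints_Reals vec_in_Ints_Reals] by (simp add: id cong: conj_cong)
  also have "\<dots> \<longleftrightarrow> zvec (x' - x) \<and> zvec (y' - y) \<and> z' - z - bdot (x' - x) y \<in> \<int>" (is "?L \<longleftrightarrow> ?R")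
  proof
    assume ?R
    then show ?L
      by (intro exI[of _ "x' - x"] exI[of _ "y' - y"] exI[of _ "z' - z - bdot (x' - x) y"]) simp
  qed auto
  finally show ?thesis .
qed


subsection \<open>A Liouville theorem on complex tori\<close>

text \<open>The modulus of exp h is bounded by its values on a fundamental cube, and Liouville on
  the complex line through u gives constancy. Periodicity is required of the modulus alone because
  the multiplier in the dual argument is a unitary character not yet known to be trivial.\<close>

lemma lattice_periodic_const:
  fixes \<tau> :: "complex ^ 'd ^ 'd"
  assumes \<tau>: "\<tau> \<in> siegel" and h: "holomorphic_wrt J_vec UNIV h"
    and per: "\<And>u m. zvec m \<Longrightarrow> cmod (exp (h (u + upt \<tau> m))) = cmod (exp (h u))"
  shows "exp (h u) = exp (h 0)"
proof -
  have hd: "\<exists>D. (h has_derivative D) (at p) \<and> (\<forall>x. D (\<i> *s x) = \<i> * D x)" for p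
    using h by (auto simp: holomorphic_wrt_def J_vec_def)
  have "isCont h p" for p using hd[of p] has_derivative_continuous by blast
  then have hc: "continuous_on UNIV h" by (simp add: continuous_at_imp_continuous_on)
  let ?F = "\<lambda>r::real ^ ('d + 'd). cmod (exp (h (upt \<tau> (cvec r))))"
  have "continuous_on UNIV (\<lambda>r. upt \<tau> (cvec r))" unfolding upt_def by (intro continuous_intros)
  then have "continuous_on UNIV (\<lambda>r. h (upt \<tau> (cvec r)))"
    by (rule continuous_on_compose2[OF hc]) simp
  then have "continuous_on UNIV ?F" by (intro continuous_on_norm continuous_on_exp)
  then have "continuous_on (cbox 0 (\<chi> i. 1)) ?F" by (rule continuous_on_subset) simp
  then have "bounded (?F ` cbox 0 (\<chi> i. 1))"
    by (intro compact_imp_bounded compact_continuous_image) auto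
  then obtain B where B: "\<And>r. r \<in> cbox 0 (\<chi> i. 1) \<Longrightarrow> ?F r \<le> B" unfolding bounded_iff by auto
  have bound: "cmod (exp (h v)) \<le> B" for v
  proof -
    obtain x where x: "rvec x" "v = upt \<tau> x" using upt_surj[OF \<tau>] .
    define n :: "real ^ ('d + 'd)" where "n = (\<chi> i. frac (Rev x $ i))"
    have "x $ i - cvec n $ i = of_int \<lfloor>Rev x $ i\<rfloor>" for i
    proof -
      have "x $ i = of_real (Rev x $ i)" using cvec_Rev[OF x(1)] by (metis cvec_def vec_lambda_beta)
      then show ?thesis by (simp add: n_def cvec_def frac_def)
    qed
    then have "zvec (x - cvec n)" by (simp add: vec_in_def)
    then have "cmod (exp (h (upt \<tau> (cvec n) + upt \<tau> (x - cvec n)))) = ?F n" by (rule per)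
    moreover have "upt \<tau> (cvec n) + upt \<tau> (x - cvec n) = v" by (simp add: x(2) upt_linear)
    moreover have "n \<in> cbox 0 (\<chi> i. 1)" by (auto simp: mem_box_cart n_def frac_ge_0 less_imp_le[OF frac_lt_1])
    ultimately show ?thesis using B by metis
  qed
  \<comment> \<open>Compatibility of the real derivative D with i turns D(s u) into s D(u), which is
    complex differentiability along the line.\<close>
  have "\<exists>d. ((\<lambda>t. h (t *s u)) has_field_derivative d) (at t)" for t
  proof -
    obtain D where D: "(h has_derivative D) (at (t *s u))" "\<And>x. D (\<i> *s x) = \<i> * D x" using hd by blast
    have lin: "linear D" using D(1) has_derivative_linear by blast
    have "bounded_linear (\<lambda>s. s *s u)"
    proof (rule linear_conv_bounded_linear[THEN iffD1], rule linearI)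
      show "(r *\<^sub>R b) *s u = r *\<^sub>R (b *s u)" for r b by (simp add: vec_eq_iff)
    qed (simp add: vector_sadd_rdistrib)
    then have "((\<lambda>s. s *s u) has_derivative (\<lambda>s. s *s u)) (at t)" by (rule bounded_linear_imp_has_derivative)
    then have "((\<lambda>s. h (s *s u)) has_derivative (\<lambda>s. D (s *s u))) (at t)"
      using D(1) has_derivative_compose by blast
    moreover have "D (s *s u) = s * D u" for s
    proof -
      have "s *s u = Re s *\<^sub>R u + Im s *\<^sub>R (\<i> *s u)" by (simp add: vec_eq_iff complex_eq_iff)
      then have "D (s *s u) = Re s *\<^sub>R D u + Im s *\<^sub>R (\<i> * D u)"
        using lin D(2) by (simp add: linear_add linear_scale)
      also have "\<dots> = s * D u" by (simp add: complex_eq_iff)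
      finally show ?thesis .
    qed
    then have "(\<lambda>s. D (s *s u)) = (*) (D u)" by (simp add: fun_eq_iff mult.commute)
    ultimately have "((\<lambda>s. h (s *s u)) has_field_derivative D u) (at t)"
      by (simp only: has_field_derivative_def)
    then show ?thesis by blast
  qed
  then have "(\<lambda>t. exp (h (t *s u))) holomorphic_on UNIV"
    by (intro holomorphic_on_compose_gen[OF _ holomorphic_on_exp, unfolded o_def])
      (auto simp: holomorphic_on_def field_differentiable_def)
  moreover have "bounded (range (\<lambda>t. exp (h (t *s u))))" using bound by (auto simp: bounded_iff)
  ultimately obtain c where "\<And>t. exp (h (t *s u)) = c"
    using Liouville_theorem unfolding constant_on_def by blast
  from this[of 1] this[of 0] show ?thesis by simp
qed

lemma holomorphic_wrtD:
  "holomorphic_wrt J U f \<Longrightarrow> p \<in> U \<Longrightarrow> \<exists>D. (f has_derivative D) (at p) \<and> (\<forall>x. D (J x) = \<i> * D x)"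
  unfolding holomorphic_wrt_def by blast

lemma holomorphic_wrt_J_vec_add:
  assumes "holomorphic_wrt J_vec UNIV f" "holomorphic_wrt J_vec UNIV g"
  shows "holomorphic_wrt J_vec UNIV (\<lambda>u. f u + g u)"
  unfolding holomorphic_wrt_def
proof
  fix p
  obtain D where "(f has_derivative D) (at p)" "\<forall>x. D (J_vec x) = \<i> * D x"
    using holomorphic_wrtD[OF assms(1) UNIV_I] by blast
  moreover obtain E where "(g has_derivative E) (at p)" "\<forall>x. E (J_vec x) = \<i> * E x"
    using holomorphic_wrtD[OF assms(2) UNIV_I] by blast
  ultimately show "\<exists>D. ((\<lambda>u. f u + g u) has_derivative D) (at p) \<and> (\<forall>x. D (J_vec x) = \<i> * D x)"
    by (intro exI[of _ "\<lambda>x. D x + E x"] conjI has_derivative_add) (auto simp: algebra_simps)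
qed

lemma has_derivative_vec_nth: "((\<lambda>u::complex ^ 'n. u $ i) has_derivative (\<lambda>x. x $ i)) F"
  by (rule bounded_linear_imp_has_derivative[OF bounded_linear_vec_nth])

lemma holomorphic_wrt_linear: "holomorphic_wrt J_vec UNIV (\<lambda>u. bdot v u)"
  unfolding holomorphic_wrt_def
proof
  fix p
  show "\<exists>D. ((\<lambda>u. bdot v u) has_derivative D) (at p) \<and> (\<forall>x. D (J_vec x) = \<i> * D x)"
  proof (intro exI[of _ "\<lambda>x. bdot v x"] conjI allI)
    show "((\<lambda>u. bdot v u) has_derivative (\<lambda>x. bdot v x)) (at p)"
      unfolding bdot_def by (intro has_derivative_sum has_derivative_mult_right has_derivative_vec_nth)
  qed (simp add: J_vec_def bdot_linear)
qed

lemma holomorphic_wrt_quadratic: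
  fixes Q :: "complex ^ 'n ^ 'n"
  shows "holomorphic_wrt J_vec UNIV (\<lambda>u. bdot u (Q *v u))"
  unfolding holomorphic_wrt_def
proof
  fix p :: "complex ^ 'n"
  have "((\<lambda>u. \<Sum>i\<in>UNIV. \<Sum>j\<in>UNIV. Q $ i $ j * (u $ i * u $ j)) has_derivative
      (\<lambda>x. \<Sum>i\<in>UNIV. \<Sum>j\<in>UNIV. Q $ i $ j * (p $ i * x $ j + x $ i * p $ j))) (at p)"
    by (intro has_derivative_sum has_derivative_mult_right has_derivative_mult has_derivative_vec_nth)
  moreover have "bdot u (Q *v u) = (\<Sum>i\<in>UNIV. \<Sum>j\<in>UNIV. Q $ i $ j * (u $ i * u $ j))" for u
    by (simp add: bdot_def matrix_vector_mult_def sum_distrib_left mult_ac)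
  ultimately have "((\<lambda>u. bdot u (Q *v u)) has_derivative
      (\<lambda>x. \<Sum>i\<in>UNIV. \<Sum>j\<in>UNIV. Q $ i $ j * (p $ i * x $ j + x $ i * p $ j))) (at p)" by simp
  moreover have "(\<Sum>i\<in>UNIV. \<Sum>j\<in>UNIV. Q $ i $ j * (p $ i * (\<i> *s x) $ j + (\<i> *s x) $ i * p $ j)) =
      \<i> * (\<Sum>i\<in>UNIV. \<Sum>j\<in>UNIV. Q $ i $ j * (p $ i * x $ j + x $ i * p $ j))" for x :: "complex ^ 'n"
    by (simp add: sum_distrib_left algebra_simps)
  ultimately show "\<exists>D. ((\<lambda>u. bdot u (Q *v u)) has_derivative D) (at p) \<and> (\<forall>x. D (J_vec x) = \<i> * D x)"
    unfolding J_vec_def by blast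
qed

lemma holomorphic_wrt_J_vec_cmult:
  assumes "holomorphic_wrt J_vec UNIV f"
  shows "holomorphic_wrt J_vec UNIV (\<lambda>u. c * f u)"
  unfolding holomorphic_wrt_def
proof
  fix p
  obtain D where "(f has_derivative D) (at p)" "\<forall>x. D (J_vec x) = \<i> * D x"
    using holomorphic_wrtD[OF assms UNIV_I] by blast
  then show "\<exists>D. ((\<lambda>u. c * f u) has_derivative D) (at p) \<and> (\<forall>x. D (J_vec x) = \<i> * D x)"
    by (intro exI[of _ "\<lambda>x. c * D x"] conjI has_derivative_mult_right) auto
qed


subsection \<open>The dual morphism\<close>

lemma exp_eq_Ints: "exp w = exp z \<longleftrightarrow> (w - z) / tpi \<in> \<int>"
proof
  assume "exp w = exp z"
  then obtain n :: int where "w = z + (of_int (2 * n) * pi) * \<i>" unfolding exp_eq by blast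
  then have "(w - z) / tpi = of_int n" by (simp add: field_simps)
  then show "(w - z) / tpi \<in> \<int>" by simp
next
  assume "(w - z) / tpi \<in> \<int>"
  then obtain n where "(w - z) / tpi = of_int n" by (rule Ints_cases)
  then have "w = z + (of_int (2 * n) * pi) * \<i>" by (simp add: field_simps)
  then show "exp w = exp z" unfolding exp_eq by blast
qed

lemma upt_bdot_lower:
  "bdot (upt \<tau> x) (lower m) = tpi * (bdot x m - bdot (upper x) (row_block \<tau> *v m))"
proof -
  have "bdot x m = bdot x (blocks (row_block \<tau> *v m) 0) + bdot x (col_block \<tau> *v lower m)"
    by (subst lat_decomp[of m \<tau>]) (simp add: bdot_linear)
  also have "bdot x (blocks (row_block \<tau> *v m) 0) = bdot (upper x) (row_block \<tau> *v m)"
    by (simp add: bdot_blocks bdot_linear)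
  finally show ?thesis by (simp add: upt_def bdot_linear bdot_vmult)
qed

text \<open>Fix a real x. The isomorphism of the two torsors over B makes exp h, below, an entire
  function that the lattice vector n multiplies by exp 2\<pi>i(\<langle>x, b n\<rangle> +
  \<langle>n, b' x\<rangle>). Reality of the exponent makes this character unitary and Liouville
  makes exp h constant, so the bracket is an integer for all real x, hence zero.\<close>

lemma dual_matrix:
  fixes \<tau> :: "complex ^ 'd ^ 'd"
  assumes \<tau>: "\<tau> \<in> siegel" and dual: "dual_morphism \<tau> L L'"
    and b: "zmat b" "\<And>n. L *v upt \<tau> n = row_block \<tau> *v (b *v n)"
    and b': "zmat b'" "\<And>n. L' *v upt \<tau> n = row_block \<tau> *v (b' *v n)"
  shows "b' = - transpose b"
proof -
  have bR: "rmat b" "rmat b'" using b(1) b'(1) vec_in_Ints_Reals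
    unfolding mat_in_def by (metis Ints_cases Reals_of_int)+
  have key: "bdot x (b *v m) + bdot m (b' *v x) \<in> \<int>" if x: "rvec x" and m: "zvec m" for x m
  proof -
    let ?u = "upt \<tau> x"
    obtain \<phi> where \<phi>: "holomorphic_wrt J_vec UNIV \<phi>"
      "\<And>u1 u2 w1 w2. u2 - u1 \<in> lattice_B \<tau> \<Longrightarrow>
           (poincare_eq (\<tau>, ?u, L *v u1, w1) (\<tau>, ?u, L *v u2, w2) \<longleftrightarrow>
            poincare_eq (\<tau>, u1, L' *v ?u, w1 + \<phi> u1) (\<tau>, u2, L' *v ?u, w2 + \<phi> u2))"
      using dual unfolding dual_morphism_def by blast
    \<comment> \<open>The linear terms account for the passage from w to z on the two sides, as far
      as it is holomorphic in u; what remains is the character.\<close>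
    define h where "h u = \<phi> u + (tpi * bdot (upper x) (L *v u) + bdot (lower (b' *v x)) u)" for u
    have jump: "(h (upt \<tau> x1 + upt \<tau> n) - h (upt \<tau> x1)) / tpi - (bdot x (b *v n) + bdot n (b' *v x)) \<in> \<int>"
      if x1: "rvec x1" and n: "zvec n" for x1 n
    proof -
      let ?u1 = "upt \<tau> x1" and ?u2 = "upt \<tau> (x1 + n)"
      have nR: "rvec n" by (rule vec_in_Ints_Reals[OF n])
      have x1n: "rvec (x1 + n)" using x1 nR by (rule vec_in_ops)
      have pt1: "(\<tau>, ?u, L *v upt \<tau> y, w) = pt \<tau> x (b *v y) ((w + bdot ?u (lower (b *v y))) / tpi)" for y w
        by (simp add: pt_def b(2))
      have pt2: "(\<tau>, upt \<tau> y, L' *v ?u, w) = pt \<tau> y (b' *v x) ((w + bdot (upt \<tau> y) (lower (b' *v x))) / tpi)" for y w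
        by (simp add: pt_def b'(2))
      \<comment> \<open>Chosen to make the two z-coordinates on the first side equal, so that the
        first identification holds with w1 = 0.\<close>
      define w2 where "w2 = - bdot ?u (lower (b *v n))"
      have "?u2 - ?u1 = upt \<tau> n" by (simp add: upt_linear)
      then have lat: "?u2 - ?u1 \<in> lattice_B \<tau>" unfolding lattice_B_upt using n by blast
      have z0: "(w2 + bdot ?u (lower (b *v (x1 + n)))) / tpi - (0 + bdot ?u (lower (b *v x1))) / tpi = 0"
        by (simp add: w2_def mvmult_linear bdot_linear flip: diff_divide_distrib)
      have "zvec (b *v (x1 + n) - b *v x1)"
        using mat_in_mvmult[OF subring_pts(3) b(1) n] by (simp add: mvmult_linear)
      then have "poincare_eq (\<tau>, ?u, L *v ?u1, 0) (\<tau>, ?u, L *v ?u2, w2)"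
        unfolding pt1 poincare_eq_pt_iff[OF \<tau> x vec_in_mvmult[OF bR(1) x1] x vec_in_mvmult[OF bR(1) x1n]]
        by (simp only: z0 diff_self bdot_linear(7) diff_zero vec_in_0 Ints_0 simp_thms)
      then have "poincare_eq (\<tau>, ?u1, L' *v ?u, 0 + \<phi> ?u1) (\<tau>, ?u2, L' *v ?u, w2 + \<phi> ?u2)"
        using \<phi>(2)[OF lat] by blast
      then have "(w2 + \<phi> ?u2 + bdot ?u2 (lower (b' *v x))) / tpi - (0 + \<phi> ?u1 + bdot ?u1 (lower (b' *v x))) / tpi
          - bdot (x1 + n - x1) (b' *v x) \<in> \<int>"
        unfolding pt2 poincare_eq_pt_iff[OF \<tau> x1 vec_in_mvmult[OF bR(2) x] x1n vec_in_mvmult[OF bR(2) x]] by blast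
      moreover have "(w2 + \<phi> ?u2 + bdot ?u2 (lower (b' *v x))) / tpi - (0 + \<phi> ?u1 + bdot ?u1 (lower (b' *v x))) / tpi
          - bdot (x1 + n - x1) (b' *v x) = (h (upt \<tau> x1 + upt \<tau> n) - h (upt \<tau> x1)) / tpi - (bdot x (b *v n) + bdot n (b' *v x))"
      proof -
        have w2: "w2 = tpi * bdot (upper x) (L *v upt \<tau> n) - tpi * bdot x (b *v n)"
          unfolding w2_def upt_bdot_lower b(2) by (simp add: right_diff_distrib)
        have "h (upt \<tau> x1 + upt \<tau> n) - h (upt \<tau> x1) = \<phi> ?u2 - \<phi> ?u1 + tpi * bdot (upper x) (L *v upt \<tau> n)
            + bdot (upt \<tau> n) (lower (b' *v x))"
          by (simp add: h_def upt_linear mvmult_linear bdot_linear bdot_commute algebra_simps)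
        then have eq: "w2 + \<phi> ?u2 + bdot ?u2 (lower (b' *v x)) - (0 + \<phi> ?u1 + bdot ?u1 (lower (b' *v x)))
            = h (upt \<tau> x1 + upt \<tau> n) - h (upt \<tau> x1) - tpi * bdot x (b *v n)"
          by (simp add: w2 upt_linear bdot_linear)
        show ?thesis unfolding diff_divide_distrib[symmetric] eq by (simp add: diff_divide_distrib)
      qed
      ultimately show ?thesis by (simp only:)
    qed
    have holo: "holomorphic_wrt J_vec UNIV h"
    proof -
      have "h = (\<lambda>u. \<phi> u + (tpi * bdot (upper x v* L) u + bdot (lower (b' *v x)) u))"
        by (simp add: h_def fun_eq_iff bdot_vmult)
      then show ?thesis
        by (simp only:) (intro holomorphic_wrt_J_vec_add \<phi>(1) holomorphic_wrt_J_vec_cmult holomorphic_wrt_linear)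
    qed
    have per: "cmod (exp (h (u + upt \<tau> n))) = cmod (exp (h u))" if n: "zvec n" for u n
    proof -
      obtain x1 where x1: "rvec x1" "u = upt \<tau> x1" using upt_surj[OF \<tau>] .
      have "Im (bdot x (b *v n)) = 0" "Im (bdot n (b' *v x)) = 0"
        using x vec_in_Ints_Reals[OF n] bR by (simp_all add: real_bdot_Im vec_in_mvmult)
      then have "Im ((h (u + upt \<tau> n) - h u) / tpi) = 0"
        using Ints_Im[OF jump[OF x1(1) n]] x1(2) by simp
      then have "Re (h (u + upt \<tau> n) - h u) = 0"
        by (simp add: Im_divide power2_eq_square)
      then show ?thesis by simp
    qed
    have "exp (h (upt \<tau> m)) = exp (h 0)" by (rule lattice_periodic_const[OF \<tau> holo per])
    then have "(h (upt \<tau> m) - h 0) / tpi \<in> \<int>" unfolding exp_eq_Ints .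
    moreover have "(h (upt \<tau> m) - h 0) / tpi - (bdot x (b *v m) + bdot m (b' *v x)) \<in> \<int>"
      using jump[OF vec_in_0(1) m] by (simp add: upt_linear)
    ultimately show ?thesis by (metis Ints_diff diff_diff_eq2 add_diff_cancel_left')
  qed
  have "b' $ i $ j = - b $ j $ i" for i j
  proof (rule ccontr)
    assume "b' $ i $ j \<noteq> - b $ j $ i"
    define s where "s = b $ j $ i + b' $ i $ j"
    have s: "s \<noteq> 0" using \<open>b' $ i $ j \<noteq> - b $ j $ i\<close> unfolding s_def by (metis add.commute add_eq_0_iff minus_unique)
    have "s \<in> \<real>" unfolding s_def using bR by (auto simp: mat_in_def)
    \<comment> \<open>Here s is the supposedly nonzero entry; with x scaled by 1 / (2s) the
      integrality in \<open>key\<close> would make 1/2 an integer.\<close>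
    then have "rvec ((1 / (2 * s)) *s axis j 1)" by (intro vec_in_scale) auto
    from key[OF this vec_in_axis(1)[of i]]
    have "(1 / (2 * s)) * s \<in> \<int>"
      by (simp add: bdot_linear mvmult_linear mvmult_axis s_def distrib_left)
    then have "(1 / 2 :: complex) \<in> \<int>" using s by simp
    then obtain k where "(1 / 2 :: complex) = of_int k" by (rule Ints_cases)
    then have "(of_int (2 * k) :: complex) = of_int 1" by (simp add: mult.commute)
    then have "2 * k = 1" unfolding of_int_eq_iff .
    then show False by presburger
  qed
  then show ?thesis by (simp add: vec_eq_iff transpose_def)
qed

text \<open>A real x with b x = 0 spans a real line mapping to 0 in A. Small multiples of x are
  pairwise inequivalent modulo the lattice of B, so the kernel would be infinite.\<close>

lemma isogeny_matrix_injective: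
  fixes \<tau> :: "complex ^ 'd ^ 'd"
  assumes \<tau>: "\<tau> \<in> siegel" and iso: "isogeny_BA \<tau> L"
    and b: "\<And>n. L *v upt \<tau> n = row_block \<tau> *v (b *v n)" and x: "rvec x" "b *v x = 0"
  shows "x = 0"
proof (rule ccontr)
  assume "x \<noteq> 0"
  \<comment> \<open>For s and t between 0 and e all entries of (t - s) x are below 1 in absolute
    value, so that an integral difference vanishes.\<close>
  define e where "e = 1 / (1 + norm x)"
  have e: "e > 0" by (simp add: e_def add_pos_nonneg)
  let ?r = "{(u, v). v - u \<in> lattice_B \<tau>}"
  let ?c = "\<lambda>t::real. ?r `` {upt \<tau> (of_real t *s x)}"
  have zero: "0 \<in> lattice_B \<tau>"
    unfolding lattice_B_upt by (intro CollectI exI[of _ 0]) (simp add: upt_linear)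
  have mem: "?c t \<in> {c \<in> B_var \<tau>. torus_map \<tau> L c = lattice_A \<tau>}" for t
  proof -
    have "?c t \<in> B_var \<tau>" unfolding B_var_def by (intro quotientI) simp
    moreover have "torus_map \<tau> L (?c t) = lattice_A \<tau>"
    proof -
      have Lu: "L *v upt \<tau> (of_real t *s x) = 0" by (simp add: b mvmult_linear x)
      have sub: "L *v l \<in> lattice_A \<tau>" if "l \<in> lattice_B \<tau>" for l
        using iso that by (simp add: isogeny_BA_def morphism_BA_def)
      have in_A: "L *v v \<in> lattice_A \<tau>" if "v - upt \<tau> (of_real t *s x) \<in> lattice_B \<tau>" for v
        using sub[OF that] Lu by (simp add: mvmult_linear)
      have add: "y \<in> lattice_A \<tau>" if yy: "y' \<in> lattice_A \<tau>" "y - y' \<in> lattice_A \<tau>" for y y'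
      proof -
        obtain p q where pq: "y' = row_block \<tau> *v p" "zvec p" "y - y' = row_block \<tau> *v q" "zvec q"
          using yy unfolding lattice_A_def by blast
        then have "y = row_block \<tau> *v (p + q)" by (simp add: mvmult_linear algebra_simps)
        moreover have "zvec (p + q)" using pq by (auto simp: vec_in_def)
        ultimately show ?thesis by (auto simp: lattice_A_def)
      qed
      have z: "0 \<in> (\<lambda>u. L *v u) ` ?c t"
        using Lu zero by (intro image_eqI[of _ _ "upt \<tau> (of_real t *s x)"]) auto
      show ?thesis
        unfolding torus_map_def
      proof (intro equalityI subsetI)
        fix y assume "y \<in> {(x, y). y - x \<in> lattice_A \<tau>} `` ((\<lambda>u. L *v u) ` ?c t)"
        then obtain v where v: "v \<in> ?c t" "y - L *v v \<in> lattice_A \<tau>" by auto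
        then have "L *v v \<in> lattice_A \<tau>" by (intro in_A) simp
        then show "y \<in> lattice_A \<tau>" using add v(2) by blast
      next
        fix y assume "y \<in> lattice_A \<tau>"
        then show "y \<in> {(x, y). y - x \<in> lattice_A \<tau>} `` ((\<lambda>u. L *v u) ` ?c t)"
          by (intro ImageI[OF _ z]) simp
      qed
    qed
    ultimately show ?thesis by simp
  qed
  have inj: "inj_on ?c {0<..<e}"
  proof (rule inj_onI)
    fix s t assume st: "s \<in> {0<..<e}" "t \<in> {0<..<e}" "?c s = ?c t"
    have "upt \<tau> (of_real t *s x) \<in> ?c t" using zero by simp
    then have "upt \<tau> (of_real t *s x) \<in> ?c s" using st(3) by simp
    then obtain n where n: "zvec n" "upt \<tau> (of_real t *s x) - upt \<tau> (of_real s *s x) = upt \<tau> n"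
      unfolding lattice_B_upt by auto
    have "upt \<tau> (of_real (t - s) *s x) = upt \<tau> n"
      using n(2) by (simp add: upt_linear vector_sub_rdistrib)
    then have eq: "of_real (t - s) *s x = n"
      using upt_cong_iff[OF \<tau> vec_in_scale[OF Reals_of_real x(1)] vec_in_Ints_Reals[OF n(1)]] by blast
    have "n $ i = 0" for i
    proof (rule small_Ints_eq_0)
      show "n $ i \<in> \<int>" using n(1) by (simp add: vec_in_def)
      have "norm (n $ i) = \<bar>t - s\<bar> * norm (x $ i)" unfolding eq[symmetric] by (simp add: norm_mult flip: of_real_diff)
      also have "\<dots> \<le> e * norm x" using st by (intro mult_mono Finite_Cartesian_Product.norm_nth_le) auto
      also have "\<dots> < 1" by (simp add: e_def divide_less_eq add_pos_nonneg)
      finally show "norm (n $ i) < 1" .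
    qed
    then have "n = 0" by (simp add: vec_eq_iff)
    obtain i where "x $ i \<noteq> 0" using \<open>x \<noteq> 0\<close> by (auto simp: vec_eq_iff)
    then have "complex_of_real (t - s) = 0" using eq \<open>n = 0\<close> by (metis mult_eq_0_iff vector_smult_component zero_index)
    then show "s = t" by simp
  qed
  have "?c ` {0<..<e} \<subseteq> {c \<in> B_var \<tau>. torus_map \<tau> L c = lattice_A \<tau>}" using mem by blast
  moreover have "finite {c \<in> B_var \<tau>. torus_map \<tau> L c = lattice_A \<tau>}"
    using iso by (simp add: isogeny_BA_def)
  ultimately have "finite (?c ` {0<..<e})" by (rule finite_subset)
  then have "finite {0<..<e}" using inj by (rule finite_imageD)
  then show False using infinite_Ioo[OF e] by blast
qed

text \<open>The kernel of a real matrix is stable under conjugation, so injectivity on real vectors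
  gives it on complex ones; the inverse commutes with conjugation and is therefore real.\<close>

lemma matrix_real_solve:
  fixes b :: "complex ^ 'n ^ 'n"
  assumes "rmat b" and inj: "\<And>x. rvec x \<Longrightarrow> b *v x = 0 \<Longrightarrow> x = 0"
  obtains c where "rmat c" "b ** c = mat 1" "c ** b = mat 1"
proof -
  have zero: "x = 0" if "b *v x = 0" for x
  proof -
    have "b *v cnjv x = 0" using that cnjv_mvmult_real[OF assms(1), of x] by simp
    then have "b *v (x + cnjv x) = 0" "b *v (\<i> *s (x - cnjv x)) = 0" using that by (simp_all add: mvmult_linear)
    moreover have "rvec (x + cnjv x)" "rvec (\<i> *s (x - cnjv x))"
      by (auto simp: vec_in_def cnjv_def complex_is_Real_iff)
    ultimately have "x + cnjv x = 0" "\<i> *s (x - cnjv x) = 0" using inj by blast+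
    then have "x $ i + cnj (x $ i) = 0" "x $ i - cnj (x $ i) = 0" for i
      by (auto simp: vec_eq_iff cnjv_def)
    then show "x = 0" by (auto simp: vec_eq_iff complex_eq_iff)
  qed
  then have "invertible b" by (metis invertible_left_inverse matrix_left_invertible_ker)
  then obtain c where c: "b ** c = mat 1" "c ** b = mat 1" unfolding invertible_def by blast
  have "cnjv (c *v axis j 1) = c *v axis j 1" for j
  proof -
    have "b *v (cnjv (c *v axis j 1) - c *v axis j 1) = cnjv (b *v (c *v axis j 1)) - b *v (c *v axis j 1)"
      by (simp add: mvmult_linear cnjv_mvmult_real[OF assms(1)])
    also have "\<dots> = 0" by (simp add: matrix_vector_mul_assoc c) (simp add: cnjv_def axis_def vec_eq_iff)
    finally show ?thesis using zero by force
  qed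
  then have "cnj (c $ i $ j) = c $ i $ j" for i j
    using mvmult_axis[of c j i] by (metis cnjv_def vec_lambda_beta)
  then have "rmat c" by (simp add: mat_in_def Reals_cnj_iff)
  then show ?thesis using that c by blast
qed

section \<open>The Ribet section\<close>


text \<open>The matrix b is that of f on lattices, and \<open>L0\<close> that of \<alpha> on
  universal covers at \<tau>0. The decomposition of a is kept because it encodes the even diagonal;
  \<open>a_inj\<close> is what the isogeny hypothesis provides.\<close>

locale ribet_family = poincare_family \<tau>0 a
  for \<tau>0 :: "complex ^ 'd ^ 'd" and a :: "complex ^ ('d + 'd) ^ ('d + 'd)" +
  fixes b :: "complex ^ ('d + 'd) ^ ('d + 'd)" and L0 :: "complex ^ 'd ^ 'd"
  assumes bZ: "zmat b" and a_b: "a = b + transpose b"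
    and L0: "\<And>n. L0 *v upt \<tau>0 n = row_block \<tau>0 *v (a *v n)"
    and a_inj: "\<And>x. rvec x \<Longrightarrow> a *v x = 0 \<Longrightarrow> x = 0"
begin

lemma a_sym: "transpose a = a"
  by (simp add: a_b transpose_def vec_eq_iff add.commute)

lemma aZ: "zmat a"
  using bZ by (auto simp: a_b mat_in_def transpose_def)

lemma aR: "rmat a"
  using aZ unfolding mat_in_def by (metis Ints_cases Reals_of_int)

lemma bdot_a: "bdot x (a *v y) = bdot y (a *v x)"
  by (metis a_sym bdot_commute bdot_mvmult)

text \<open>Both summands of a contribute \<langle>m, b m\<rangle>. The resulting integer is the
  block k that accompanies a translation of x by m in \<open>rpt_cong\<close>.\<close>

lemma bdot_a_even:
  assumes "zvec m"
  shows "bdot m (a *v m) / 2 \<in> \<int>"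
proof -
  have "bdot m (transpose b *v m) = bdot m (b *v m)"
    using bdot_mvmult[of b m m] by (simp add: bdot_commute del: transpose_matrix_vector)
  then have "bdot m (a *v m) / 2 = bdot m (b *v m)"
    by (simp add: a_b mvmult_mat_add bdot_linear del: transpose_matrix_vector)
  also have "\<dots> \<in> \<int>" using assms bZ by (intro bdot_in mat_in_mvmult) auto
  finally show ?thesis .
qed

lemma annihilator_iff: "n v* col_block \<tau> = 0 \<longleftrightarrow> (\<forall>m\<in>Lag \<tau>. bdot n m = 0)"
proof
  assume *: "\<forall>m\<in>Lag \<tau>. bdot n m = 0"
  show "n v* col_block \<tau> = 0"
    by (rule bdot_eqI) (use * in \<open>auto simp: bdot_vmult bdot_linear Lag_def\<close>)
qed (auto simp: Lag_def bdot_linear simp flip: bdot_vmult)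

text \<open>Compatibility of \<alpha> with the Hodge filtrations. At \<tau>0 it follows from
  \<open>L0\<close>, since n with \<open>n v* col_block \<tau>0 = 0\<close> has
  \<open>upt \<tau>0 n = 0\<close>; the identity g a g^t = \<mu> a transports it along the
  orbit.\<close>

lemma annihilator_to_Lag:
  assumes "\<tau> \<in> H" "n v* col_block \<tau> = 0"
  shows "a *v n \<in> Lag \<tau>"
proof -
  obtain g \<mu> where g: "(g, \<mu>) \<in> G_alpha_real_plus a" "(*v) g ` Lag \<tau>0 = Lag \<tau>"
    using assms(1) unfolding H_alpha_eq by auto
  then have st: "(g, \<mu>) \<in> Stab a" using G_real_plus_subset G_alpha_subset by blast
  have "\<mu> \<noteq> 0" using st by (auto simp: Stab_iff GSp_iff)
  have "(n v* g) v* col_block \<tau>0 = 0"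
    using assms(2) unfolding annihilator_iff g(2)[symmetric] by (simp add: bdot_vmult)
  then have "row_block \<tau>0 *v (a *v (n v* g)) = 0"
    using L0[of "n v* g"] by (simp add: upt_def mvmult_linear)
  then have "g *v (a *v (n v* g)) \<in> Lag \<tau>" unfolding g(2)[symmetric] by (simp add: Lag_iff)
  then have "\<mu> *s (a *v n) \<in> Lag \<tau>" using st by (simp add: Stab_iff)
  then show ?thesis using \<open>\<mu> \<noteq> 0\<close> by (simp add: Lag_iff mvmult_linear)
qed

text \<open>By the previous lemma the class of a n modulo \<open>Lag \<tau>\<close> depends on
  \<open>upt \<tau> n\<close> only. L is read off on the vectors with upper block 0, which represent
  every value of u.\<close>

lemma L_exists:
  assumes "\<tau> \<in> H"
  obtains L where "\<And>n. L *v upt \<tau> n = row_block \<tau> *v (a *v n)"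
proof -
  define E :: "complex ^ 'd ^ ('d + 'd)" where
    "E = (\<chi> i j. case i of Inl _ \<Rightarrow> 0 | Inr k \<Rightarrow> if k = j then 1 else 0)"
  have E: "E *v u = blocks 0 u" for u
    by (auto simp: E_def blocks_def vec_eq_iff matrix_vector_mult_def if_distribR if_distrib sum.If_cases split: sum.split)
  define L where "L = (\<chi> i j. (1 / tpi) * (row_block \<tau> ** a ** E) $ i $ j)"
  have L: "L *v u = (1 / tpi) *s (row_block \<tau> *v (a *v blocks 0 u))" for u
    unfolding L_def mvmult_mat_scale by (simp add: E flip: matrix_vector_mul_assoc)
  have "L *v upt \<tau> n = row_block \<tau> *v (a *v n)" for n
  proof -
    let ?k = "n - blocks 0 (n v* col_block \<tau>)"
    have "?k v* col_block \<tau> = 0" by (simp add: vmult_col_block vmult_linear)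
    then have "row_block \<tau> *v (a *v ?k) = 0" using annihilator_to_Lag[OF assms] by (simp add: Lag_iff)
    then have "row_block \<tau> *v (a *v n) = row_block \<tau> *v (a *v blocks 0 (n v* col_block \<tau>))"
      by (simp add: mvmult_linear)
    also have "\<dots> = L *v upt \<tau> n"
    proof -
      have "blocks 0 (upt \<tau> n) = tpi *s blocks 0 (n v* col_block \<tau>)"
        by (simp add: upt_def lat_eq_iff)
      then show ?thesis by (simp add: L mvmult_linear vector_smult_assoc)
    qed
    finally show ?thesis by simp
  qed
  then show ?thesis using that by blast
qed

text \<open>In the real coordinates the Ribet section is \<open>x \<mapsto> (x, \<alpha> x, \<langle>x, \<alpha> x\<rangle> / 2)\<close>; \<open>sfun\<close> is the
  corresponding fourth coordinate \<open>w\<close>, a quadratic form in \<open>u\<close> that does not depend on \<open>\<tau>\<close>.\<close>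

definition sfun :: "complex ^ 'd \<Rightarrow> complex" where
  "sfun u = - bdot u (lower (a *v blocks 0 u)) / (2 * tpi)"

lemma sfun_upt:
  assumes "\<tau> \<in> H"
  shows "sfun (upt \<tau> n) = tpi * (bdot n (a *v n) / 2) - bdot (upt \<tau> n) (lower (a *v n))"
proof -
  let ?c = "n v* col_block \<tau>"
  \<comment> \<open>In n = m + k, m has upper block 0 and the same u as n, and k lies in the kernel
    of \<open>upt \<tau>\<close>. Then a k lies in \<open>Lag \<tau>\<close>, so \<langle>k, a
    k\<rangle> = 0 and both cross terms equal \<open>bdot ?c e\<close>.\<close>
  define m where "m = blocks 0 ?c"
  define k where "k = n - m"
  have kc: "k v* col_block \<tau> = 0" by (simp add: k_def m_def vmult_col_block vmult_linear)
  define e where "e = lower (a *v k)"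
  have ak: "a *v k = col_block \<tau> *v e"
    using annihilator_to_Lag[OF assms kc] by (auto simp: e_def Lag_def)
  have n: "n = m + k" by (simp add: k_def)
  have kk: "bdot k (a *v k) = 0" unfolding ak bdot_vmult[symmetric] kc by (simp add: bdot_linear)
  have mk: "bdot m (a *v k) = bdot ?c e"
    unfolding ak by (simp add: m_def bdot_blocks bdot_linear)
  have km: "bdot k (a *v m) = bdot ?c e" using bdot_a[of k m] mk by simp
  have "bdot n (a *v n) = bdot (m + k) (a *v (m + k))" using n by simp
  also have "\<dots> = bdot m (a *v m) + 2 * bdot ?c e"
    unfolding mvmult_linear bdot_linear kk mk km by simp
  finally have 1: "bdot n (a *v n) = bdot m (a *v m) + 2 * bdot ?c e" .
  have mm: "bdot m (a *v m) = bdot ?c (lower (a *v m))" by (simp add: m_def bdot_blocks bdot_linear)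
  have "lower (a *v n) = lower (a *v (m + k))" using n by simp
  also have "\<dots> = lower (a *v m) + e" unfolding mvmult_linear e_def by simp
  finally have 2: "lower (a *v n) = lower (a *v m) + e" .
  have "blocks 0 (upt \<tau> n) = tpi *s m" by (simp add: m_def upt_def lat_eq_iff)
  then have "sfun (upt \<tau> n) = - (tpi * tpi * bdot ?c (lower (a *v m))) / (2 * tpi)"
    by (simp add: sfun_def mvmult_linear bdot_linear) (simp add: upt_def bdot_linear)
  also have "\<dots> = - (tpi * bdot ?c (lower (a *v m)) / 2)" by (simp add: field_simps)
  finally show ?thesis unfolding 1 2 mm by (simp add: upt_def bdot_linear field_simps)
qed

lemma sfun_holomorphic: "holomorphic_wrt J_vec UNIV sfun"
proof -
  define Q where "Q = (\<chi> i j. a $ Inr i $ Inr j)"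
  have "lower (a *v blocks 0 u) = Q *v u" for u
    by (simp add: vec_eq_iff lower_def matrix_vector_mult_def sum_UNIV_Plus blocks_def Q_def)
  then have "sfun = (\<lambda>u. (- 1 / (2 * tpi)) * bdot u (Q *v u))" by (simp add: sfun_def fun_eq_iff)
  then show ?thesis by (simp only:) (intro holomorphic_wrt_J_vec_cmult holomorphic_wrt_quadratic)
qed

abbreviation "rpt \<tau> x \<equiv> cpt \<tau> x (a *v x) (bdot x (a *v x) / 2)"

lemma rpt_eq:
  assumes "\<tau> \<in> H" "\<And>n. L *v upt \<tau> n = row_block \<tau> *v (a *v n)"
  shows "(\<tau>, upt \<tau> x, L *v upt \<tau> x, sfun (upt \<tau> x) + s) = pt \<tau> x (a *v x) (bdot x (a *v x) / 2 + s / tpi)"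
  by (simp add: pt_def assms(2) sfun_upt[OF assms(1)] algebra_simps)

text \<open>The shift \<open>c\<close> is used to compare two sections.\<close>

lemma rpt_cong:
  assumes "\<tau> \<in> H" "\<tau>' \<in> H" "rvec x" "rvec x'" "cptB \<tau> x = cptB \<tau>' x'"
  shows "cpt \<tau> x (a *v x) (bdot x (a *v x) / 2 + c) = cpt \<tau>' x' (a *v x') (bdot x' (a *v x') / 2 + c)"
proof -
  have "((\<tau>, upt \<tau> x), (\<tau>', upt \<tau>' x')) \<in> RB" using assms clsB_eq_iff by blast
  then obtain g m where g: "g \<in> Gam a" "zvec m" "(*v) g ` Lag \<tau> = Lag \<tau>'" "x' v* g = x + m"
    using B_rel_pt_iff assms by blast
  \<comment> \<open>The stabiliser identity with \<mu> = 1. It replaces the quadratic form at x' by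
    that at \<open>x' v* g = x + m\<close>, whose expansion consists of the shift
    \<open>bdot m y\<close> for y = a x and an integer from the even diagonal.\<close>
  have st: "g *v (a *v (n v* g)) = a *v n" for n using Gam_matrix(5)[OF g(1)] by (simp add: Stab_iff)
  have y: "a *v x' = g *v (a *v x) + g *v (a *v m)"
    using st[of x'] unfolding g(4) mvmult_linear by simp
  have "bdot x' (a *v x') = bdot (x' v* g) (a *v (x' v* g))" unfolding bdot_vmult st ..
  also have "\<dots> = bdot x (a *v x) + 2 * bdot m (a *v x) + bdot m (a *v m)"
    unfolding g(4) mvmult_linear bdot_linear bdot_a[of x m] by simp
  finally have z: "bdot x' (a *v x') / 2 = bdot x (a *v x) / 2 + bdot m (a *v x) + bdot m (a *v m) / 2"
    by (simp add: add_divide_distrib)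
  have "zvec (g *v (a *v m))"
    using g(2) aZ Gam_matrix(1)[OF g(1)] by (intro mat_in_mvmult) auto
  then have "(pt \<tau> x (a *v x) (bdot x (a *v x) / 2 + c), pt \<tau>' x' (a *v x') (bdot x' (a *v x') / 2 + c)) \<in> R"
    unfolding R_pt_iff[OF assms(1-3) vec_in_mvmult[OF aR assms(3)] assms(4) vec_in_mvmult[OF aR assms(4)]]
    using g y z bdot_a_even[OF g(2)]
    by (intro bexI[OF _ g(1)] exI[of _ m] exI[of _ "g *v (a *v m)"] exI[of _ "bdot m (a *v m) / 2"]) auto
  then show ?thesis by (rule cls_eqI)
qed

section \<open>Existence and uniqueness of the section\<close>

definition rsec :: "'d bpoint set \<Rightarrow> 'd point set" where
  "rsec = restrict (\<lambda>c. let (\<tau>, x) = (SOME (\<tau>, x). \<tau> \<in> H \<and> rvec x \<and> c = cptB \<tau> x) in rpt \<tau> x)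
     (Btot)"

lemma rsec_cptB:
  assumes "\<tau> \<in> H" "rvec x"
  shows "rsec (cptB \<tau> x) = rpt \<tau> x"
proof -
  define p where "p = (SOME p. fst p \<in> H \<and> rvec (snd p) \<and> cptB \<tau> x = cptB (fst p) (snd p))"
  have p: "fst p \<in> H \<and> rvec (snd p) \<and> cptB \<tau> x = cptB (fst p) (snd p)"
    unfolding p_def by (rule someI[of _ "(\<tau>, x)"]) (use assms in simp)
  have "rsec (cptB \<tau> x) = rpt (fst p) (snd p)"
    using cptB_in_B_tot[OF assms(1)] by (simp add: rsec_def p_def case_prod_unfold Let_def)
  also have "\<dots> = rpt \<tau> x" using rpt_cong[of \<tau> "fst p" x "snd p" 0] p assms by simp
  finally show ?thesis .
qed

lemma rsec_is_ribet_section: "is_ribet_section \<tau>0 a rsec"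
  unfolding is_ribet_section_def
proof (intro conjI ballI)
  show "rsec \<in> extensional (Btot)" by (simp add: rsec_def)
  fix \<tau> assume \<tau>: "\<tau> \<in> H"
  obtain L where L: "\<And>n. L *v upt \<tau> n = row_block \<tau> *v (a *v n)" using L_exists[OF \<tau>] by blast
  have "rsec (clsB (\<tau>, u)) = cls (\<tau>, u, L *v u, sfun u)" for u
  proof -
    obtain x where x: "rvec x" "u = upt \<tau> x" using upt_surj[OF H_siegel[OF \<tau>]] .
    show ?thesis unfolding x(2) rsec_cptB[OF \<tau> x(1)] using rpt_eq[OF \<tau> L, of x 0] by simp
  qed
  moreover have "on_lattices \<tau> a L" using L by (simp add: on_lattices_iff)
  moreover have "exp (sfun 0) = 1" by (simp add: sfun_def bdot_linear)
  ultimately show "\<exists>L s. on_lattices \<tau> a L \<and> holomorphic_wrt J_vec UNIV s \<and> exp (s 0) = 1 \<and>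
        (\<forall>u. rsec (clsB (\<tau>, u)) = cls (\<tau>, u, L *v u, s u))"
    using sfun_holomorphic by blast
qed

text \<open>Over a fixed \<tau> the two sections differ by exp h with h entire. Both descend to B,
  so exp h is periodic under the lattice, constant by Liouville, and 1 by the normalisation at the
  origin.\<close>

lemma ribet_section_unique:
  assumes "is_ribet_section \<tau>0 a r"
  shows "r = rsec"
proof
  fix c
  show "r c = rsec c"
  proof (cases "c \<in> Btot")
    case True
    obtain \<tau> x where c: "\<tau> \<in> H" "rvec x" "c = cptB \<tau> x" using B_tot_cases[OF True] .
    obtain L s where s: "on_lattices \<tau> a L" "holomorphic_wrt J_vec UNIV s" "exp (s 0) = 1"
        "\<And>u. r (clsB (\<tau>, u)) = cls (\<tau>, u, L *v u, s u)"
      using assms c(1) unfolding is_ribet_section_def by blast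
    have L: "L *v upt \<tau> n = row_block \<tau> *v (a *v n)" for n using s(1) by (simp add: on_lattices_iff)
    define h where "h u = s u + (- 1) * sfun u" for u
    have rx: "r (cptB \<tau> y) = cpt \<tau> y (a *v y) (bdot y (a *v y) / 2 + h (upt \<tau> y) / tpi)" for y
      unfolding s(4) using rpt_eq[OF c(1) L, of y "h (upt \<tau> y)"] by (simp add: h_def)
    have per: "exp (h (u + upt \<tau> m)) = exp (h u)" if m: "zvec m" for u m
    proof -
      obtain y where y: "rvec y" "u = upt \<tau> y" using upt_surj[OF H_siegel[OF c(1)]] .
      have ym: "rvec (y + m)" using y(1) vec_in_Ints_Reals[OF m] by (rule vec_in_ops)
      have id: "(*v) (mat 1) ` Lag \<tau> = Lag \<tau>" by (auto simp: image_def)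
      have "((\<tau>, upt \<tau> y), (\<tau>, upt \<tau> (y + m))) \<in> RB"
        unfolding B_rel_pt_iff[OF c(1,1) y(1) ym]
        by (intro bexI[OF _ Gam_one] exI[of _ m]) (simp add: m id)
      then have eq: "cptB \<tau> y = cptB \<tau> (y + m)" by (rule equiv_class_eq[OF B_rel_equiv])
      have "cpt \<tau> y (a *v y) (bdot y (a *v y) / 2 + h (upt \<tau> y) / tpi) =
          cpt \<tau> (y + m) (a *v (y + m)) (bdot (y + m) (a *v (y + m)) / 2 + h (upt \<tau> (y + m)) / tpi)"
        using rx[of y] rx[of "y + m"] eq by simp
      also have "\<dots> = cpt \<tau> y (a *v y) (bdot y (a *v y) / 2 + h (upt \<tau> (y + m)) / tpi)"
        by (rule rpt_cong[OF c(1,1) y(1) ym eq, symmetric])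
      finally have "(bdot y (a *v y) / 2 + h (upt \<tau> (y + m)) / tpi) - (bdot y (a *v y) / 2 + h (upt \<tau> y) / tpi) \<in> \<int>"
        using cpt_eq_iff[OF c(1) y(1) vec_in_mvmult[OF aR y(1)] vec_in_mvmult[OF aR y(1)]] by blast
      then have "(h (upt \<tau> (y + m)) - h (upt \<tau> y)) / tpi \<in> \<int>" by (simp add: diff_divide_distrib)
      then show ?thesis unfolding exp_eq_Ints y(2) upt_linear(1) .
    qed
    have "holomorphic_wrt J_vec UNIV h"
      unfolding h_def by (intro holomorphic_wrt_J_vec_add s(2) holomorphic_wrt_J_vec_cmult sfun_holomorphic)
    then have "exp (h (upt \<tau> x)) = exp (h 0)"
      by (rule lattice_periodic_const[OF H_siegel[OF c(1)]]) (simp add: per)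
    also have "\<dots> = exp 0" using s(3) by (simp add: h_def sfun_def bdot_linear)
    finally have "h (upt \<tau> x) / tpi \<in> \<int>" unfolding exp_eq_Ints by simp
    then have "cpt \<tau> x (a *v x) (bdot x (a *v x) / 2) = cpt \<tau> x (a *v x) (bdot x (a *v x) / 2 + h (upt \<tau> x) / tpi)"
      unfolding cpt_eq_iff[OF c(1,2) vec_in_mvmult[OF aR c(2)] vec_in_mvmult[OF aR c(2)]] by simp
    then show ?thesis unfolding c(3) rx rsec_cptB[OF c(1,2)] by simp
  next
    case False
    then show ?thesis using assms rsec_is_ribet_section
      unfolding is_ribet_section_def by (metis extensional_arb)
  qed
qed

lemma ribet_section_eq: "ribet_section \<tau>0 a = rsec"
  unfolding ribet_section_def using rsec_is_ribet_section ribet_section_unique by (rule the_equality)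

lemma rsec_int_pow:
  assumes "\<tau> \<in> H" "rvec x"
  shows "rsec (cptB \<tau> x) [^]\<^bsub>Fib (cptB \<tau> x)\<^esub> (n::int) =
    cpt \<tau> x (of_int n *s (a *v x)) (of_int n * (bdot x (a *v x) / 2))"
  unfolding rsec_cptB[OF assms] by (rule fibre_int_pow[OF assms vec_in_mvmult[OF aR assms(2)]])


section \<open>The Ribet section is not a torsion translate\<close>

text \<open>The unit of the fibre of K over b puts t(b) itself into the image of the section, and
  the projection to B shows that it is the value at b. So every value of the section would have
  order dividing N.\<close>

lemma not_torsion_translate: "\<not> torsion_translate_of_family \<tau>0 a (ribet_section \<tau>0 a ` Btot)"
proof
  assume "torsion_translate_of_family \<tau>0 a (ribet_section \<tau>0 a ` Btot)"
  then obtain K t and N :: nat where *: "family_of_algebraic_subgroups \<tau>0 a K \<and> N > 0 \<and>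
        (\<forall>b\<in>Btot. t b \<in> carrier (Fib b) \<and>
           t b [^]\<^bsub>Fib b\<^esub> N = \<one>\<^bsub>Fib b\<^esub>) \<and>
        rsec ` Btot = {t b \<otimes>\<^bsub>Fib b\<^esub> h | b h.
               b \<in> Btot \<and> h \<in> K \<inter> carrier (Fib b)}"
    unfolding torsion_translate_of_family_def ribet_section_eq by (elim exE) (rule that, assumption)
  have K: "family_of_algebraic_subgroups \<tau>0 a K" and N: "N > 0" using * by simp_all
  have t: "t b \<in> carrier (Fib b)" "t b [^]\<^bsub>Fib b\<^esub> N = \<one>\<^bsub>Fib b\<^esub>"
    if "b \<in> Btot" for b using * that by simp_all
  have X: "rsec ` Btot = {t b \<otimes>\<^bsub>Fib b\<^esub> h | b h.
               b \<in> Btot \<and> h \<in> K \<inter> carrier (Fib b)}" using * by (elim conjE)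
  obtain c where c: "rmat c" "a ** c = mat 1" "c ** a = mat 1"
    using matrix_real_solve[OF aR a_inj] by blast
  define i :: "'d + 'd" where "i = undefined"
  \<comment> \<open>For a x = y, the N-th power of the value at x has as its y-coordinate half a
    basis vector, which is not integral.\<close>
  define y :: "complex ^ ('d + 'd)" where "y = (1 / (2 * of_nat N)) *s axis i 1"
  have yR: "rvec y" unfolding y_def by (intro vec_in_scale) auto
  define x where "x = c *v y"
  have xR: "rvec x" unfolding x_def by (rule vec_in_mvmult[OF c(1) yR])
  have ax: "a *v x = y" by (simp add: x_def matrix_vector_mul_assoc c)
  define b' where "b' = cptB \<tau>0 x"
  have b': "b' \<in> Btot" unfolding b'_def by (rule cptB_in_B_tot[OF base_in_H])
  interpret grp: group "Fib b'" by (rule fibre_group[OF b'])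
  have "subgroup (K \<inter> carrier (Fib b')) (Fib b')"
    using K b' by (auto simp: family_of_algebraic_subgroups_def)
  then have "\<one>\<^bsub>Fib b'\<^esub> \<in> K \<inter> carrier (Fib b')" by (rule subgroup.one_closed)
  moreover have tb: "t b' \<in> carrier (Fib b')" by (rule t(1)[OF b'])
  then have "t b' = t b' \<otimes>\<^bsub>Fib b'\<^esub> \<one>\<^bsub>Fib b'\<^esub>" by simp
  ultimately have "t b' \<in> rsec ` Btot" unfolding X using b' by blast
  then obtain d where d: "d \<in> Btot" "t b' = rsec d" by blast
  obtain \<sigma> s where s: "\<sigma> \<in> H" "rvec s" "d = cptB \<sigma> s" using B_tot_cases[OF d(1)] .
  have "P_proj \<tau>0 a (t b') = d"
    unfolding d(2) s(3) rsec_cptB[OF s(1,2)] by (rule cls_proj[OF s(1,2) vec_in_mvmult[OF aR s(2)]])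
  moreover have "P_proj \<tau>0 a (t b') = b'" using tb by (simp add: P_fibre_def)
  ultimately have "t b' = rsec b'" using d(2) by simp
  then have "rsec b' [^]\<^bsub>Fib b'\<^esub> N = \<one>\<^bsub>Fib b'\<^esub>" using t(2)[OF b'] by simp
  then have "cpt \<tau>0 x 0 0 = cpt \<tau>0 x (of_nat N *s y) (of_nat N * (bdot x y / 2))"
    unfolding b'_def rsec_cptB[OF base_in_H xR] ax fibre_nat_pow[OF base_in_H xR yR] fibre_one[OF base_in_H xR]
    by simp
  then have "zvec (of_nat N *s y - 0)"
    using cpt_eq_iff[OF base_in_H xR vec_in_0(1) vec_in_scale[OF Reals_of_nat yR]] by blast
  then have "(of_nat N *s y) $ i \<in> \<int>" by (simp add: vec_in_def)
  then have "(1 / 2 :: complex) \<in> \<int>" using N by (simp add: y_def axis_def)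
  then obtain k where "(1 / 2 :: complex) = of_int k" by (rule Ints_cases)
  then have "(of_int (2 * k) :: complex) = of_int 1" by (simp add: mult.commute)
  then have "2 * k = 1" unfolding of_int_eq_iff .
  then show False by presburger
qed

end

section \<open>Density\<close>

text \<open>Move \<open>x\<close> to \<open>x''\<close> with \<open>i\<close>-th coordinate \<open>(AN + 1) / N\<^sup>2\<close>, so that \<open>(1 - AN) x''\<^sub>i\<close> is congruent
  to \<open>1 / N\<^sup>2\<close>. The solutions \<open>x'\<close> of \<open>n a x' \<in> y + \<int>\<^sup>2\<^sup>d\<close> near \<open>x''\<close> form a lattice that gets finer with
  \<open>n\<close>; moving along it by \<open>j (1 - AN) a\<^sup>-\<^sup>1 e\<^sub>i / n\<close> changes \<open>n \<langle>x', a x'\<rangle> / 2\<close> by about \<open>j / N\<^sup>2\<close>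
  modulo 1.\<close>

lemma quadratic_approximation:
  fixes A C :: "real ^ 'n ^ 'n" and x y :: "real ^ 'n" and r e :: real
  assumes C: "A ** C = mat 1" "C ** A = mat 1" and sym: "transpose A = A" and e: "e > 0"
  obtains n :: nat and x' k p where "n > 0" "norm (x' - x) < e" "\<And>i. k $ i \<in> \<int>"
    "real n *\<^sub>R (A *v x') = y + k" "\<bar>real n / 2 * (x' \<bullet> (A *v x')) - r - of_int p\<bar> < e"
proof -
  have AC: "A *v (C *v v) = v" and CA: "C *v (A *v v) = v" for v
    by (simp_all add: matrix_vector_mul_assoc C)
  have Asym: "u \<bullet> (A *v v) = v \<bullet> (A *v u)" for u v by (rule inner_symmetric_matrix[OF sym])
  define i :: 'n where "i = undefined"
  obtain N :: nat where N: "N > 0" "1 / real N < e / 2"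
    using e by (metis nat_approx_posE half_gt_zero zero_less_Suc)
  \<comment> \<open>The integer called A above. The choice of N makes the new coordinate \<theta>
    close enough to the i-th entry of x.\<close>
  define z :: int where "z = \<lfloor>x $ i * N\<rfloor>"
  define \<theta> where "\<theta> = (of_int z * N + 1) / (real N)\<^sup>2"
  \<comment> \<open>An integer with q \<theta> congruent to 1/N^2 modulo \<int>, because (1 - zN)(1
    + zN) = 1 - z^2 N^2.\<close>
  define q where "q = 1 - of_int z * real N"
  have q\<theta>: "q * \<theta> = 1 / (real N)\<^sup>2 - (of_int z)\<^sup>2"
    using N(1) by (simp add: q_def \<theta>_def field_simps power2_eq_square)
  have "\<bar>\<theta> - x $ i\<bar> \<le> 1 / N"
  proof -
    have "of_int z \<le> x $ i * N" "x $ i * N \<le> of_int z + 1" unfolding z_def by linarith+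
    moreover have "0 < 1 / real N" "1 / real N \<le> 1" using N(1) by simp_all
    ultimately have "\<bar>of_int z - x $ i * N + 1 / N\<bar> \<le> 1" by linarith
    moreover have "\<theta> - x $ i = (of_int z - x $ i * N + 1 / N) / N"
      using N(1) by (simp add: \<theta>_def field_simps power2_eq_square)
    ultimately show ?thesis using N(1) by (simp add: abs_divide divide_right_mono)
  qed
  define x2 where "x2 = x + (\<theta> - x $ i) *\<^sub>R axis i 1"
  have x2i: "x2 $ i = \<theta>" by (simp add: x2_def)
  have x2x: "norm (x2 - x) < e / 2"
    using \<open>\<bar>\<theta> - x $ i\<bar> \<le> 1 / N\<close> N(2) by (simp add: x2_def)
  define Q where "Q = (real N)\<^sup>2"
  have Q: "Q > 0" "1 / Q < e / 2"
  proof -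
    show "Q > 0" using N(1) by (simp add: Q_def)
    have "1 / Q \<le> 1 / N" using N(1) by (simp add: Q_def power2_eq_square field_simps)
    then show "1 / Q < e / 2" using N(2) by linarith
  qed
  \<comment> \<open>B will bound d for every admissible j and independently of n, and M bounds C. So
    n can be chosen last: the displacement C d / n is at most M B / n, and the quadratic error at
    most M B^2 / (2n).\<close>
  define B where "B = Q * \<bar>q\<bar> + real CARD('n)"
  define M where "M = (\<Sum>i\<in>UNIV. \<Sum>j\<in>UNIV. norm (C $ i $ j))"
  have B: "B \<ge> 0" and M: "M \<ge> 0" using Q(1) by (simp_all add: B_def M_def sum_nonneg)
  obtain n :: nat where n: "(M * B + M * B\<^sup>2 + 1) / (e / 2) < real n" using reals_Archimedean2 by blast
  have pos: "0 < M * B + M * B\<^sup>2 + 1" using B M by (simp add: add_nonneg_pos)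
  then have n0: "real n > 0" using n e by (meson divide_pos_pos half_gt_zero order_less_trans)
  have small: "(M * B + M * B\<^sup>2 + 1) / real n < e / 2"
    using n n0 e by (simp add: field_simps)
  \<comment> \<open>Subtracting f makes n A x2 - y integral, so that n A x' = y + k can be solved
    with integral k. V is the value then obtained before any step j, up to a term that tends to 0
    with growing n.\<close>
  define f :: "real ^ 'n" where "f = (\<chi> l. frac ((real n *\<^sub>R (A *v x2) - y) $ l))"
  define V where "V = real n / 2 * (x2 \<bullet> (A *v x2)) - x2 \<bullet> f"
  \<comment> \<open>Each step adds 1/Q modulo \<int>, so this number of steps brings V within 1/Q of
    r modulo \<int>.\<close>
  define j where "j = \<lfloor>frac (r - V) * Q\<rfloor>"
  have j0: "j \<ge> 0" using Q(1) by (simp add: j_def frac_ge_0)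
  have jQ: "of_int j \<le> Q"
  proof -
    have "of_int j \<le> frac (r - V) * Q" by (simp add: j_def)
    also have "\<dots> \<le> 1 * Q" using Q(1) frac_lt_1[of "r - V"] by (intro mult_right_mono) auto
    finally show ?thesis by simp
  qed
  have jr: "\<bar>of_int j / Q - frac (r - V)\<bar> \<le> 1 / Q"
  proof -
    have "of_int j \<le> frac (r - V) * Q" "frac (r - V) * Q \<le> of_int j + 1" unfolding j_def by linarith+
    then have "\<bar>of_int j - frac (r - V) * Q\<bar> \<le> 1" by linarith
    moreover have "of_int j / Q - frac (r - V) = (of_int j - frac (r - V) * Q) / Q"
      using Q(1) by (simp add: field_simps)
    ultimately show ?thesis using Q(1) by (simp add: abs_divide divide_right_mono)
  qed
  define d where "d = (of_int j * q) *\<^sub>R axis i 1 - f"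
  define k where "k = real n *\<^sub>R (A *v x2) - y + d"
  define x' where "x' = x2 + (1 / real n) *\<^sub>R (C *v d)"
  have nd: "norm d \<le> B"
  proof -
    have "norm f \<le> (\<Sum>l\<in>UNIV. \<bar>f $ l\<bar>)" by (rule norm_le_l1_cart)
    also have "\<dots> \<le> (\<Sum>l\<in>(UNIV::'n set). 1)"
      by (intro sum_mono) (simp add: f_def frac_ge_0 less_imp_le[OF frac_lt_1])
    finally have "norm f \<le> real CARD('n)" by simp
    moreover have "norm ((of_int j * q) *\<^sub>R axis i (1::real)) \<le> Q * \<bar>q\<bar>"
      using j0 jQ by (simp add: abs_mult mult_right_mono)
    ultimately show ?thesis unfolding d_def B_def by (meson add_mono norm_triangle_ineq4 order_trans)
  qed
  have nC: "norm (C *v d) \<le> M * B"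
    using norm_mvmult_le[of C d] nd M unfolding M_def[symmetric] by (meson mult_left_mono order_trans)
  have kZ: "k $ l \<in> \<int>" for l
  proof -
    have "real n * (A *v x2) $ l - y $ l - f $ l \<in> \<int>"
      by (simp add: f_def frac_def)
    moreover have "of_int j * q * axis i 1 $ l \<in> \<int>" by (auto simp: q_def axis_def)
    moreover have "k $ l = (real n * (A *v x2) $ l - y $ l - f $ l) + of_int j * q * axis i 1 $ l"
      by (simp add: k_def d_def)
    ultimately show ?thesis by (metis Ints_add)
  qed
  have Ax': "real n *\<^sub>R (A *v x') = y + k"
    using n0 by (simp add: x'_def k_def matrix_vector_right_distrib matrix_vector_mult_scaleR AC scaleR_right_distrib)
  have "norm (x' - x2) = norm (C *v d) / real n" using n0 by (simp add: x'_def)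
  also have "\<dots> \<le> (M * B + M * B\<^sup>2 + 1) / real n"
    using nC B M n0 by (intro divide_right_mono) (auto simp: add_increasing2)
  finally have "norm (x' - x2) < e / 2" using small by linarith
  then have near: "norm (x' - x) < e" using x2x norm_triangle_ineq[of "x' - x2" "x2 - x"] by simp
  have val: "real n / 2 * (x' \<bullet> (A *v x')) = V + of_int j / Q - of_int (j * z\<^sup>2) + (C *v d) \<bullet> d / (2 * real n)"
  proof -
    have 1: "(C *v d) \<bullet> (A *v x2) = x2 \<bullet> d" using Asym[of "C *v d" x2] by (simp add: AC)
    have "x' \<bullet> (A *v x') = (x2 + (1 / real n) *\<^sub>R (C *v d)) \<bullet> (A *v x2 + (1 / real n) *\<^sub>R d)"
      by (simp add: x'_def matrix_vector_right_distrib matrix_vector_mult_scaleR AC)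
    also have "\<dots> = x2 \<bullet> (A *v x2) + 2 / real n * (x2 \<bullet> d) + (C *v d) \<bullet> d / (real n)\<^sup>2"
      using n0 by (simp add: inner_add_left inner_add_right 1 power2_eq_square field_simps)
    finally have "real n / 2 * (x' \<bullet> (A *v x')) = real n / 2 * (x2 \<bullet> (A *v x2)) + x2 \<bullet> d + (C *v d) \<bullet> d / (2 * real n)"
      using n0 by (simp add: field_simps power2_eq_square)
    moreover have "x2 \<bullet> d = of_int j * (q * \<theta>) - x2 \<bullet> f"
      by (simp add: d_def inner_diff_right inner_axis x2i mult_ac)
    ultimately show ?thesis unfolding q\<theta> by (simp add: V_def Q_def right_diff_distrib)
  qed
  have rest: "\<bar>(C *v d) \<bullet> d / (2 * real n)\<bar> < e / 2"
  proof -
    have "\<bar>(C *v d) \<bullet> d\<bar> \<le> norm (C *v d) * norm d" by (rule Cauchy_Schwarz_ineq2)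
    also have "\<dots> \<le> (M * B) * B" using nC nd B M by (intro mult_mono) auto
    also have "\<dots> = M * B\<^sup>2" by (simp add: power2_eq_square)
    finally have "\<bar>(C *v d) \<bullet> d / (2 * real n)\<bar> \<le> M * B\<^sup>2 / (2 * real n)"
      using n0 by (simp add: abs_divide divide_right_mono)
    also have "\<dots> \<le> M * B\<^sup>2 / real n" using n0 M by (intro divide_left_mono) auto
    also have "\<dots> \<le> (M * B + M * B\<^sup>2 + 1) / real n" using n0 M B by (intro divide_right_mono) auto
    finally show ?thesis using small by linarith
  qed
  \<comment> \<open>Collects the integers: the floor of r - V, and j z^2 from q \<theta> = 1/N^2 -
    z^2.\<close>
  define p where "p = - \<lfloor>r - V\<rfloor> - j * z\<^sup>2"
  have "real n / 2 * (x' \<bullet> (A *v x')) - r - of_int p =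
      (of_int j / Q - frac (r - V)) + (C *v d) \<bullet> d / (2 * real n)"
    unfolding val p_def frac_def by simp
  then have "\<bar>real n / 2 * (x' \<bullet> (A *v x')) - r - of_int p\<bar> < e"
    using jr rest Q(2) by linarith
  then show ?thesis using that[of n x' k p] n0 near kZ Ax' by simp
qed

lemma bdot_cvec: "bdot (cvec r) (cvec s) = of_real (r \<bullet> s)"
  by (simp add: bdot_def cvec_def inner_vec_def)

lemma cvec_mvmult: "rmat A \<Longrightarrow> cvec (Rem A *v r) = A *v cvec r"
  using cvec_Rev[OF vec_in_mvmult[OF _ vec_in_cvec]] by (metis Rev_Imv_linear(11,12) Rev_Imv_mult(1) diff_zero matrix_vector_mult_0_right)

lemma norm_cvec: "norm (cvec r) = norm r"
proof -
  have "(norm (cvec r))\<^sup>2 = (norm r)\<^sup>2" by (simp add: norm_complex_vec)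
  then show ?thesis by simp
qed

context ribet_family
begin

text \<open>Transfers the real statement to complex vectors with real entries. The value of y is met
  exactly modulo an integral vector; x and z are approximated.\<close>

lemma approximation:
  assumes "rvec x" "rvec y" "e > 0"
  obtains n :: nat and x' k and p :: int and s :: real where "n > 0" "rvec x'" "norm (x' - x) < e"
    "zvec k" "of_nat n *s (a *v x') = y + k"
    "of_nat n * (bdot x' (a *v x') / 2) = of_real s + of_int p" "\<bar>s - r\<bar> < e"
proof -
  obtain c where c: "rmat c" "a ** c = mat 1" "c ** a = mat 1"
    using matrix_real_solve[OF aR a_inj] by blast
  have inj: "cvec u = cvec v \<Longrightarrow> u = v" for u v :: "real ^ ('d + 'd)" by (metis Rev_Imv_linear(11))
  have 1: "Rem a ** Rem c = mat 1" "Rem c ** Rem a = mat 1"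
  proof -
    have "cvec (Rem a *v (Rem c *v v)) = cvec v" "cvec (Rem c *v (Rem a *v v)) = cvec v" for v
      unfolding cvec_mvmult[OF aR] cvec_mvmult[OF c(1)] by (simp_all add: c matrix_vector_mul_assoc)
    then have "(Rem a ** Rem c) *v v = mat 1 *v v" "(Rem c ** Rem a) *v v = mat 1 *v v" for v
      using inj by (auto simp flip: matrix_vector_mul_assoc)
    then show "Rem a ** Rem c = mat 1" "Rem c ** Rem a = mat 1" by (simp_all add: matrix_eq)
  qed
  have sym: "transpose (Rem a) = Rem a"
    using a_sym by (simp add: transpose_def Rem_def vec_eq_iff)
  obtain n :: nat and x' k p where n: "n > 0" "norm (x' - Rev x) < e" "\<And>i. k $ i \<in> \<int>"
    "real n *\<^sub>R (Rem a *v x') = Rev y + k" "\<bar>real n / 2 * (x' \<bullet> (Rem a *v x')) - r - of_int p\<bar> < e"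
    using quadratic_approximation[OF 1 sym assms(3)] by blast
  have x: "x = cvec (Rev x)" and y: "y = cvec (Rev y)" using assms by (simp_all add: cvec_Rev)
  have cadd: "cvec (u + v) = cvec u + cvec v" "cvec (u - v) = cvec u - cvec v" "cvec (t *\<^sub>R u) = of_real t *s cvec u"
    for u v :: "real ^ ('d + 'd)" and t by (simp_all add: cvec_def vec_eq_iff)
  define s where "s = real n / 2 * (x' \<bullet> (Rem a *v x')) - of_int p"
  show ?thesis
  proof (rule that)
    show "n > 0" by (rule n(1))
    show "rvec (cvec x')" by simp
    have "norm (cvec (x' - Rev x)) < e" unfolding norm_cvec by (rule n(2))
    then show "norm (cvec x' - x) < e" unfolding cadd x[symmetric] .
    show "zvec (cvec k)"
      using n(3) unfolding vec_in_def cvec_def by (metis Ints_cases Ints_of_int of_real_of_int_eq vec_lambda_beta)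
    have "cvec (real n *\<^sub>R (Rem a *v x')) = cvec (Rev y + k)" unfolding n(4) ..
    then show "of_nat n *s (a *v cvec x') = y + cvec k" unfolding cadd cvec_mvmult[OF aR] y[symmetric] by simp
    show "of_nat n * (bdot (cvec x') (a *v cvec x') / 2) = of_real s + of_int p"
      by (simp add: bdot_cvec s_def flip: cvec_mvmult[OF aR])
    show "\<bar>s - r\<bar> < e" using n(5) by (simp add: s_def algebra_simps)
  qed
qed

abbreviation "multiples \<equiv> (\<Union>n::int. (\<lambda>b. rsec b [^]\<^bsub>Fib b\<^esub> n) ` Btot)"

lemma multiples_subset_Circ: "multiples \<subseteq> Circ"
proof (rule subsetI)
  fix c assume "c \<in> multiples"
  then obtain n :: int and b' where b': "b' \<in> Btot" "c = rsec b' [^]\<^bsub>Fib b'\<^esub> n" by auto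
  obtain \<tau> x where x: "\<tau> \<in> H" "rvec x" "b' = cptB \<tau> x" using B_tot_cases[OF b'(1)] .
  have ax: "rvec (of_int n *s (a *v x))" by (intro vec_in_scale vec_in_mvmult aR x(2)) auto
  have "Im (bdot x (a *v x)) = 0" by (intro real_bdot_Im vec_in_mvmult aR x(2))
  then have "Im (of_int n * (bdot x (a *v x) / 2)) = 0" by simp
  then show "c \<in> Circ"
    unfolding b'(2) x(3) rsec_int_pow[OF x(1,2)] Circ_def using cpt_in_P_tot[OF x(1)] ht_cpt[OF x(1,2) ax] by simp
qed

text \<open>The coordinates \<tau> and y are held fixed: the approximating multiple has y-coordinate
  y + k with k integral, which gives the same point as y. So only x and the real number r move, each
  by less than e / 2.\<close>

lemma multiples_dense: "Circ \<subseteq> Ptop closure_of multiples"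
proof (rule subsetI)
  fix c assume c: "c \<in> Circ"
  then have "c \<in> Ptot" by (simp add: Circ_def)
  then obtain \<tau> x y z where cc: "\<tau> \<in> H" "rvec x" "rvec y" "c = cpt \<tau> x y z"
    using P_tot_cases by blast
  have "Im z = 0" using c ht_cpt[OF cc(1-3), of z] cc(4) by (simp add: Circ_def)
  define r where "r = Re z"
  have z: "z = of_real r" using \<open>Im z = 0\<close> by (simp add: complex_eq_iff r_def)
  have "\<exists>v. v \<in> multiples \<and> v \<in> T" if T: "c \<in> T" "openin (Ptop) T" for T
  proof -
    have Tsub: "T \<subseteq> Ptot" using openin_subset[OF T(2)] by simp
    let ?g = "\<lambda>p::(complex ^ ('d + 'd)) \<times> real. pt \<tau> (fst p) y (of_real (snd p))"
    have "continuous_on UNIV ?g" by (intro pt_continuous continuous_intros)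
    moreover have "openin (top_of_set D) {q \<in> D. cls q \<in> T}" using T(2) openin_P_top_preimage[OF Tsub] by simp
    ultimately have "openin (top_of_set UNIV) (UNIV \<inter> ?g -` {q \<in> D. cls q \<in> T})"
      using pt_in_D[OF cc(1)] by (intro continuous_openin_preimage[of _ _ D]) auto
    then have op: "open (?g -` {q \<in> D. cls q \<in> T})" by simp
    have xr: "(x, r) \<in> ?g -` {q \<in> D. cls q \<in> T}" using T(1) cc z pt_in_D by simp
    obtain e where e: "e > 0" "\<forall>p. dist p (x, r) < e \<longrightarrow> p \<in> ?g -` {q \<in> D. cls q \<in> T}"
      using op[unfolded open_dist, rule_format, OF xr] by (elim exE conjE)
    have e2: "e / 2 > 0" using e(1) by simp
    obtain n :: nat and x' k and p :: int and s where n: "n > 0" "rvec x'" "norm (x' - x) < e / 2"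
      "zvec k" "of_nat n *s (a *v x') = y + k"
      "of_nat n * (bdot x' (a *v x') / 2) = of_real s + of_int p" "\<bar>s - r\<bar> < e / 2"
      using approximation[OF cc(2,3) e2, where r = r] .
    have "dist (x', s) (x, r) \<le> dist x' x + dist s r"
      by (simp add: dist_Pair_Pair sqrt_sum_squares_le_sum)
    also have "\<dots> < e" using n(3,7) by (simp add: dist_norm)
    finally have inT: "cpt \<tau> x' y (of_real s) \<in> T" using e(2) by fastforce
    have yk: "rvec (y + k)" using cc(3) vec_in_Ints_Reals[OF n(4)] by (rule vec_in_ops)
    have "rsec (cptB \<tau> x') [^]\<^bsub>Fib (cptB \<tau> x')\<^esub> (int n) = cpt \<tau> x' (y + k) (of_real s + of_int p)"
      using rsec_int_pow[OF cc(1) n(2), of "int n"] unfolding of_int_of_nat_eq n(5,6) .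
    also have "\<dots> = cpt \<tau> x' y (of_real s)"
      unfolding cpt_eq_iff[OF cc(1) n(2) yk cc(3)] using n(4) by (simp add: vec_in_def)
    finally have "cpt \<tau> x' y (of_real s) \<in> multiples"
      using cptB_in_B_tot[OF cc(1)] by (metis (no_types, lifting) UN_iff UNIV_I image_eqI)
    then show ?thesis using inT by blast
  qed
  then show "c \<in> Ptop closure_of multiples"
    using \<open>c \<in> Ptot\<close> unfolding in_closure_of by simp
qed

end

theorem mainTheorem4:
  fixes \<tau>0 f f_dual :: "complex ^ 'd ^ 'd"
    and \<alpha>Z :: "complex ^ ('d + 'd) ^ ('d + 'd)"
  assumes "\<tau>0 \<in> siegel"
    and "morphism_BA \<tau>0 f"
    and "dual_morphism \<tau>0 f f_dual"
    and "mat_in \<int> \<alpha>Z"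
    and "on_lattices \<tau>0 \<alpha>Z (f - f_dual)"
    and "isogeny_BA \<tau>0 (f - f_dual)"
  shows "\<not> torsion_translate_of_family \<tau>0 \<alpha>Z (ribet_section \<tau>0 \<alpha>Z ` B_tot \<tau>0 \<alpha>Z) \<and>
    (\<exists>C. circle_subbundle \<tau>0 \<alpha>Z C \<and>
         real_codimension_one (P_top \<tau>0 \<alpha>Z) C \<and>
         (\<forall>b\<in>B_tot \<tau>0 \<alpha>Z. maximal_compact_subgroup (P_top \<tau>0 \<alpha>Z) (P_fibre \<tau>0 \<alpha>Z b)
            (C \<inter> carrier (P_fibre \<tau>0 \<alpha>Z b))) \<and>
         (let U = (\<Union>n::int. (\<lambda>b. ribet_section \<tau>0 \<alpha>Z b [^]\<^bsub>P_fibre \<tau>0 \<alpha>Z b\<^esub> n) ` B_tot \<tau>0 \<alpha>Z)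
          in U \<subseteq> C \<and> C \<subseteq> P_top \<tau>0 \<alpha>Z closure_of U))"
proof -
  have toR: "mat_in \<real> m" if "mat_in \<int> m" for m :: "complex ^ ('d + 'd) ^ ('d + 'd)"
    using that unfolding mat_in_def by (metis Ints_cases Reals_of_int)
  obtain b where b: "mat_in \<int> b" "\<And>n. f *v upt \<tau>0 n = row_block \<tau>0 *v (b *v n)"
    using morphism_BA_matrix[OF assms(2)] by blast
  have "morphism_BA \<tau>0 f_dual" using assms(3) by (simp add: dual_morphism_def)
  then obtain b' where b': "mat_in \<int> b'" "\<And>n. f_dual *v upt \<tau>0 n = row_block \<tau>0 *v (b' *v n)"
    using morphism_BA_matrix by blast
  have dual: "b' = - transpose b" by (rule dual_matrix[OF assms(1,3) b b'])
  have al: "(f - f_dual) *v upt \<tau>0 n = row_block \<tau>0 *v (\<alpha>Z *v n)" for n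
    using assms(5) by (simp add: on_lattices_iff)
  \<comment> \<open>Both matrices induce \<alpha> at \<tau>0, and a real matrix is determined by the
    map it induces; with b' = -b^t this is the decomposition that the locale asks for.\<close>
  have "\<alpha>Z = b - b'"
  proof (rule row_block_matrix_inj[OF assms(1) toR[OF assms(4)]])
    show "mat_in \<real> (b - b')" using toR[OF b(1)] toR[OF b'(1)] by (simp add: mat_in_def)
    fix n
    show "row_block \<tau>0 *v (\<alpha>Z *v n) = row_block \<tau>0 *v ((b - b') *v n)"
      using al[of n] b(2)[of n] b'(2)[of n] by (simp add: matrix_vector_mult_diff_rdistrib mvmult_linear)
  qed
  then have sum: "\<alpha>Z = b + transpose b" using dual by simp
  have inj: "x = 0" if "vec_in \<real> x" "\<alpha>Z *v x = 0" for x
    by (rule isogeny_matrix_injective[OF assms(1,6) al that])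
  interpret ribet_family \<tau>0 \<alpha>Z b "f - f_dual"
    by unfold_locales (use assms(1) b(1) sum al inj in auto)
  show ?thesis
    unfolding Let_def
    using not_torsion_translate circle_subbundle_Circ real_codimension_one_Circ Circ_maximal_compact
      multiples_subset_Circ multiples_dense
    unfolding ribet_section_eq by blast
qed

end
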